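(* A Gray-functor $F:\mathbb A\to\mathbb B$ is a fibration if and only if it satisfies the adjoint-biequivalence-lifting property and each 2-functor $F:\mathbb A(A,B)\to\mathbb B(FA,FB)$ (for objects $A,B$ of $\mathbb A$) is a fibration in $\mathbf{2}\text{-}\mathbf{Cat}$.
   Context: A Gray-category is a category enriched in the category $\mathbf{2}\text{-}\mathbf{Cat}$ of (strict) 2-categories and (strict) 2-functors with the (pseudo) Gray tensor product; Gray-functors are the enriched functors. Juxtaposition denotes composition of 1-cells and whiskering by 1-cells, and $.$ denotes composition of 2-cells in the hom 2-categories. For 2-cells $\alpha:f\to f':A\to B$ and $\beta:g\to g':B\to C$ there is a specified invertible 3-cell $\beta_\alpha:\beta f'.g\alpha\cong g'\alpha.\beta f$. A 1-cell $f$ in a 2-category is an equivalence if there is a 1-cell $g$ in the opposite direction with $gf\cong1$ and $fg\cong 1$; an adjoint equivalence is an adjunction with invertible unit and counit, all of this data being specified. A 2-functor $P:\mathscr E\to\mathscr B$ is a fibration in $\mathbf{2}\text{-}\mathbf{Cat}$ if (a) each equivalence $f:B\to PE$ in $\mathscr B$ lifts to an equivalence $f':E'\to E$ in $\mathscr E$ with $Pf'=f$, and (b) for each 1-cell $f:D\to E$ in $\mathscr E$, each invertible 2-cell $\beta:g\cong Pf$ in $\mathscr B$ lifts to an invertible 2-cell $\beta':g'\cong f$ in $\mathscr E$ with $P\beta'=\beta$. For a Gray-category $\mathbb B$, $\pi_*\mathbb B$ is the ordinary category with the same objects, whose morphisms $B\to C$ are the equivalence classes of objects of the 2-category $\mathbb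 B(B,C)$ (two being identified when equivalent in $\mathbb B(B,C)$). A Gray-functor $F:\mathbb A\to\mathbb B$ is a fibration if each 2-functor $F:\mathbb A(A,B)\to\mathbb B(FA,FB)$ is a fibration in $\mathbf{2}\text{-}\mathbf{Cat}$ and for each $A\in\mathbb A$ and isomorphism $f:B\cong FA$ in $\pi_*\mathbb B$ there is an isomorphism $f':A'\cong A$ in $\pi_*\mathbb A$ with $FA'=B$ and $(\pi_*F)f'=f$. An adjoint biequivalence in a Gray-category consists of 1-cells $f:A\to B$ and $g:B\to A$, adjoint equivalences $\eta:1\to gf$ and $\epsilon:fg\to1$ in the hom 2-categories (including specified right adjoints, units and counits of these), and invertible 3-cells $S:\epsilon f.f\eta\cong1$ and $T:1\cong g\epsilon.\eta g$, such that the composites $$\eta \xrightarrow{(Tf).\eta} g\epsilon f.\eta gf.\eta \xrightarrow{g\epsilon f.\eta_\eta} g\epsilon f.gf\eta.\eta \xrightarrow{(gS).\eta}\eta,$$ $$\epsilon \xrightarrow{\epsilon.(fT)} \epsilon.fg\epsilon.f\eta g \xrightarrow{\epsilon_\epsilon.f\eta g} \epsilon.\epsilon fg.f\eta g \xrightarrow{\epsilon.(Sg)} \epsilon$$ are identities. A Gray-functor $F:\mathbb A\to\mathbb B$ has the adjoint-biequivalence-lifting property if, for each object $A\in\mathbb A$, each $B\in\mathbb B$ and each adjoint biequivalence $(f:B\to FA,\ g:FA\to B,\ \eta,\epsilon,S,T)$ in $\mathbb B$, there exist $A'\in\mathbb A$ and an adjoint biequivalence $(f':A'\to A,\ g':A\to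 A',\ \eta',\epsilon',S',T')$ in $\mathbb A$ which $F$ sends to the given one: $FA'=B$, $Ff'=f$, $Fg'=g$, $F\eta'=\eta$ and $F\epsilon'=\epsilon$ (as adjoint equivalences), $FS'=S$, $FT'=T$. *)

theory Defs
  imports Main
begin

section \<open>Strict 2-categories and 2-functors\<close>

text \<open>
  Cells carry their boundary. Operations are total functions; they are constrained only on
  (composable) cells of the 2-category. Compositions are written in the applicative order.
\<close>

record ('o, 'a, 't) twocat =
  Ob :: "'o set"
  Ar :: "'a set"
  Ce :: "'t set"
  src :: "'a \<Rightarrow> 'o"
  trg :: "'a \<Rightarrow> 'o"
  dom2 :: "'t \<Rightarrow> 'a"
  cod2 :: "'t \<Rightarrow> 'a"
  id1 :: "'o \<Rightarrow> 'a"
  cmp1 :: "'a \<Rightarrow> 'a \<Rightarrow> 'a" (infixr "\<cdot>\<index>" 70)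
  id2 :: "'a \<Rightarrow> 't"
  vcmp :: "'t \<Rightarrow> 't \<Rightarrow> 't" (infixr "\<odot>\<index>" 65)
  hcmp :: "'t \<Rightarrow> 't \<Rightarrow> 't" (infixr "\<star>\<index>" 70)

definition arrow :: "('o, 'a, 't) twocat \<Rightarrow> 'a \<Rightarrow> 'o \<Rightarrow> 'o \<Rightarrow> bool" where
  "arrow C f x y \<longleftrightarrow> f \<in> Ar C \<and> src C f = x \<and> trg C f = y"

definition cell :: "('o, 'a, 't) twocat \<Rightarrow> 't \<Rightarrow> 'a \<Rightarrow> 'a \<Rightarrow> bool" where
  "cell C \<sigma> f g \<longleftrightarrow> \<sigma> \<in> Ce C \<and> dom2 C \<sigma> = f \<and> cod2 C \<sigma> = g"

locale two_category =
  fixes C :: "('o, 'a, 't) twocat" (structure)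
  assumes src_Ob: "f \<in> Ar C \<Longrightarrow> src C f \<in> Ob C"
    and trg_Ob: "f \<in> Ar C \<Longrightarrow> trg C f \<in> Ob C"
    and dom2_Ar: "\<sigma> \<in> Ce C \<Longrightarrow> dom2 C \<sigma> \<in> Ar C"
    and cod2_Ar: "\<sigma> \<in> Ce C \<Longrightarrow> cod2 C \<sigma> \<in> Ar C"
    and src_cod2: "\<sigma> \<in> Ce C \<Longrightarrow> src C (cod2 C \<sigma>) = src C (dom2 C \<sigma>)"
    and trg_cod2: "\<sigma> \<in> Ce C \<Longrightarrow> trg C (cod2 C \<sigma>) = trg C (dom2 C \<sigma>)"
    and id1_arrow: "x \<in> Ob C \<Longrightarrow> arrow C (id1 C x) x x"
    and cmp1_arrow: "arrow C f x y \<Longrightarrow> arrow C g y z \<Longrightarrow> arrow C (g \<cdot> f) x z"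
    and cmp1_id_right: "arrow C f x y \<Longrightarrow> f \<cdot> id1 C x = f"
    and cmp1_id_left: "arrow C f x y \<Longrightarrow> id1 C y \<cdot> f = f"
    and cmp1_assoc: "arrow C f w x \<Longrightarrow> arrow C g x y \<Longrightarrow> arrow C h y z \<Longrightarrow>
          (h \<cdot> g) \<cdot> f = h \<cdot> (g \<cdot> f)"
    and id2_cell: "f \<in> Ar C \<Longrightarrow> cell C (id2 C f) f f"
    and vcmp_cell: "cell C \<sigma> f g \<Longrightarrow> cell C \<tau> g h \<Longrightarrow> cell C (\<tau> \<odot> \<sigma>) f h"
    and vcmp_id_right: "cell C \<sigma> f g \<Longrightarrow> \<sigma> \<odot> id2 C f = \<sigma>"
    and vcmp_id_left: "cell C \<sigma> f g \<Longrightarrow> id2 C g \<odot> \<sigma> = \<sigma>"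
    and vcmp_assoc: "cell C \<rho> e f \<Longrightarrow> cell C \<sigma> f g \<Longrightarrow> cell C \<tau> g h \<Longrightarrow>
          (\<tau> \<odot> \<sigma>) \<odot> \<rho> = \<tau> \<odot> (\<sigma> \<odot> \<rho>)"
    and hcmp_cell: "cell C \<sigma> f f' \<Longrightarrow> cell C \<tau> g g' \<Longrightarrow> trg C f = src C g \<Longrightarrow>
          cell C (\<tau> \<star> \<sigma>) (g \<cdot> f) (g' \<cdot> f')"
    and hcmp_id2: "arrow C f x y \<Longrightarrow> arrow C g y z \<Longrightarrow>
          id2 C g \<star> id2 C f = id2 C (g \<cdot> f)"
    and interchange: "cell C \<sigma> f f' \<Longrightarrow> cell C \<sigma>' f' f'' \<Longrightarrow>
          cell C \<tau> g g' \<Longrightarrow> cell C \<tau>' g' g'' \<Longrightarrow> trg C f = src C g \<Longrightarrow>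
          (\<tau>' \<odot> \<tau>) \<star> (\<sigma>' \<odot> \<sigma>) = (\<tau>' \<star> \<sigma>') \<odot> (\<tau> \<star> \<sigma>)"
    and hcmp_id_right: "cell C \<sigma> f g \<Longrightarrow> \<sigma> \<star> id2 C (id1 C (src C f)) = \<sigma>"
    and hcmp_id_left: "cell C \<sigma> f g \<Longrightarrow> id2 C (id1 C (trg C f)) \<star> \<sigma> = \<sigma>"
    and hcmp_assoc: "cell C \<rho> f f' \<Longrightarrow> cell C \<sigma> g g' \<Longrightarrow> cell C \<tau> h h' \<Longrightarrow>
          trg C f = src C g \<Longrightarrow> trg C g = src C h \<Longrightarrow>
          (\<tau> \<star> \<sigma>) \<star> \<rho> = \<tau> \<star> (\<sigma> \<star> \<rho>)"

record ('o, 'a, 't, 'p, 'b, 'u) twofun =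
  on_ob :: "'o \<Rightarrow> 'p"
  on_ar :: "'a \<Rightarrow> 'b"
  on_ce :: "'t \<Rightarrow> 'u"

locale two_functor =
  source: two_category C + target: two_category D
  for C :: "('o, 'a, 't) twocat" and D :: "('p, 'b, 'u) twocat" +
  fixes P :: "('o, 'a, 't, 'p, 'b, 'u) twofun"
  assumes map_ob: "x \<in> Ob C \<Longrightarrow> on_ob P x \<in> Ob D"
    and map_ar: "arrow C f x y \<Longrightarrow> arrow D (on_ar P f) (on_ob P x) (on_ob P y)"
    and map_ce: "cell C \<sigma> f g \<Longrightarrow> cell D (on_ce P \<sigma>) (on_ar P f) (on_ar P g)"
    and map_id1: "x \<in> Ob C \<Longrightarrow> on_ar P (id1 C x) = id1 D (on_ob P x)"
    and map_cmp1: "arrow C f x y \<Longrightarrow> arrow C g y z \<Longrightarrow>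
          on_ar P (g \<cdot>\<^bsub>C\<^esub> f) = on_ar P g \<cdot>\<^bsub>D\<^esub> on_ar P f"
    and map_id2: "f \<in> Ar C \<Longrightarrow> on_ce P (id2 C f) = id2 D (on_ar P f)"
    and map_vcmp: "cell C \<sigma> f g \<Longrightarrow> cell C \<tau> g h \<Longrightarrow>
          on_ce P (\<tau> \<odot>\<^bsub>C\<^esub> \<sigma>) = on_ce P \<tau> \<odot>\<^bsub>D\<^esub> on_ce P \<sigma>"
    and map_hcmp: "cell C \<sigma> f f' \<Longrightarrow> cell C \<tau> g g' \<Longrightarrow> trg C f = src C g \<Longrightarrow>
          on_ce P (\<tau> \<star>\<^bsub>C\<^esub> \<sigma>) = on_ce P \<tau> \<star>\<^bsub>D\<^esub> on_ce P \<sigma>"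


section \<open>Equivalences, adjoint equivalences and fibrations of 2-categories\<close>

definition invertible_cell :: "('o, 'a, 't) twocat \<Rightarrow> 't \<Rightarrow> 'a \<Rightarrow> 'a \<Rightarrow> bool" where
  "invertible_cell C \<sigma> f g \<longleftrightarrow> cell C \<sigma> f g \<and>
     (\<exists>\<tau>. cell C \<tau> g f \<and> \<tau> \<odot>\<^bsub>C\<^esub> \<sigma> = id2 C f \<and> \<sigma> \<odot>\<^bsub>C\<^esub> \<tau> = id2 C g)"

definition equivalence :: "('o, 'a, 't) twocat \<Rightarrow> 'a \<Rightarrow> 'o \<Rightarrow> 'o \<Rightarrow> bool" where
  "equivalence C f x y \<longleftrightarrow> arrow C f x y \<and>
     (\<exists>g. arrow C g y x \<and>
        (\<exists>\<sigma>. invertible_cell C \<sigma> (g \<cdot>\<^bsub>C\<^esub> f) (id1 C x)) \<and>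
        (\<exists>\<tau>. invertible_cell C \<tau> (f \<cdot>\<^bsub>C\<^esub> g) (id1 C y)))"

definition equivalent_obs :: "('o, 'a, 't) twocat \<Rightarrow> 'o \<Rightarrow> 'o \<Rightarrow> bool" where
  "equivalent_obs C x y \<longleftrightarrow> (\<exists>f. equivalence C f x y)"

record ('a, 't) adjeq =
  ladj :: 'a
  radj :: 'a
  adj_unit :: 't
  adj_counit :: 't

definition adjoint_equivalence ::
    "('o, 'a, 't) twocat \<Rightarrow> ('a, 't) adjeq \<Rightarrow> 'o \<Rightarrow> 'o \<Rightarrow> bool" where
  "adjoint_equivalence C e x y \<longleftrightarrow>
     arrow C (ladj e) x y \<and> arrow C (radj e) y x \<and>
     invertible_cell C (adj_unit e) (id1 C x) (radj e \<cdot>\<^bsub>C\<^esub> ladj e) \<and>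
     invertible_cell C (adj_counit e) (ladj e \<cdot>\<^bsub>C\<^esub> radj e) (id1 C y) \<and>
     (adj_counit e \<star>\<^bsub>C\<^esub> id2 C (ladj e)) \<odot>\<^bsub>C\<^esub> (id2 C (ladj e) \<star>\<^bsub>C\<^esub> adj_unit e)
       = id2 C (ladj e) \<and>
     (id2 C (radj e) \<star>\<^bsub>C\<^esub> adj_counit e) \<odot>\<^bsub>C\<^esub> (adj_unit e \<star>\<^bsub>C\<^esub> id2 C (radj e))
       = id2 C (radj e)"

definition two_fibration :: "('o, 'a, 't) twocat \<Rightarrow> ('p, 'b, 'u) twocat \<Rightarrow>
    ('o, 'a, 't, 'p, 'b, 'u) twofun \<Rightarrow> bool" where
  "two_fibration E B P \<longleftrightarrow> two_functor E B P \<and>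
     (\<forall>e b f. e \<in> Ob E \<longrightarrow> equivalence B f b (on_ob P e) \<longrightarrow>
        (\<exists>e' f'. equivalence E f' e' e \<and> on_ob P e' = b \<and> on_ar P f' = f)) \<and>
     (\<forall>f g \<beta>. f \<in> Ar E \<longrightarrow> invertible_cell B \<beta> g (on_ar P f) \<longrightarrow>
        (\<exists>g' \<beta>'. invertible_cell E \<beta>' g' f \<and> on_ar P g' = g \<and> on_ce P \<beta>' = \<beta>))"


section \<open>2-functors out of a Gray tensor product\<close>

text \<open>
  The Gray tensor product of \<open>C\<close> and \<open>D\<close> is generated by the objects \<open>(x, y)\<close>, the 1-cells
  \<open>(f, y)\<close> and \<open>(x, g)\<close>, the 2-cells \<open>(\<sigma>, y)\<close> and \<open>(x, \<tau>)\<close>, and invertible 2-cells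
  \<open>(f, y').(x, g) \<cong> (x', g).(f, y)\<close> for \<open>f : x \<rightarrow> x'\<close> and \<open>g : y \<rightarrow> y'\<close>. A 2-functor from it
  to \<open>E\<close> is thus given by its values on these generators, subject to the defining relations.
  In the field names, \<open>o\<close>, \<open>a\<close>, \<open>t\<close> stand for an object, a 1-cell, a 2-cell in the respective
  variable; \<open>on_aa\<close> gives the values on the structural invertible 2-cells.
\<close>

record ('o, 'a, 't, 'p, 'b, 'u, 'q, 'c, 'v) graymap =
  on_oo :: "'o \<Rightarrow> 'p \<Rightarrow> 'q"
  on_ao :: "'a \<Rightarrow> 'p \<Rightarrow> 'c"
  on_oa :: "'o \<Rightarrow> 'b \<Rightarrow> 'c"
  on_to :: "'t \<Rightarrow> 'p \<Rightarrow> 'v"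
  on_ot :: "'o \<Rightarrow> 'u \<Rightarrow> 'v"
  on_aa :: "'a \<Rightarrow> 'b \<Rightarrow> 'v"

definition fix_right :: "('o, 'a, 't, 'p, 'b, 'u, 'q, 'c, 'v) graymap \<Rightarrow> 'p \<Rightarrow>
    ('o, 'a, 't, 'q, 'c, 'v) twofun" where
  "fix_right M y =
     \<lparr>on_ob = (\<lambda>x. on_oo M x y), on_ar = (\<lambda>f. on_ao M f y), on_ce = (\<lambda>\<sigma>. on_to M \<sigma> y)\<rparr>"

definition fix_left :: "('o, 'a, 't, 'p, 'b, 'u, 'q, 'c, 'v) graymap \<Rightarrow> 'o \<Rightarrow>
    ('p, 'b, 'u, 'q, 'c, 'v) twofun" where
  "fix_left M x = \<lparr>on_ob = on_oo M x, on_ar = on_oa M x, on_ce = on_ot M x\<rparr>"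

locale gray_map =
  left: two_category C + right: two_category D + target: two_category E
  for C :: "('o, 'a, 't) twocat" and D :: "('p, 'b, 'u) twocat"
    and E :: "('q, 'c, 'v) twocat" +
  fixes M :: "('o, 'a, 't, 'p, 'b, 'u, 'q, 'c, 'v) graymap"
  assumes left_functor: "y \<in> Ob D \<Longrightarrow> two_functor C E (fix_right M y)"
    and right_functor: "x \<in> Ob C \<Longrightarrow> two_functor D E (fix_left M x)"
    and aa_invertible: "arrow C f x x' \<Longrightarrow> arrow D g y y' \<Longrightarrow>
          invertible_cell E (on_aa M f g)
            (on_ao M f y' \<cdot>\<^bsub>E\<^esub> on_oa M x g) (on_oa M x' g \<cdot>\<^bsub>E\<^esub> on_ao M f y)"
    and aa_natural: "arrow C f x x' \<Longrightarrow> arrow D g y y' \<Longrightarrow>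
          cell C \<sigma> f f' \<Longrightarrow> cell D \<tau> g g' \<Longrightarrow>
          on_aa M f' g' \<odot>\<^bsub>E\<^esub> (on_to M \<sigma> y' \<star>\<^bsub>E\<^esub> on_ot M x \<tau>)
            = (on_ot M x' \<tau> \<star>\<^bsub>E\<^esub> on_to M \<sigma> y) \<odot>\<^bsub>E\<^esub> on_aa M f g"
    and aa_id_left: "x \<in> Ob C \<Longrightarrow> g \<in> Ar D \<Longrightarrow>
          on_aa M (id1 C x) g = id2 E (on_oa M x g)"
    and aa_id_right: "f \<in> Ar C \<Longrightarrow> y \<in> Ob D \<Longrightarrow>
          on_aa M f (id1 D y) = id2 E (on_ao M f y)"
    and aa_cmp_left: "arrow C f x x' \<Longrightarrow> arrow C f' x' x'' \<Longrightarrow> arrow D g y y' \<Longrightarrow>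
          on_aa M (f' \<cdot>\<^bsub>C\<^esub> f) g
            = (on_aa M f' g \<star>\<^bsub>E\<^esub> id2 E (on_ao M f y))
                \<odot>\<^bsub>E\<^esub> (id2 E (on_ao M f' y') \<star>\<^bsub>E\<^esub> on_aa M f g)"
    and aa_cmp_right: "arrow C f x x' \<Longrightarrow> arrow D g y y' \<Longrightarrow> arrow D g' y' y'' \<Longrightarrow>
          on_aa M f (g' \<cdot>\<^bsub>D\<^esub> g)
            = (id2 E (on_oa M x' g') \<star>\<^bsub>E\<^esub> on_aa M f g)
                \<odot>\<^bsub>E\<^esub> (on_aa M f g' \<star>\<^bsub>E\<^esub> id2 E (on_oa M x g))"


section \<open>Gray-categories and Gray-functors\<close>

text \<open>
  \<open>Homs\<close> is the disjoint union of all the hom 2-categories; \<open>dom0\<close> and \<open>cod0\<close> say in which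
  hom 2-category a 1-cell of the Gray-category (an object of \<open>Homs\<close>) lies. So 1-, 2- and
  3-cells of the Gray-category are objects, 1-cells and 2-cells of \<open>Homs\<close>. The field \<open>gcomp\<close>
  collects all the composition 2-functors \<open>hom Y Z \<otimes> hom X Y \<rightarrow> hom X Z\<close>.
\<close>

record ('o, 'a, 'b, 'c) graycat =
  Obj :: "'o set"
  dom0 :: "'a \<Rightarrow> 'o"
  cod0 :: "'a \<Rightarrow> 'o"
  Homs :: "('a, 'b, 'c) twocat"
  unit0 :: "'o \<Rightarrow> 'a"
  gcomp :: "('a, 'b, 'c, 'a, 'b, 'c, 'a, 'b, 'c) graymap"

definition hom :: "('o, 'a, 'b, 'c) graycat \<Rightarrow> 'o \<Rightarrow> 'o \<Rightarrow> ('a, 'b, 'c) twocat" where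
  "hom G X Y = (Homs G)
     \<lparr>Ob := {f \<in> Ob (Homs G). dom0 G f = X \<and> cod0 G f = Y},
      Ar := {\<alpha> \<in> Ar (Homs G). dom0 G (src (Homs G) \<alpha>) = X \<and> cod0 G (src (Homs G) \<alpha>) = Y},
      Ce := {\<Gamma> \<in> Ce (Homs G). dom0 G (src (Homs G) (dom2 (Homs G) \<Gamma>)) = X \<and>
                              cod0 G (src (Homs G) (dom2 (Homs G) \<Gamma>)) = Y}\<rparr>"

text \<open>
  The associativity axioms say that the two composite 2-functors out of
  \<open>(hom Y Z \<otimes> hom X Y) \<otimes> hom W X\<close> agree on generators: on cells of one variable,
  and on the invertible 2-cells indexed by 1-cells of two of the variables. The unit axioms are
  of the same kind.
\<close>

locale gray_category =
  fixes G :: "('o, 'a, 'b, 'c) graycat"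
  assumes Homs: "two_category (Homs G)"
    and dom0_Obj: "f \<in> Ob (Homs G) \<Longrightarrow> dom0 G f \<in> Obj G"
    and cod0_Obj: "f \<in> Ob (Homs G) \<Longrightarrow> cod0 G f \<in> Obj G"
    and dom0_trg: "\<alpha> \<in> Ar (Homs G) \<Longrightarrow> dom0 G (trg (Homs G) \<alpha>) = dom0 G (src (Homs G) \<alpha>)"
    and cod0_trg: "\<alpha> \<in> Ar (Homs G) \<Longrightarrow> cod0 G (trg (Homs G) \<alpha>) = cod0 G (src (Homs G) \<alpha>)"
    and unit_Ob: "X \<in> Obj G \<Longrightarrow> unit0 G X \<in> Ob (hom G X X)"
    and comp_gray_map: "X \<in> Obj G \<Longrightarrow> Y \<in> Obj G \<Longrightarrow> Z \<in> Obj G \<Longrightarrow>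
          gray_map (hom G Y Z) (hom G X Y) (hom G X Z) (gcomp G)"
    and unit_left_o: "f \<in> Ob (hom G X Y) \<Longrightarrow> on_oo (gcomp G) (unit0 G Y) f = f"
    and unit_left_a: "\<alpha> \<in> Ar (hom G X Y) \<Longrightarrow> on_oa (gcomp G) (unit0 G Y) \<alpha> = \<alpha>"
    and unit_left_t: "\<Gamma> \<in> Ce (hom G X Y) \<Longrightarrow> on_ot (gcomp G) (unit0 G Y) \<Gamma> = \<Gamma>"
    and unit_right_o: "f \<in> Ob (hom G X Y) \<Longrightarrow> on_oo (gcomp G) f (unit0 G X) = f"
    and unit_right_a: "\<alpha> \<in> Ar (hom G X Y) \<Longrightarrow> on_ao (gcomp G) \<alpha> (unit0 G X) = \<alpha>"
    and unit_right_t: "\<Gamma> \<in> Ce (hom G X Y) \<Longrightarrow> on_to (gcomp G) \<Gamma> (unit0 G X) = \<Gamma>"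
    and assoc_ooo: "f \<in> Ob (hom G W X) \<Longrightarrow> g \<in> Ob (hom G X Y) \<Longrightarrow> h \<in> Ob (hom G Y Z) \<Longrightarrow>
          on_oo (gcomp G) (on_oo (gcomp G) h g) f = on_oo (gcomp G) h (on_oo (gcomp G) g f)"
    and assoc_aoo: "f \<in> Ob (hom G W X) \<Longrightarrow> g \<in> Ob (hom G X Y) \<Longrightarrow> \<gamma> \<in> Ar (hom G Y Z) \<Longrightarrow>
          on_ao (gcomp G) (on_ao (gcomp G) \<gamma> g) f = on_ao (gcomp G) \<gamma> (on_oo (gcomp G) g f)"
    and assoc_oao: "f \<in> Ob (hom G W X) \<Longrightarrow> \<beta> \<in> Ar (hom G X Y) \<Longrightarrow> h \<in> Ob (hom G Y Z) \<Longrightarrow>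
          on_ao (gcomp G) (on_oa (gcomp G) h \<beta>) f = on_oa (gcomp G) h (on_ao (gcomp G) \<beta> f)"
    and assoc_ooa: "\<alpha> \<in> Ar (hom G W X) \<Longrightarrow> g \<in> Ob (hom G X Y) \<Longrightarrow> h \<in> Ob (hom G Y Z) \<Longrightarrow>
          on_oa (gcomp G) (on_oo (gcomp G) h g) \<alpha> = on_oa (gcomp G) h (on_oa (gcomp G) g \<alpha>)"
    and assoc_too: "f \<in> Ob (hom G W X) \<Longrightarrow> g \<in> Ob (hom G X Y) \<Longrightarrow> \<Gamma> \<in> Ce (hom G Y Z) \<Longrightarrow>
          on_to (gcomp G) (on_to (gcomp G) \<Gamma> g) f = on_to (gcomp G) \<Gamma> (on_oo (gcomp G) g f)"
    and assoc_oto: "f \<in> Ob (hom G W X) \<Longrightarrow> \<Gamma> \<in> Ce (hom G X Y) \<Longrightarrow> h \<in> Ob (hom G Y Z) \<Longrightarrow>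
          on_to (gcomp G) (on_ot (gcomp G) h \<Gamma>) f = on_ot (gcomp G) h (on_to (gcomp G) \<Gamma> f)"
    and assoc_oot: "\<Gamma> \<in> Ce (hom G W X) \<Longrightarrow> g \<in> Ob (hom G X Y) \<Longrightarrow> h \<in> Ob (hom G Y Z) \<Longrightarrow>
          on_ot (gcomp G) (on_oo (gcomp G) h g) \<Gamma> = on_ot (gcomp G) h (on_ot (gcomp G) g \<Gamma>)"
    and assoc_aao: "f \<in> Ob (hom G W X) \<Longrightarrow> \<beta> \<in> Ar (hom G X Y) \<Longrightarrow> \<gamma> \<in> Ar (hom G Y Z) \<Longrightarrow>
          on_to (gcomp G) (on_aa (gcomp G) \<gamma> \<beta>) f = on_aa (gcomp G) \<gamma> (on_ao (gcomp G) \<beta> f)"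
    and assoc_aoa: "\<alpha> \<in> Ar (hom G W X) \<Longrightarrow> g \<in> Ob (hom G X Y) \<Longrightarrow> \<gamma> \<in> Ar (hom G Y Z) \<Longrightarrow>
          on_aa (gcomp G) (on_ao (gcomp G) \<gamma> g) \<alpha> = on_aa (gcomp G) \<gamma> (on_oa (gcomp G) g \<alpha>)"
    and assoc_oaa: "\<alpha> \<in> Ar (hom G W X) \<Longrightarrow> \<beta> \<in> Ar (hom G X Y) \<Longrightarrow> h \<in> Ob (hom G Y Z) \<Longrightarrow>
          on_aa (gcomp G) (on_oa (gcomp G) h \<beta>) \<alpha> = on_ot (gcomp G) h (on_aa (gcomp G) \<beta> \<alpha>)"

record ('o, 'a, 'b, 'c, 'p, 'd, 'e, 'f) grayfun =
  on_Obj :: "'o \<Rightarrow> 'p"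
  on_hom :: "('a, 'b, 'c, 'd, 'e, 'f) twofun"

locale gray_functor =
  source: gray_category A + target: gray_category B
  for A :: "('o, 'a, 'b, 'c) graycat" and B :: "('p, 'd, 'e, 'f) graycat" +
  fixes F :: "('o, 'a, 'b, 'c, 'p, 'd, 'e, 'f) grayfun"
  assumes map_Obj: "X \<in> Obj A \<Longrightarrow> on_Obj F X \<in> Obj B"
    and map_hom: "X \<in> Obj A \<Longrightarrow> Y \<in> Obj A \<Longrightarrow>
          two_functor (hom A X Y) (hom B (on_Obj F X) (on_Obj F Y)) (on_hom F)"
    and map_unit: "X \<in> Obj A \<Longrightarrow> on_ob (on_hom F) (unit0 A X) = unit0 B (on_Obj F X)"
    and map_oo: "f \<in> Ob (hom A X Y) \<Longrightarrow> g \<in> Ob (hom A Y Z) \<Longrightarrow>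
          on_ob (on_hom F) (on_oo (gcomp A) g f)
            = on_oo (gcomp B) (on_ob (on_hom F) g) (on_ob (on_hom F) f)"
    and map_ao: "f \<in> Ob (hom A X Y) \<Longrightarrow> \<beta> \<in> Ar (hom A Y Z) \<Longrightarrow>
          on_ar (on_hom F) (on_ao (gcomp A) \<beta> f)
            = on_ao (gcomp B) (on_ar (on_hom F) \<beta>) (on_ob (on_hom F) f)"
    and map_oa: "\<alpha> \<in> Ar (hom A X Y) \<Longrightarrow> g \<in> Ob (hom A Y Z) \<Longrightarrow>
          on_ar (on_hom F) (on_oa (gcomp A) g \<alpha>)
            = on_oa (gcomp B) (on_ob (on_hom F) g) (on_ar (on_hom F) \<alpha>)"
    and map_to: "f \<in> Ob (hom A X Y) \<Longrightarrow> \<Gamma> \<in> Ce (hom A Y Z) \<Longrightarrow>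
          on_ce (on_hom F) (on_to (gcomp A) \<Gamma> f)
            = on_to (gcomp B) (on_ce (on_hom F) \<Gamma>) (on_ob (on_hom F) f)"
    and map_ot: "\<Gamma> \<in> Ce (hom A X Y) \<Longrightarrow> g \<in> Ob (hom A Y Z) \<Longrightarrow>
          on_ce (on_hom F) (on_ot (gcomp A) g \<Gamma>)
            = on_ot (gcomp B) (on_ob (on_hom F) g) (on_ce (on_hom F) \<Gamma>)"
    and map_aa: "\<alpha> \<in> Ar (hom A X Y) \<Longrightarrow> \<beta> \<in> Ar (hom A Y Z) \<Longrightarrow>
          on_ce (on_hom F) (on_aa (gcomp A) \<beta> \<alpha>)
            = on_aa (gcomp B) (on_ar (on_hom F) \<beta>) (on_ar (on_hom F) \<alpha>)"


section \<open>The category of objects and equivalence classes of 1-cells, and fibrations\<close>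

text \<open>The prefix \<open>pi_\<close> refers to the ordinary category \<open>\<pi>\<^sub>*G\<close>, whose objects are those of \<open>G\<close>.\<close>

definition pi_rel :: "('o, 'a, 'b, 'c) graycat \<Rightarrow> 'o \<Rightarrow> 'o \<Rightarrow> ('a \<times> 'a) set" where
  "pi_rel G X Y = {(f, g). f \<in> Ob (hom G X Y) \<and> g \<in> Ob (hom G X Y) \<and>
                           equivalent_obs (hom G X Y) f g}"

definition pi_hom :: "('o, 'a, 'b, 'c) graycat \<Rightarrow> 'o \<Rightarrow> 'o \<Rightarrow> 'a set set" where
  "pi_hom G X Y = Ob (hom G X Y) // pi_rel G X Y"

definition pi_id :: "('o, 'a, 'b, 'c) graycat \<Rightarrow> 'o \<Rightarrow> 'a set" where
  "pi_id G X = pi_rel G X X `` {unit0 G X}"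

definition pi_comp :: "('o, 'a, 'b, 'c) graycat \<Rightarrow> 'o \<Rightarrow> 'o \<Rightarrow> 'o \<Rightarrow>
    'a set \<Rightarrow> 'a set \<Rightarrow> 'a set" where
  "pi_comp G X Y Z v u = (\<Union>g\<in>v. \<Union>f\<in>u. pi_rel G X Z `` {on_oo (gcomp G) g f})"

definition pi_iso :: "('o, 'a, 'b, 'c) graycat \<Rightarrow> 'a set \<Rightarrow> 'o \<Rightarrow> 'o \<Rightarrow> bool" where
  "pi_iso G u X Y \<longleftrightarrow> u \<in> pi_hom G X Y \<and>
     (\<exists>v \<in> pi_hom G Y X. pi_comp G X Y X v u = pi_id G X \<and> pi_comp G Y X Y u v = pi_id G Y)"

definition pi_map :: "('p, 'd, 'e, 'f) graycat \<Rightarrow>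
    ('o, 'a, 'b, 'c, 'p, 'd, 'e, 'f) grayfun \<Rightarrow> 'o \<Rightarrow> 'o \<Rightarrow> 'a set \<Rightarrow> 'd set" where
  "pi_map B F X Y u =
     (\<Union>f\<in>u. pi_rel B (on_Obj F X) (on_Obj F Y) `` {on_ob (on_hom F) f})"

definition locally_fibration :: "('o, 'a, 'b, 'c) graycat \<Rightarrow> ('p, 'd, 'e, 'f) graycat \<Rightarrow>
    ('o, 'a, 'b, 'c, 'p, 'd, 'e, 'f) grayfun \<Rightarrow> bool" where
  "locally_fibration A B F \<longleftrightarrow> (\<forall>X \<in> Obj A. \<forall>Y \<in> Obj A.
     two_fibration (hom A X Y) (hom B (on_Obj F X) (on_Obj F Y)) (on_hom F))"

definition gray_fibration :: "('o, 'a, 'b, 'c) graycat \<Rightarrow> ('p, 'd, 'e, 'f) graycat \<Rightarrow>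
    ('o, 'a, 'b, 'c, 'p, 'd, 'e, 'f) grayfun \<Rightarrow> bool" where
  "gray_fibration A B F \<longleftrightarrow> gray_functor A B F \<and> locally_fibration A B F \<and>
     (\<forall>X \<in> Obj A. \<forall>Y \<in> Obj B. \<forall>u. pi_iso B u Y (on_Obj F X) \<longrightarrow>
        (\<exists>X' \<in> Obj A. \<exists>u'. pi_iso A u' X' X \<and> on_Obj F X' = Y \<and> pi_map B F X' X u' = u))"


section \<open>Adjoint biequivalences\<close>

record ('a, 'b, 'c) adjbieq =
  fwd :: 'a
  bwd :: 'a
  eta :: "('b, 'c) adjeq"
  eps :: "('b, 'c) adjeq"
  S3 :: 'c
  T3 :: 'c

text \<open>
  With \<open>\<beta> : g \<rightarrow> g'\<close> and \<open>\<alpha> : f \<rightarrow> f'\<close>, the 3-cell \<open>\<beta>\<^sub>\<alpha> : \<beta>f'.g\<alpha> \<cong> g'\<alpha>.\<beta>f\<close> is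
  \<open>on_aa (gcomp G) \<beta> \<alpha>\<close>.
\<close>

definition adjoint_biequivalence :: "('o, 'a, 'b, 'c) graycat \<Rightarrow> ('a, 'b, 'c) adjbieq \<Rightarrow>
    'o \<Rightarrow> 'o \<Rightarrow> bool" where
  "adjoint_biequivalence G x X Y \<longleftrightarrow>
    (let H = Homs G; oo = on_oo (gcomp G); ao = on_ao (gcomp G); oa = on_oa (gcomp G);
         to = on_to (gcomp G); ot = on_ot (gcomp G); aa = on_aa (gcomp G);
         f = fwd x; g = bwd x; \<eta> = ladj (eta x); \<epsilon> = ladj (eps x); S = S3 x; T = T3 x
     in f \<in> Ob (hom G X Y) \<and> g \<in> Ob (hom G Y X) \<and>
        adjoint_equivalence (hom G X X) (eta x) (unit0 G X) (oo g f) \<and>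
        adjoint_equivalence (hom G Y Y) (eps x) (oo f g) (unit0 G Y) \<and>
        invertible_cell (hom G X Y) S (ao \<epsilon> f \<cdot>\<^bsub>H\<^esub> oa f \<eta>) (id1 H f) \<and>
        invertible_cell (hom G Y X) T (id1 H g) (oa g \<epsilon> \<cdot>\<^bsub>H\<^esub> ao \<eta> g) \<and>
        (ot g S \<star>\<^bsub>H\<^esub> id2 H \<eta>)
          \<odot>\<^bsub>H\<^esub> (id2 H (oa g (ao \<epsilon> f)) \<star>\<^bsub>H\<^esub> aa \<eta> \<eta>)
          \<odot>\<^bsub>H\<^esub> (to T f \<star>\<^bsub>H\<^esub> id2 H \<eta>) = id2 H \<eta> \<and>
        (id2 H \<epsilon> \<star>\<^bsub>H\<^esub> to S g)
          \<odot>\<^bsub>H\<^esub> (aa \<epsilon> \<epsilon> \<star>\<^bsub>H\<^esub> id2 H (oa f (ao \<eta> g)))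
          \<odot>\<^bsub>H\<^esub> (id2 H \<epsilon> \<star>\<^bsub>H\<^esub> ot f T) = id2 H \<epsilon>)"

definition map_adjeq :: "('o, 'a, 't, 'p, 'b, 'u) twofun \<Rightarrow> ('a, 't) adjeq \<Rightarrow> ('b, 'u) adjeq"
  where
  "map_adjeq P e = \<lparr>ladj = on_ar P (ladj e), radj = on_ar P (radj e),
     adj_unit = on_ce P (adj_unit e), adj_counit = on_ce P (adj_counit e)\<rparr>"

definition map_adjbieq :: "('o, 'a, 'b, 'c, 'p, 'd, 'e, 'f) grayfun \<Rightarrow>
    ('a, 'b, 'c) adjbieq \<Rightarrow> ('d, 'e, 'f) adjbieq" where
  "map_adjbieq F x = \<lparr>fwd = on_ob (on_hom F) (fwd x), bwd = on_ob (on_hom F) (bwd x),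
     eta = map_adjeq (on_hom F) (eta x), eps = map_adjeq (on_hom F) (eps x),
     S3 = on_ce (on_hom F) (S3 x), T3 = on_ce (on_hom F) (T3 x)\<rparr>"

definition adjoint_biequivalence_lifting :: "('o, 'a, 'b, 'c) graycat \<Rightarrow>
    ('p, 'd, 'e, 'f) graycat \<Rightarrow> ('o, 'a, 'b, 'c, 'p, 'd, 'e, 'f) grayfun \<Rightarrow> bool" where
  "adjoint_biequivalence_lifting A B F \<longleftrightarrow>
     (\<forall>X \<in> Obj A. \<forall>Y \<in> Obj B. \<forall>x. adjoint_biequivalence B x Y (on_Obj F X) \<longrightarrow>
        (\<exists>X' \<in> Obj A. \<exists>x'. adjoint_biequivalence A x' X' X \<and>
           on_Obj F X' = Y \<and> map_adjbieq F x' = x))"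

end

theory Submission
  imports Defs
begin

text \<open>
  Everything rests on the fact that whiskering by a biequivalence \<open>f\<close> is locally an equivalence of
  categories. It yields, first, that every biequivalence \<open>f\<close>, with any pseudo-inverse \<open>g\<close> and any
  \<open>\<eta>\<close>, is part of an adjoint biequivalence: \<open>\<epsilon>\<close> and \<open>S\<close> exist because \<open>x \<mapsto> xf.f\<eta>\<close> is
  essentially surjective, and \<open>T\<close> is the unique solution of the first axiom because
  \<open>x \<mapsto> xf.\<eta>\<close> is fully faithful; the second axiom then follows from the first. This reduces the
  fibration condition on \<open>\<pi>\<^sub>*\<close> to the lifting of adjoint biequivalences.

  Conversely, a lifting of the class of \<open>f\<close> in \<open>\<pi>\<^sub>*\<close> is corrected to a lifting of \<open>f\<close> itself by
  the local fibration property. The remaining data are lifted in the order \<open>(g, \<eta>)\<close>,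
  \<open>(\<epsilon>, S)\<close>, \<open>T\<close>: given what precedes it, each of these is unique up to an invertible
  comparison, along which any choice upstairs can be transported to one lying over the
  prescribed data.
\<close>

section \<open>Equivalences in 2-categories\<close>

text \<open>A fibration of 2-categories lifts an equivalence with prescribed target and an
  invertible 2-cell with prescribed codomain, but it gives no lift of a 2-cell with both ends
  prescribed. This shapes the lifting argument. \<open>g\<close> and \<open>\<eta>\<close> are
  corrected by moving the domain of an equivalence and of an invertible 2-cell; \<open>S\<close> is
  made right by using up the freedom in \<open>\<epsilon>\<close>. Nothing is left to move for
  \<open>T\<close>, so its image must be right by uniqueness, and likewise the counits of the
  adjoint equivalences once right adjoints and units match. Whiskering by \<open>f\<close> is
  approached through \<open>fg\<close> and \<open>gf\<close>: an equivalence
  \<open>e : fg \<rightarrow> 1\<close> has interchange cells with every 2-cell of the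
  Gray-category, and these compare whiskering by \<open>fg\<close> with the identity. What holds for
  \<open>fg\<close> and \<open>gf\<close> then passes to \<open>f\<close>. The second axiom follows
  from the first because its left side \<open>Q\<close> can be tested on \<open>Qf\<close>
  precomposed with \<open>f\<eta>\<close>. There, naturality of the interchange cells at
  \<open>S\<close> and the exchange of \<open>S\<close> with itself turn it into the first axiom
  whiskered by \<open>f\<close> and by \<open>\<epsilon>f\<close>.\<close>

context two_category
begin

text \<open>The locale axioms speak through \<open>arrow\<close> and \<open>cell\<close>; recast as
  membership and boundary equations they become conditional rewrite rules, so that simp settles
  composability side conditions on its own.\<close>

lemma typing [simp]:
  "x \<in> Ob C \<Longrightarrow> id1 C x \<in> Ar C"
  "x \<in> Ob C \<Longrightarrow> src C (id1 C x) = x"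
  "x \<in> Ob C \<Longrightarrow> trg C (id1 C x) = x"
  "f \<in> Ar C \<Longrightarrow> g \<in> Ar C \<Longrightarrow> trg C f = src C g \<Longrightarrow> g \<cdot> f \<in> Ar C"
  "f \<in> Ar C \<Longrightarrow> g \<in> Ar C \<Longrightarrow> trg C f = src C g \<Longrightarrow> src C (g \<cdot> f) = src C f"
  "f \<in> Ar C \<Longrightarrow> g \<in> Ar C \<Longrightarrow> trg C f = src C g \<Longrightarrow> trg C (g \<cdot> f) = trg C g"
  "f \<in> Ar C \<Longrightarrow> id2 C f \<in> Ce C"
  "f \<in> Ar C \<Longrightarrow> dom2 C (id2 C f) = f"
  "f \<in> Ar C \<Longrightarrow> cod2 C (id2 C f) = f"
  "\<sigma> \<in> Ce C \<Longrightarrow> \<tau> \<in> Ce C \<Longrightarrow> cod2 C \<sigma> = dom2 C \<tau> \<Longrightarrow> \<tau> \<odot> \<sigma> \<in> Ce C"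
  "\<sigma> \<in> Ce C \<Longrightarrow> \<tau> \<in> Ce C \<Longrightarrow> cod2 C \<sigma> = dom2 C \<tau> \<Longrightarrow> dom2 C (\<tau> \<odot> \<sigma>) = dom2 C \<sigma>"
  "\<sigma> \<in> Ce C \<Longrightarrow> \<tau> \<in> Ce C \<Longrightarrow> cod2 C \<sigma> = dom2 C \<tau> \<Longrightarrow> cod2 C (\<tau> \<odot> \<sigma>) = cod2 C \<tau>"
  "\<sigma> \<in> Ce C \<Longrightarrow> \<tau> \<in> Ce C \<Longrightarrow> trg C (dom2 C \<sigma>) = src C (dom2 C \<tau>) \<Longrightarrow> \<tau> \<star> \<sigma> \<in> Ce C"
  "\<sigma> \<in> Ce C \<Longrightarrow> \<tau> \<in> Ce C \<Longrightarrow> trg C (dom2 C \<sigma>) = src C (dom2 C \<tau>) \<Longrightarrow>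
     dom2 C (\<tau> \<star> \<sigma>) = dom2 C \<tau> \<cdot> dom2 C \<sigma>"
  "\<sigma> \<in> Ce C \<Longrightarrow> \<tau> \<in> Ce C \<Longrightarrow> trg C (dom2 C \<sigma>) = src C (dom2 C \<tau>) \<Longrightarrow>
     cod2 C (\<tau> \<star> \<sigma>) = cod2 C \<tau> \<cdot> cod2 C \<sigma>"
  using id1_arrow cmp1_arrow id2_cell vcmp_cell hcmp_cell
  unfolding arrow_def cell_def by blast+

declare src_Ob [simp] trg_Ob [simp] dom2_Ar [simp] cod2_Ar [simp] src_cod2 [simp] trg_cod2 [simp]

lemma cmp1_id [simp]:
  "f \<in> Ar C \<Longrightarrow> src C f = x \<Longrightarrow> f \<cdot> id1 C x = f"
  "f \<in> Ar C \<Longrightarrow> trg C f = y \<Longrightarrow> id1 C y \<cdot> f = f"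
  using cmp1_id_right cmp1_id_left by (auto simp: arrow_def)

lemma cmp1_assoc' [simp]:
  "f \<in> Ar C \<Longrightarrow> g \<in> Ar C \<Longrightarrow> h \<in> Ar C \<Longrightarrow> trg C f = src C g \<Longrightarrow> trg C g = src C h \<Longrightarrow>
    (h \<cdot> g) \<cdot> f = h \<cdot> g \<cdot> f"
  using cmp1_assoc by (auto simp: arrow_def)

lemma vcmp_id [simp]:
  "\<sigma> \<in> Ce C \<Longrightarrow> dom2 C \<sigma> = f \<Longrightarrow> \<sigma> \<odot> id2 C f = \<sigma>"
  "\<sigma> \<in> Ce C \<Longrightarrow> cod2 C \<sigma> = f \<Longrightarrow> id2 C f \<odot> \<sigma> = \<sigma>"
  using vcmp_id_right vcmp_id_left by (auto simp: cell_def)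

lemma vcmp_assoc' [simp]:
  "\<rho> \<in> Ce C \<Longrightarrow> \<sigma> \<in> Ce C \<Longrightarrow> \<tau> \<in> Ce C \<Longrightarrow> cod2 C \<rho> = dom2 C \<sigma> \<Longrightarrow> cod2 C \<sigma> = dom2 C \<tau> \<Longrightarrow>
    (\<tau> \<odot> \<sigma>) \<odot> \<rho> = \<tau> \<odot> \<sigma> \<odot> \<rho>"
  using vcmp_assoc by (auto simp: cell_def)

lemma hcmp_id2' [simp]:
  "f \<in> Ar C \<Longrightarrow> g \<in> Ar C \<Longrightarrow> trg C f = src C g \<Longrightarrow> id2 C g \<star> id2 C f = id2 C (g \<cdot> f)"
  using hcmp_id2 by (auto simp: arrow_def)

lemma hcmp_id [simp]:
  "\<sigma> \<in> Ce C \<Longrightarrow> src C (dom2 C \<sigma>) = x \<Longrightarrow> \<sigma> \<star> id2 C (id1 C x) = \<sigma>"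
  "\<sigma> \<in> Ce C \<Longrightarrow> trg C (dom2 C \<sigma>) = y \<Longrightarrow> id2 C (id1 C y) \<star> \<sigma> = \<sigma>"
  using hcmp_id_right hcmp_id_left by (auto simp: cell_def)

lemma hcmp_assoc' [simp]:
  "\<rho> \<in> Ce C \<Longrightarrow> \<sigma> \<in> Ce C \<Longrightarrow> \<tau> \<in> Ce C \<Longrightarrow> trg C (dom2 C \<rho>) = src C (dom2 C \<sigma>) \<Longrightarrow>
    trg C (dom2 C \<sigma>) = src C (dom2 C \<tau>) \<Longrightarrow> (\<tau> \<star> \<sigma>) \<star> \<rho> = \<tau> \<star> \<sigma> \<star> \<rho>"
  using hcmp_assoc by (auto simp: cell_def)

text \<open>Merges the identities of a repeated left whiskering, as \<open>hcmp_assoc'\<close> and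
  \<open>hcmp_id2'\<close> already do on the right. The result is the normal form in which simp
  compares pasted 2-cells.\<close>

lemma hcmp_id2_hcmp [simp]:
  assumes "\<sigma> \<in> Ce C" "f \<in> Ar C" "g \<in> Ar C" "trg C (dom2 C \<sigma>) = src C f" "trg C f = src C g"
  shows "id2 C g \<star> id2 C f \<star> \<sigma> = id2 C (g \<cdot> f) \<star> \<sigma>"
  using assms by (simp flip: hcmp_assoc' hcmp_id2')

lemma interchange':
  "\<sigma> \<in> Ce C \<Longrightarrow> \<sigma>' \<in> Ce C \<Longrightarrow> \<tau> \<in> Ce C \<Longrightarrow> \<tau>' \<in> Ce C \<Longrightarrow> cod2 C \<sigma> = dom2 C \<sigma>' \<Longrightarrow>
    cod2 C \<tau> = dom2 C \<tau>' \<Longrightarrow> trg C (dom2 C \<sigma>) = src C (dom2 C \<tau>) \<Longrightarrow>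
    (\<tau>' \<odot> \<tau>) \<star> (\<sigma>' \<odot> \<sigma>) = (\<tau>' \<star> \<sigma>') \<odot> (\<tau> \<star> \<sigma>)"
  using interchange by (auto simp: cell_def)

lemma whisker_vcmp [simp]:
  assumes "\<sigma> \<in> Ce C" "\<tau> \<in> Ce C" "cod2 C \<sigma> = dom2 C \<tau>" "f \<in> Ar C"
  shows "trg C (dom2 C \<sigma>) = src C f \<Longrightarrow> id2 C f \<star> (\<tau> \<odot> \<sigma>) = (id2 C f \<star> \<tau>) \<odot> (id2 C f \<star> \<sigma>)"
    and "trg C f = src C (dom2 C \<sigma>) \<Longrightarrow> (\<tau> \<odot> \<sigma>) \<star> id2 C f = (\<tau> \<star> id2 C f) \<odot> (\<sigma> \<star> id2 C f)"
  using assms interchange'[of \<sigma> \<tau> "id2 C f" "id2 C f"]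
    interchange'[of "id2 C f" "id2 C f" \<sigma> \<tau>] by auto

text \<open>Both sides equal \<open>\<tau> \<star> \<sigma>\<close>, by interchange against identity
  cells. Applied to a cell and itself it yields the Eckmann-Hilton type identities for units and for
  \<open>S\<close>.\<close>

lemma exchange:
  assumes "\<sigma> \<in> Ce C" "\<tau> \<in> Ce C" "trg C (dom2 C \<sigma>) = src C (dom2 C \<tau>)"
  shows "(\<tau> \<star> id2 C (cod2 C \<sigma>)) \<odot> (id2 C (dom2 C \<tau>) \<star> \<sigma>) =
    (id2 C (cod2 C \<tau>) \<star> \<sigma>) \<odot> (\<tau> \<star> id2 C (dom2 C \<sigma>))"
  using assms interchange'[of \<sigma> "id2 C (cod2 C \<sigma>)" "id2 C (dom2 C \<tau>)" \<tau>]
    interchange'[of "id2 C (dom2 C \<sigma>)" \<sigma> \<tau> "id2 C (cod2 C \<tau>)"] by simp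

lemma invertible_cellE:
  assumes "invertible_cell C \<sigma> f g"
  obtains \<tau> where "\<sigma> \<in> Ce C" "dom2 C \<sigma> = f" "cod2 C \<sigma> = g" "\<tau> \<in> Ce C" "dom2 C \<tau> = g" "cod2 C \<tau> = f"
    "\<tau> \<odot> \<sigma> = id2 C f" "\<sigma> \<odot> \<tau> = id2 C g"
  using assms unfolding invertible_cell_def cell_def by blast

lemma invertible_cellI:
  assumes "\<sigma> \<in> Ce C" "dom2 C \<sigma> = f" "cod2 C \<sigma> = g" "\<tau> \<in> Ce C" "dom2 C \<tau> = g" "cod2 C \<tau> = f"
    "\<tau> \<odot> \<sigma> = id2 C f" "\<sigma> \<odot> \<tau> = id2 C g"
  shows "invertible_cell C \<sigma> f g"
  using assms unfolding invertible_cell_def cell_def by blast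

lemma invertible_cell_simps [simp]:
  assumes "invertible_cell C \<sigma> f g"
  shows "\<sigma> \<in> Ce C" "dom2 C \<sigma> = f" "cod2 C \<sigma> = g"
  using assms by (auto simp: invertible_cell_def cell_def)

lemma invertible_cell_inverse:
  assumes "invertible_cell C \<sigma> f g"
  obtains \<tau> where "invertible_cell C \<tau> g f" "\<tau> \<odot> \<sigma> = id2 C f" "\<sigma> \<odot> \<tau> = id2 C g"
  using assms unfolding invertible_cell_def by blast

lemma invertible_id2: "f \<in> Ar C \<Longrightarrow> invertible_cell C (id2 C f) f f"
  by (rule invertible_cellI[of _ _ _ "id2 C f"]) auto

lemma invertible_vcmp:
  assumes "invertible_cell C \<sigma> f g" "invertible_cell C \<tau> g h"
  shows "invertible_cell C (\<tau> \<odot> \<sigma>) f h"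
proof -
  from assms(1) obtain \<sigma>' where s: "\<sigma> \<in> Ce C" "dom2 C \<sigma> = f" "cod2 C \<sigma> = g" "\<sigma>' \<in> Ce C"
    "dom2 C \<sigma>' = g" "cod2 C \<sigma>' = f" "\<sigma>' \<odot> \<sigma> = id2 C f" "\<sigma> \<odot> \<sigma>' = id2 C g"
    by (rule invertible_cellE)
  from assms(2) obtain \<tau>' where t: "\<tau> \<in> Ce C" "dom2 C \<tau> = g" "cod2 C \<tau> = h" "\<tau>' \<in> Ce C"
    "dom2 C \<tau>' = h" "cod2 C \<tau>' = g" "\<tau>' \<odot> \<tau> = id2 C g" "\<tau> \<odot> \<tau>' = id2 C h"
    by (rule invertible_cellE)
  have "\<tau>' \<odot> \<tau> \<odot> \<sigma> = \<sigma>" "\<sigma> \<odot> \<sigma>' \<odot> \<tau>' = \<tau>'"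
    using s t vcmp_assoc'[of \<sigma> \<tau> \<tau>'] vcmp_assoc'[of \<tau>' \<sigma>' \<sigma>] by auto
  with s t show ?thesis by (intro invertible_cellI[of _ _ _ "\<sigma>' \<odot> \<tau>'"]) auto
qed

lemma invertible_hcmp:
  assumes "invertible_cell C \<sigma> f f'" "invertible_cell C \<tau> g g'" "trg C f = src C g"
  shows "invertible_cell C (\<tau> \<star> \<sigma>) (g \<cdot> f) (g' \<cdot> f')"
proof -
  from assms(1) obtain \<sigma>' where s: "\<sigma> \<in> Ce C" "dom2 C \<sigma> = f" "cod2 C \<sigma> = f'" "\<sigma>' \<in> Ce C"
    "dom2 C \<sigma>' = f'" "cod2 C \<sigma>' = f" "\<sigma>' \<odot> \<sigma> = id2 C f" "\<sigma> \<odot> \<sigma>' = id2 C f'"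
    by (rule invertible_cellE)
  from assms(2) obtain \<tau>' where t: "\<tau> \<in> Ce C" "dom2 C \<tau> = g" "cod2 C \<tau> = g'" "\<tau>' \<in> Ce C"
    "dom2 C \<tau>' = g'" "cod2 C \<tau>' = g" "\<tau>' \<odot> \<tau> = id2 C g" "\<tau> \<odot> \<tau>' = id2 C g'"
    by (rule invertible_cellE)
  have ar: "f \<in> Ar C" "g \<in> Ar C" "f' \<in> Ar C" "g' \<in> Ar C" "trg C f' = src C g'"
    using s t assms(3) by (metis dom2_Ar cod2_Ar src_cod2 trg_cod2)+
  show ?thesis
    using s t ar assms(3) interchange'[of \<sigma> \<sigma>' \<tau> \<tau>'] interchange'[of \<sigma>' \<sigma> \<tau>' \<tau>]
    by (intro invertible_cellI[of _ _ _ "\<tau>' \<star> \<sigma>'"]) auto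
qed

lemma invertible_whisker:
  assumes "invertible_cell C \<sigma> f f'" "g \<in> Ar C"
  shows "trg C f = src C g \<Longrightarrow> invertible_cell C (id2 C g \<star> \<sigma>) (g \<cdot> f) (g \<cdot> f')"
    and "trg C g = src C f \<Longrightarrow> invertible_cell C (\<sigma> \<star> id2 C g) (f \<cdot> g) (f' \<cdot> g)"
  using assms invertible_id2 invertible_hcmp by auto

lemma vcmp_cancel_right:
  assumes "invertible_cell C \<sigma> f g" "\<tau> \<in> Ce C" "\<tau>' \<in> Ce C" "dom2 C \<tau> = g" "dom2 C \<tau>' = g"
    "\<tau> \<odot> \<sigma> = \<tau>' \<odot> \<sigma>"
  shows "\<tau> = \<tau>'"
proof -
  obtain \<rho> where r: "invertible_cell C \<rho> g f" "\<sigma> \<odot> \<rho> = id2 C g"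
    using assms(1) by (rule invertible_cell_inverse)
  have "(\<tau> \<odot> \<sigma>) \<odot> \<rho> = (\<tau>' \<odot> \<sigma>) \<odot> \<rho>" using assms by simp
  then show ?thesis using assms(1-5) r by simp
qed

lemma vcmp_cancel_left:
  assumes "invertible_cell C \<sigma> f g" "\<tau> \<in> Ce C" "\<tau>' \<in> Ce C" "cod2 C \<tau> = f" "cod2 C \<tau>' = f"
    "\<sigma> \<odot> \<tau> = \<sigma> \<odot> \<tau>'"
  shows "\<tau> = \<tau>'"
proof -
  obtain \<rho> where r: "invertible_cell C \<rho> g f" "\<rho> \<odot> \<sigma> = id2 C f"
    using assms(1) by (rule invertible_cell_inverse)
  have "\<rho> \<odot> \<sigma> \<odot> \<tau> = \<rho> \<odot> \<sigma> \<odot> \<tau>'" using assms by simp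
  then show ?thesis using assms(1-5) r by (simp flip: vcmp_assoc')
qed

section \<open>Closure properties of equivalences\<close>

lemma equivalenceE:
  assumes "equivalence C f x y"
  obtains g \<sigma> \<tau> where "f \<in> Ar C" "src C f = x" "trg C f = y" "g \<in> Ar C" "src C g = y" "trg C g = x"
    "invertible_cell C \<sigma> (g \<cdot> f) (id1 C x)" "invertible_cell C \<tau> (f \<cdot> g) (id1 C y)"
  using assms unfolding equivalence_def arrow_def by blast

lemma equivalenceI:
  assumes "f \<in> Ar C" "src C f = x" "trg C f = y" "g \<in> Ar C" "src C g = y" "trg C g = x"
    "invertible_cell C \<sigma> (g \<cdot> f) (id1 C x)" "invertible_cell C \<tau> (f \<cdot> g) (id1 C y)"
  shows "equivalence C f x y"
  using assms unfolding equivalence_def arrow_def by blast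

lemma equivalence_arrow:
  assumes "equivalence C f x y"
  shows "f \<in> Ar C" "src C f = x" "trg C f = y"
  using assms unfolding equivalence_def arrow_def by blast+

lemma equivalence_Ob:
  assumes "equivalence C f x y"
  shows "x \<in> Ob C" "y \<in> Ob C"
  using equivalence_arrow[OF assms] by auto

lemma invertible_cell_Ar:
  assumes "invertible_cell C \<sigma> f g"
  shows "f \<in> Ar C" "g \<in> Ar C" "src C f = src C g" "trg C f = trg C g"
  using dom2_Ar[of \<sigma>] cod2_Ar[of \<sigma>] src_cod2[of \<sigma>] trg_cod2[of \<sigma>] invertible_cell_simps[OF assms]
  by auto

lemma equivalence_id1:
  assumes "x \<in> Ob C"
  shows "equivalence C (id1 C x) x x"
  using assms invertible_id2[of "id1 C x"] by (intro equivalenceI[of _ _ _ "id1 C x"]) auto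

lemma equivalence_comp:
  assumes "equivalence C f x y" "equivalence C g y z"
  shows "equivalence C (g \<cdot> f) x z"
proof -
  from assms(1) obtain f' \<sigma> \<tau> where f: "f \<in> Ar C" "src C f = x" "trg C f = y" "f' \<in> Ar C"
    "src C f' = y" "trg C f' = x"
    and s: "invertible_cell C \<sigma> (f' \<cdot> f) (id1 C x)" and t: "invertible_cell C \<tau> (f \<cdot> f') (id1 C y)"
    by (rule equivalenceE)
  from assms(2) obtain g' \<sigma>' \<tau>' where g: "g \<in> Ar C" "src C g = y" "trg C g = z" "g' \<in> Ar C"
    "src C g' = z" "trg C g' = y"
    and s': "invertible_cell C \<sigma>' (g' \<cdot> g) (id1 C y)" and t': "invertible_cell C \<tau>' (g \<cdot> g') (id1 C z)"
    by (rule equivalenceE)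
  have y: "y \<in> Ob C" using f by auto
  have "invertible_cell C (id2 C f' \<star> \<sigma>' \<star> id2 C f) (f' \<cdot> g' \<cdot> g \<cdot> f) (f' \<cdot> f)"
    using invertible_whisker(1)[OF invertible_whisker(2)[OF s', of f], of f'] f g y by simp
  moreover have "invertible_cell C (id2 C g \<star> \<tau> \<star> id2 C g') (g \<cdot> f \<cdot> f' \<cdot> g') (g \<cdot> g')"
    using invertible_whisker(1)[OF invertible_whisker(2)[OF t, of g'], of g] f g y by simp
  ultimately have "invertible_cell C (\<sigma> \<odot> id2 C f' \<star> \<sigma>' \<star> id2 C f) ((f' \<cdot> g') \<cdot> g \<cdot> f) (id1 C x)"
    and "invertible_cell C (\<tau>' \<odot> id2 C g \<star> \<tau> \<star> id2 C g') ((g \<cdot> f) \<cdot> f' \<cdot> g') (id1 C z)"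
    using invertible_vcmp s t' f g by auto
  then show ?thesis using f g by (intro equivalenceI[of _ _ _ "f' \<cdot> g'"]) auto
qed

lemma equivalence_inverse:
  assumes "equivalence C f x y"
  obtains g \<sigma> \<tau> where "equivalence C g y x" "invertible_cell C \<sigma> (g \<cdot> f) (id1 C x)"
    "invertible_cell C \<tau> (f \<cdot> g) (id1 C y)"
  using assms by (metis equivalenceE equivalenceI)

lemma equivalence_iso:
  assumes "equivalence C f x y" "invertible_cell C \<rho> f f'"
  shows "equivalence C f' x y"
proof -
  from assms(1) obtain g \<sigma> \<tau> where f: "f \<in> Ar C" "src C f = x" "trg C f = y" "g \<in> Ar C"
    "src C g = y" "trg C g = x"
    and s: "invertible_cell C \<sigma> (g \<cdot> f) (id1 C x)" and t: "invertible_cell C \<tau> (f \<cdot> g) (id1 C y)"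
    by (rule equivalenceE)
  obtain \<rho>' where r: "invertible_cell C \<rho>' f' f" using invertible_cell_inverse[OF assms(2)] .
  have f': "f' \<in> Ar C" "src C f' = x" "trg C f' = y"
    using invertible_cell_Ar[OF r] f by auto
  have "invertible_cell C (id2 C g \<star> \<rho>') (g \<cdot> f') (g \<cdot> f)"
    "invertible_cell C (\<rho>' \<star> id2 C g) (f' \<cdot> g) (f \<cdot> g)"
    using invertible_whisker[OF r, of g] f f' by auto
  then show ?thesis
    using invertible_vcmp s t f f' by (intro equivalenceI[of f' x y g]) auto
qed

section \<open>Composition with an equivalence is fully faithful and essentially surjective\<close>

lemma precomp_faithful:
  assumes "equivalence C w x y" "\<sigma> \<in> Ce C" "\<sigma>' \<in> Ce C" "dom2 C \<sigma> = dom2 C \<sigma>'"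
    "cod2 C \<sigma> = cod2 C \<sigma>'" "src C (dom2 C \<sigma>) = y" "\<sigma> \<star> id2 C w = \<sigma>' \<star> id2 C w"
  shows "\<sigma> = \<sigma>'"
proof -
  from assms(1) obtain g \<tau> where w: "w \<in> Ar C" "src C w = x" "trg C w = y" "g \<in> Ar C"
    "src C g = y" "trg C g = x" and t: "invertible_cell C \<tau> (w \<cdot> g) (id1 C y)"
    by (rule equivalenceE)
  have y: "y \<in> Ob C" using w by auto
  have "\<sigma> \<star> id2 C (w \<cdot> g) = (\<sigma> \<star> id2 C w) \<star> id2 C g" using assms(2-6) w by simp
  also have "\<dots> = \<sigma>' \<star> id2 C (w \<cdot> g)" unfolding assms(7) using assms(2-6) w by simp
  finally have e: "\<sigma> \<star> id2 C (w \<cdot> g) = \<sigma>' \<star> id2 C (w \<cdot> g)" .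
  \<comment> \<open>By \<open>exchange\<close> with \<open>\<tau> : w \<cdot> g \<cong> 1\<close>,
    the left side is a whiskered \<open>\<tau>\<close> after
    \<open>\<sigma> \<star> id2 C (w \<cdot> g)\<close>, which is the same for
    \<open>\<sigma>'\<close>.\<close>
  have "\<sigma> \<odot> (id2 C (dom2 C \<sigma>) \<star> \<tau>) = \<sigma>' \<odot> (id2 C (dom2 C \<sigma>) \<star> \<tau>)"
    using exchange[of \<tau> \<sigma>] exchange[of \<tau> \<sigma>'] assms w y e invertible_cell_simps[OF t] by simp
  then show ?thesis
    using vcmp_cancel_right[OF invertible_whisker(1)[OF t, of "dom2 C \<sigma>"]] assms w y by simp
qed

lemma postcomp_faithful:
  assumes "equivalence C w x y" "\<sigma> \<in> Ce C" "\<sigma>' \<in> Ce C" "dom2 C \<sigma> = dom2 C \<sigma>'"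
    "cod2 C \<sigma> = cod2 C \<sigma>'" "trg C (dom2 C \<sigma>) = x" "id2 C w \<star> \<sigma> = id2 C w \<star> \<sigma>'"
  shows "\<sigma> = \<sigma>'"
proof -
  from assms(1) obtain g \<tau> where w: "w \<in> Ar C" "src C w = x" "trg C w = y" "g \<in> Ar C"
    "src C g = y" "trg C g = x" and t: "invertible_cell C \<tau> (g \<cdot> w) (id1 C x)"
    by (rule equivalenceE)
  have x: "x \<in> Ob C" using w by auto
  have "id2 C (g \<cdot> w) \<star> \<sigma> = id2 C g \<star> id2 C w \<star> \<sigma>" using assms(2-6) w by simp
  also have "\<dots> = id2 C (g \<cdot> w) \<star> \<sigma>'" unfolding assms(7) using assms(2-6) w by simp
  finally have e: "id2 C (g \<cdot> w) \<star> \<sigma> = id2 C (g \<cdot> w) \<star> \<sigma>'" .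
  have "\<sigma> \<odot> (\<tau> \<star> id2 C (dom2 C \<sigma>)) = \<sigma>' \<odot> (\<tau> \<star> id2 C (dom2 C \<sigma>))"
    using exchange[of \<sigma> \<tau>] exchange[of \<sigma>' \<tau>] assms w x e invertible_cell_simps[OF t] by simp
  then show ?thesis
    using vcmp_cancel_right[OF invertible_whisker(2)[OF t, of "dom2 C \<sigma>"]] assms w x by simp
qed

text \<open>Naturality of \<open>\<tau> : w \<cdot> g \<cong> 1\<close> leaves one candidate for
  \<sigma>: \<open>\<delta> \<star> id2 C g\<close> conjugated by whiskerings of \<tau>. Its
  property first appears after a further whiskering by \<open>g\<close>, which is removed because
  \<open>g\<close> is an equivalence too.\<close>

lemma precomp_full:
  assumes "equivalence C w x y" "c \<in> Ar C" "c' \<in> Ar C" "src C c = y" "src C c' = y"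
    "trg C c = trg C c'" "invertible_cell C \<delta> (c \<cdot> w) (c' \<cdot> w)"
  obtains \<sigma> where "invertible_cell C \<sigma> c c'" "\<sigma> \<star> id2 C w = \<delta>"
proof -
  from assms(1) obtain g \<tau> where g: "equivalence C g y x"
    and t: "invertible_cell C \<tau> (w \<cdot> g) (id1 C y)"
    by (rule equivalence_inverse)
  note w = equivalence_arrow[OF assms(1)] equivalence_arrow[OF g]
  have y: "y \<in> Ob C" using w by auto
  have t1: "invertible_cell C (id2 C c \<star> \<tau>) (c \<cdot> w \<cdot> g) c"
    and t2: "invertible_cell C (id2 C c' \<star> \<tau>) (c' \<cdot> w \<cdot> g) c'"
    using invertible_whisker(1)[OF t, of c] invertible_whisker(1)[OF t, of c'] assms w y by auto
  obtain \<rho> where r: "invertible_cell C \<rho> c (c \<cdot> w \<cdot> g)" "\<rho> \<odot> (id2 C c \<star> \<tau>) = id2 C (c \<cdot> w \<cdot> g)"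
    by (rule invertible_cell_inverse[OF t1])
  have d: "invertible_cell C (\<delta> \<star> id2 C g) (c \<cdot> w \<cdot> g) (c' \<cdot> w \<cdot> g)"
    using invertible_whisker(2)[OF assms(7), of g] assms w by simp
  define \<sigma> where "\<sigma> = (id2 C c' \<star> \<tau>) \<odot> (\<delta> \<star> id2 C g) \<odot> \<rho>"
  have s: "invertible_cell C \<sigma> c c'"
    unfolding \<sigma>_def using invertible_vcmp[OF invertible_vcmp[OF r(1) d] t2]
      r(1) d t1 t2 by simp
  note cs = invertible_cell_simps[OF t] invertible_cell_simps[OF s] invertible_cell_simps[OF r(1)]
    invertible_cell_simps[OF d] invertible_cell_simps[OF assms(7)]
  have "(id2 C c' \<star> \<tau>) \<odot> (\<sigma> \<star> id2 C (w \<cdot> g)) = \<sigma> \<odot> (id2 C c \<star> \<tau>)"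
    using exchange[of \<tau> \<sigma>] assms w y cs by simp
  also have "\<dots> = (id2 C c' \<star> \<tau>) \<odot> (\<delta> \<star> id2 C g)"
    unfolding \<sigma>_def using assms w y cs r(2) by simp
  finally have "\<sigma> \<star> id2 C (w \<cdot> g) = \<delta> \<star> id2 C g"
    by (rule vcmp_cancel_left[OF t2, rotated -1]) (use assms w y cs in auto)
  then have "(\<sigma> \<star> id2 C w) \<star> id2 C g = \<delta> \<star> id2 C g"
    using assms w y cs by simp
  then have "\<sigma> \<star> id2 C w = \<delta>"
    by (rule precomp_faithful[OF g, rotated -1]) (use assms w y cs in auto)
  with s show ?thesis by (rule that)
qed

lemma postcomp_full:
  assumes "equivalence C w x y" "c \<in> Ar C" "c' \<in> Ar C" "trg C c = x" "trg C c' = x"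
    "src C c = src C c'" "invertible_cell C \<delta> (w \<cdot> c) (w \<cdot> c')"
  obtains \<sigma> where "invertible_cell C \<sigma> c c'" "id2 C w \<star> \<sigma> = \<delta>"
proof -
  from assms(1) obtain g \<tau> where g: "equivalence C g y x"
    and t: "invertible_cell C \<tau> (g \<cdot> w) (id1 C x)"
    by (rule equivalence_inverse)
  note w = equivalence_arrow[OF assms(1)] equivalence_arrow[OF g]
  have x: "x \<in> Ob C" using w by auto
  have t1: "invertible_cell C (\<tau> \<star> id2 C c) (g \<cdot> w \<cdot> c) c"
    and t2: "invertible_cell C (\<tau> \<star> id2 C c') (g \<cdot> w \<cdot> c') c'"
    using invertible_whisker(2)[OF t, of c] invertible_whisker(2)[OF t, of c'] assms w x by auto
  obtain \<rho> where r: "invertible_cell C \<rho> c (g \<cdot> w \<cdot> c)" "\<rho> \<odot> (\<tau> \<star> id2 C c) = id2 C (g \<cdot> w \<cdot> c)"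
    by (rule invertible_cell_inverse[OF t1])
  have d: "invertible_cell C (id2 C g \<star> \<delta>) (g \<cdot> w \<cdot> c) (g \<cdot> w \<cdot> c')"
    using invertible_whisker(1)[OF assms(7), of g] assms w by simp
  define \<sigma> where "\<sigma> = (\<tau> \<star> id2 C c') \<odot> (id2 C g \<star> \<delta>) \<odot> \<rho>"
  have s: "invertible_cell C \<sigma> c c'"
    unfolding \<sigma>_def using invertible_vcmp[OF invertible_vcmp[OF r(1) d] t2]
      r(1) d t1 t2 by simp
  note cs = invertible_cell_simps[OF t] invertible_cell_simps[OF s] invertible_cell_simps[OF r(1)]
    invertible_cell_simps[OF d] invertible_cell_simps[OF assms(7)]
  have "(\<tau> \<star> id2 C c') \<odot> (id2 C (g \<cdot> w) \<star> \<sigma>) = \<sigma> \<odot> (\<tau> \<star> id2 C c)"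
    using exchange[of \<sigma> \<tau>] assms w x cs by simp
  also have "\<dots> = (\<tau> \<star> id2 C c') \<odot> (id2 C g \<star> \<delta>)"
    unfolding \<sigma>_def using assms w x cs r(2) by simp
  finally have "id2 C (g \<cdot> w) \<star> \<sigma> = id2 C g \<star> \<delta>"
    by (rule vcmp_cancel_left[OF t2, rotated -1]) (use assms w x cs in auto)
  then have "id2 C g \<star> id2 C w \<star> \<sigma> = id2 C g \<star> \<delta>"
    using assms w x cs by simp
  then have "id2 C w \<star> \<sigma> = \<delta>"
    by (rule postcomp_faithful[OF g, rotated -1]) (use assms w x cs in auto)
  with s show ?thesis by (rule that)
qed

lemma precomp_essentially_surjective:
  assumes "equivalence C w x y" "d \<in> Ar C" "src C d = x"
  obtains c \<sigma> where "c \<in> Ar C" "src C c = y" "trg C c = trg C d" "invertible_cell C \<sigma> (c \<cdot> w) d"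
proof -
  from assms(1) obtain g \<sigma> where w: "w \<in> Ar C" "src C w = x" "trg C w = y" "g \<in> Ar C"
    "src C g = y" "trg C g = x" and s: "invertible_cell C \<sigma> (g \<cdot> w) (id1 C x)"
    by (rule equivalenceE)
  show ?thesis
    using invertible_whisker(1)[OF s, of d] assms w
    by (intro that[of "d \<cdot> g" "id2 C d \<star> \<sigma>"]) auto
qed

text \<open>If \<open>g\<close> is a pseudo-inverse of \<open>u\<close>, then \<open>t\<close> is
  isomorphic to \<open>t \<cdot> u \<cdot> g\<close>, hence to \<open>v \<cdot> g\<close>. This is
  how 1-cells found by essential surjectivity turn out to be equivalences.\<close>

lemma equivalence_cancel_right:
  assumes "equivalence C u x y" "equivalence C v x z" "invertible_cell C \<sigma> (t \<cdot> u) v"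
    "t \<in> Ar C" "src C t = y"
  shows "equivalence C t y z"
proof -
  from assms(1) obtain g \<tau> where g: "equivalence C g y x"
    and t: "invertible_cell C \<tau> (u \<cdot> g) (id1 C y)"
    by (rule equivalence_inverse)
  note w = equivalence_arrow[OF assms(1)] equivalence_arrow[OF g] equivalence_arrow[OF assms(2)]
  have "y \<in> Ob C" using w by auto
  have vg: "equivalence C (v \<cdot> g) y z" using equivalence_comp g assms(2) by blast
  obtain \<sigma>' where s': "invertible_cell C \<sigma>' v (t \<cdot> u)" using invertible_cell_inverse[OF assms(3)] .
  have "invertible_cell C (\<sigma>' \<star> id2 C g) (v \<cdot> g) (t \<cdot> u \<cdot> g)"
    using invertible_whisker(2)[OF s', of g] w assms by simp
  moreover have "invertible_cell C (id2 C t \<star> \<tau>) (t \<cdot> u \<cdot> g) t"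
    using invertible_whisker(1)[OF t, of t] w assms by simp
  ultimately show ?thesis using equivalence_iso[OF vg invertible_vcmp] by blast
qed

section \<open>Adjoint equivalences\<close>

text \<open>
  The counit is determined by one triangle identity. For the other one, the composite \<open>Q\<close> satisfies
  \<open>Qf = 1\<close>, since \<open>\<eta>gf = gf\<eta>\<close> for an invertible \<open>\<eta>\<close> with domain an identity.
\<close>

lemma adjoint_equivalence_counit_exists:
  assumes "equivalence C f x y" "g \<in> Ar C" "src C g = y" "trg C g = x"
    "invertible_cell C \<eta> (id1 C x) (g \<cdot> f)"
  obtains \<epsilon> where "adjoint_equivalence C \<lparr>ladj = f, radj = g, adj_unit = \<eta>, adj_counit = \<epsilon>\<rparr> x y"
proof -
  note f = equivalence_arrow[OF assms(1)] equivalence_Ob[OF assms(1)]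
  note e = invertible_cell_simps[OF assms(5)]
  have fe: "invertible_cell C (id2 C f \<star> \<eta>) f (f \<cdot> g \<cdot> f)"
    using invertible_whisker(1)[OF assms(5), of f] assms f by simp
  obtain \<delta> where d: "invertible_cell C \<delta> (f \<cdot> g \<cdot> f) f" "\<delta> \<odot> (id2 C f \<star> \<eta>) = id2 C f"
    by (rule invertible_cell_inverse[OF fe])
  \<comment> \<open>Fullness of precomposition by \<open>f\<close> yields an \<epsilon> with
    \<open>\<epsilon>f\<close> inverse to \<open>f\<eta>\<close>, which is the first triangle
    identity.\<close>
  obtain \<epsilon> where ep: "invertible_cell C \<epsilon> (f \<cdot> g) (id1 C y)" "\<epsilon> \<star> id2 C f = \<delta>"
    using precomp_full[OF assms(1), of "f \<cdot> g" "id1 C y" \<delta>] assms f d by auto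
  note cs = invertible_cell_simps[OF ep(1)]
  define Q where "Q = (id2 C g \<star> \<epsilon>) \<odot> (\<eta> \<star> id2 C g)"
  have Q: "Q \<in> Ce C" "dom2 C Q = g" "cod2 C Q = g"
    unfolding Q_def using assms f e cs by auto
  have "((\<eta> \<star> id2 C (g \<cdot> f)) \<odot> \<eta>) = ((id2 C (g \<cdot> f) \<star> \<eta>) \<odot> \<eta>)"
    using exchange[of \<eta> \<eta>] assms f e by simp
  then have ee: "\<eta> \<star> id2 C (g \<cdot> f) = id2 C (g \<cdot> f) \<star> \<eta>"
    by (rule vcmp_cancel_right[OF assms(5), rotated -1]) (use assms f e in auto)
  have "Q \<star> id2 C f = (id2 C g \<star> \<epsilon> \<star> id2 C f) \<odot> (\<eta> \<star> id2 C (g \<cdot> f))"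
    unfolding Q_def using assms f e cs by simp
  also have "\<dots> = id2 C g \<star> ((\<epsilon> \<star> id2 C f) \<odot> (id2 C f \<star> \<eta>))"
    unfolding ee using assms f e cs by simp
  also have "\<dots> = id2 C g \<star> id2 C f" using ep d by simp
  finally have "Q = id2 C g"
    by (rule precomp_faithful[OF assms(1), rotated -1]) (use assms f Q in auto)
  then show ?thesis
    using that[of \<epsilon>] ep d assms f unfolding adjoint_equivalence_def arrow_def Q_def by simp
qed

lemma adjoint_equivalence_equivalence:
  assumes "adjoint_equivalence C e x y"
  shows "equivalence C (ladj e) x y"
proof -
  have e: "arrow C (ladj e) x y" "arrow C (radj e) y x"
     "invertible_cell C (adj_unit e) (id1 C x) (radj e \<cdot> ladj e)"
     "invertible_cell C (adj_counit e) (ladj e \<cdot> radj e) (id1 C y)"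
    using assms unfolding adjoint_equivalence_def by auto
  obtain \<sigma> where "invertible_cell C \<sigma> (radj e \<cdot> ladj e) (id1 C x)"
    using invertible_cell_inverse[OF e(3)] .
  with e show ?thesis unfolding arrow_def by (blast intro: equivalenceI)
qed

text \<open>A triangle identity makes \<open>\<epsilon>f\<close> inverse to the invertible
  \<open>f\<eta>\<close>, and precomposition with the equivalence \<open>f\<close> is faithful.
  Adjoint equivalences can therefore be compared on the adjoints and the unit alone.\<close>

lemma adjoint_equivalence_counit_unique:
  assumes "adjoint_equivalence C e x y" "adjoint_equivalence C e' x y" "ladj e = ladj e'"
    "radj e = radj e'" "adj_unit e = adj_unit e'"
  shows "e = e'"
proof -
  note eq = adjoint_equivalence_equivalence[OF assms(1)]
  have e: "arrow C (ladj e) x y" "arrow C (radj e) y x"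
     "invertible_cell C (adj_unit e) (id1 C x) (radj e \<cdot> ladj e)"
     "invertible_cell C (adj_counit e) (ladj e \<cdot> radj e) (id1 C y)"
     "invertible_cell C (adj_counit e') (ladj e \<cdot> radj e) (id1 C y)"
     "(adj_counit e \<star> id2 C (ladj e)) \<odot> (id2 C (ladj e) \<star> adj_unit e) = id2 C (ladj e)"
     "(adj_counit e' \<star> id2 C (ladj e)) \<odot> (id2 C (ladj e) \<star> adj_unit e) = id2 C (ladj e)"
    using assms unfolding adjoint_equivalence_def by auto
  note t = equivalence_Ob[OF eq] equivalence_arrow[OF eq] e(2)[unfolded arrow_def]
  note cs = invertible_cell_simps[OF e(3)] invertible_cell_simps[OF e(4)]
    invertible_cell_simps[OF e(5)]
  have i: "invertible_cell C (id2 C (ladj e) \<star> adj_unit e) (ladj e) (ladj e \<cdot> radj e \<cdot> ladj e)"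
    using invertible_whisker(1)[OF e(3), of "ladj e"] t by simp
  have "adj_counit e \<star> id2 C (ladj e) = adj_counit e' \<star> id2 C (ladj e)"
    by (rule vcmp_cancel_right[OF i]) (use e(6,7) t cs in auto)
  then have "adj_counit e = adj_counit e'"
    by (rule precomp_faithful[OF eq, rotated -1]) (use t cs in auto)
  then show ?thesis using assms by (cases e; cases e') auto
qed

lemma adjoint_equivalence_exists:
  assumes "equivalence C f x y"
  obtains e where "adjoint_equivalence C e x y" "ladj e = f"
proof -
  from assms(1) obtain g \<sigma> where g: "g \<in> Ar C" "src C g = y" "trg C g = x"
    and s: "invertible_cell C \<sigma> (g \<cdot> f) (id1 C x)"
    by (rule equivalenceE)
  obtain \<eta> where "invertible_cell C \<eta> (id1 C x) (g \<cdot> f)" using invertible_cell_inverse[OF s] .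
  then obtain \<epsilon> where "adjoint_equivalence C \<lparr>ladj = f, radj = g, adj_unit = \<eta>, adj_counit = \<epsilon>\<rparr> x y"
    using adjoint_equivalence_counit_exists[OF assms g] by blast
  then show ?thesis by (rule that) simp
qed

end

section \<open>2-functors, and lifting adjoint equivalences along fibrations\<close>

context two_functor
begin

lemma map_typing [simp]:
  "f \<in> Ar C \<Longrightarrow> on_ar P f \<in> Ar D"
  "f \<in> Ar C \<Longrightarrow> src D (on_ar P f) = on_ob P (src C f)"
  "f \<in> Ar C \<Longrightarrow> trg D (on_ar P f) = on_ob P (trg C f)"
  "\<sigma> \<in> Ce C \<Longrightarrow> on_ce P \<sigma> \<in> Ce D"
  "\<sigma> \<in> Ce C \<Longrightarrow> dom2 D (on_ce P \<sigma>) = on_ar P (dom2 C \<sigma>)"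
  "\<sigma> \<in> Ce C \<Longrightarrow> cod2 D (on_ce P \<sigma>) = on_ar P (cod2 C \<sigma>)"
  using map_ar map_ce unfolding arrow_def cell_def by blast+

declare map_ob [simp] map_id1 [simp] map_id2 [simp]

lemma map_cmp [simp]:
  "f \<in> Ar C \<Longrightarrow> g \<in> Ar C \<Longrightarrow> trg C f = src C g \<Longrightarrow>
    on_ar P (g \<cdot>\<^bsub>C\<^esub> f) = on_ar P g \<cdot>\<^bsub>D\<^esub> on_ar P f"
  "\<sigma> \<in> Ce C \<Longrightarrow> \<tau> \<in> Ce C \<Longrightarrow> cod2 C \<sigma> = dom2 C \<tau> \<Longrightarrow>
    on_ce P (\<tau> \<odot>\<^bsub>C\<^esub> \<sigma>) = on_ce P \<tau> \<odot>\<^bsub>D\<^esub> on_ce P \<sigma>"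
  "\<sigma> \<in> Ce C \<Longrightarrow> \<tau> \<in> Ce C \<Longrightarrow> trg C (dom2 C \<sigma>) = src C (dom2 C \<tau>) \<Longrightarrow>
    on_ce P (\<tau> \<star>\<^bsub>C\<^esub> \<sigma>) = on_ce P \<tau> \<star>\<^bsub>D\<^esub> on_ce P \<sigma>"
  using map_cmp1 map_vcmp map_hcmp unfolding arrow_def cell_def by blast+

lemma map_invertible_cell:
  assumes "invertible_cell C \<sigma> f g"
  shows "invertible_cell D (on_ce P \<sigma>) (on_ar P f) (on_ar P g)"
proof -
  from assms obtain \<tau> where t: "\<sigma> \<in> Ce C" "dom2 C \<sigma> = f" "cod2 C \<sigma> = g" "\<tau> \<in> Ce C"
    "dom2 C \<tau> = g" "cod2 C \<tau> = f" "\<tau> \<odot>\<^bsub>C\<^esub> \<sigma> = id2 C f" "\<sigma> \<odot>\<^bsub>C\<^esub> \<tau> = id2 C g"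
    by (rule source.invertible_cellE)
  have "f \<in> Ar C" "g \<in> Ar C" using t by auto
  then have "on_ce P \<tau> \<odot>\<^bsub>D\<^esub> on_ce P \<sigma> = id2 D (on_ar P f)"
    "on_ce P \<sigma> \<odot>\<^bsub>D\<^esub> on_ce P \<tau> = id2 D (on_ar P g)"
    using arg_cong[OF t(7), of "on_ce P"] arg_cong[OF t(8), of "on_ce P"] t(1-6) by simp_all
  then show ?thesis
    using t by (intro target.invertible_cellI[of _ _ _ "on_ce P \<tau>"]) auto
qed

lemma map_equivalence:
  assumes "equivalence C f x y"
  shows "equivalence D (on_ar P f) (on_ob P x) (on_ob P y)"
proof -
  from assms obtain g \<sigma> \<tau> where f: "f \<in> Ar C" "src C f = x" "trg C f = y" "g \<in> Ar C"
    "src C g = y" "trg C g = x"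
    and s: "invertible_cell C \<sigma> (g \<cdot>\<^bsub>C\<^esub> f) (id1 C x)"
    and t: "invertible_cell C \<tau> (f \<cdot>\<^bsub>C\<^esub> g) (id1 C y)"
    by (rule source.equivalenceE)
  have "x \<in> Ob C" "y \<in> Ob C" using f by auto
  with map_invertible_cell[OF s] map_invertible_cell[OF t] f show ?thesis
    by (intro target.equivalenceI[of _ _ _ "on_ar P g"]) auto
qed

lemma map_adjoint_equivalence:
  assumes "adjoint_equivalence C e x y"
  shows "adjoint_equivalence D (map_adjeq P e) (on_ob P x) (on_ob P y)"
proof -
  have e: "ladj e \<in> Ar C" "src C (ladj e) = x" "trg C (ladj e) = y"
    "radj e \<in> Ar C" "src C (radj e) = y" "trg C (radj e) = x"
    "invertible_cell C (adj_unit e) (id1 C x) (radj e \<cdot>\<^bsub>C\<^esub> ladj e)"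
    "invertible_cell C (adj_counit e) (ladj e \<cdot>\<^bsub>C\<^esub> radj e) (id1 C y)"
    "(adj_counit e \<star>\<^bsub>C\<^esub> id2 C (ladj e)) \<odot>\<^bsub>C\<^esub> (id2 C (ladj e) \<star>\<^bsub>C\<^esub> adj_unit e) = id2 C (ladj e)"
    "(id2 C (radj e) \<star>\<^bsub>C\<^esub> adj_counit e) \<odot>\<^bsub>C\<^esub> (adj_unit e \<star>\<^bsub>C\<^esub> id2 C (radj e)) = id2 C (radj e)"
    using assms unfolding adjoint_equivalence_def arrow_def by auto
  have o: "x \<in> Ob C" "y \<in> Ob C" using e by auto
  note cs = source.invertible_cell_simps[OF e(7)] source.invertible_cell_simps[OF e(8)]
  show ?thesis
    using map_invertible_cell[OF e(7)] map_invertible_cell[OF e(8)] arg_cong[OF e(9), of "on_ce P"]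
      arg_cong[OF e(10), of "on_ce P"] e(1-6) cs o
    unfolding adjoint_equivalence_def arrow_def map_adjeq_def by simp
qed

end

text \<open>Some adjoint equivalence on \<open>f\<close> exists upstairs, but its image may have
  another right adjoint and unit than prescribed. Right adjoints of the same 1-cell are isomorphic
  compatibly with the units; lifting this isomorphism replaces the right adjoint, and the unit is
  transported along it. The counit then agrees by uniqueness.\<close>

lemma two_fibration_lift_adjoint_equivalence:
  assumes fib: "two_fibration E B P" and f: "equivalence E f x y"
    and e: "adjoint_equivalence B e (on_ob P x) (on_ob P y)" "on_ar P f = ladj e"
  obtains e' where "adjoint_equivalence E e' x y" "ladj e' = f" "map_adjeq P e' = e"
proof -
  interpret two_functor E B P using fib unfolding two_fibration_def by simp
  have lift: "\<exists>g' \<beta>'. invertible_cell E \<beta>' g' h \<and> on_ar P g' = g \<and> on_ce P \<beta>' = \<beta>"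
    if "h \<in> Ar E" "invertible_cell B \<beta> g (on_ar P h)" for h g \<beta>
    using that fib unfolding two_fibration_def by blast
  obtain e0 where e0: "adjoint_equivalence E e0 x y" "ladj e0 = f"
    using source.adjoint_equivalence_exists[OF f] .
  define r u where "r = radj e0" and "u = adj_unit e0"
  have r: "r \<in> Ar E" "src E r = y" "trg E r = x" and u: "invertible_cell E u (id1 E x) (r \<cdot>\<^bsub>E\<^esub> f)"
    using e0 unfolding adjoint_equivalence_def arrow_def r_def u_def by auto
  have s: "radj e \<in> Ar B" "src B (radj e) = on_ob P y" "trg B (radj e) = on_ob P x"
    and n: "invertible_cell B (adj_unit e) (id1 B (on_ob P x)) (radj e \<cdot>\<^bsub>B\<^esub> ladj e)"
    using e unfolding adjoint_equivalence_def arrow_def by auto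
  note f' = source.equivalence_arrow[OF f] source.equivalence_Ob[OF f]
  note l = map_equivalence[OF f, unfolded e(2)]
  note l' = target.equivalence_arrow[OF l]
  note us = source.invertible_cell_simps[OF u]
  have Pu: "invertible_cell B (on_ce P u) (id1 B (on_ob P x)) (on_ar P r \<cdot>\<^bsub>B\<^esub> ladj e)"
    using map_invertible_cell[OF u] f' r e(2) by simp
  obtain n' where n': "invertible_cell B n' (radj e \<cdot>\<^bsub>B\<^esub> ladj e) (id1 B (on_ob P x))"
    "n' \<odot>\<^bsub>B\<^esub> adj_unit e = id2 B (id1 B (on_ob P x))"
    by (rule target.invertible_cell_inverse[OF n])
  \<comment> \<open>As \<open>n'\<close> inverts the prescribed unit, the equation says that
    whiskering \<theta> by \<open>ladj e\<close> carries the prescribed unit to the image of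
    \<open>u\<close>.\<close>
  obtain \<theta> where th: "invertible_cell B \<theta> (radj e) (on_ar P r)"
    "\<theta> \<star>\<^bsub>B\<^esub> id2 B (ladj e) = on_ce P u \<odot>\<^bsub>B\<^esub> n'"
    using target.precomp_full[OF l s(1) _ s(2) _ _ target.invertible_vcmp[OF n'(1) Pu]] r s by auto
  obtain s' \<theta>' where th': "invertible_cell E \<theta>' s' r" "on_ar P s' = radj e" "on_ce P \<theta>' = \<theta>"
    using lift[OF r(1) th(1)] by blast
  \<comment> \<open>The lift \<theta>' points from the new right adjoint \<open>s'\<close> to
    \<open>r\<close>, so the unit \<open>u\<close> has to be transported along its inverse.\<close>
  obtain \<theta>'' where th'': "invertible_cell E \<theta>'' r s'" "\<theta>'' \<odot>\<^bsub>E\<^esub> \<theta>' = id2 E s'"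
    by (rule source.invertible_cell_inverse[OF th'(1)])
  have s': "s' \<in> Ar E" "src E s' = y" "trg E s' = x"
    using source.invertible_cell_Ar[OF th'(1)] r by auto
  have "invertible_cell E (\<theta>'' \<star>\<^bsub>E\<^esub> id2 E f) (r \<cdot>\<^bsub>E\<^esub> f) (s' \<cdot>\<^bsub>E\<^esub> f)"
    using source.invertible_whisker(2)[OF th''(1), of f] f' r by simp
  from source.invertible_vcmp[OF u this] obtain c where
    c: "adjoint_equivalence E \<lparr>ladj = f, radj = s', adj_unit = (\<theta>'' \<star>\<^bsub>E\<^esub> id2 E f) \<odot>\<^bsub>E\<^esub> u,
      adj_counit = c\<rparr> x y" (is "adjoint_equivalence E ?e' x y")
    using source.adjoint_equivalence_counit_exists[OF f s'] by blast
  note cs = us source.invertible_cell_simps[OF th'(1)] source.invertible_cell_simps[OF th''(1)]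
    target.invertible_cell_simps[OF Pu] target.invertible_cell_simps[OF n'(1)]
    target.invertible_cell_simps[OF n] target.invertible_cell_simps[OF th(1)]
  have "on_ce P \<theta>'' \<odot>\<^bsub>B\<^esub> \<theta> = id2 B (radj e)"
    using arg_cong[OF th''(2), of "on_ce P"] th' cs s' by simp
  then have "id2 B (radj e \<cdot>\<^bsub>B\<^esub> ladj e) = (on_ce P \<theta>'' \<odot>\<^bsub>B\<^esub> \<theta>) \<star>\<^bsub>B\<^esub> id2 B (ladj e)"
    using s l' by simp
  also have "\<dots> = (on_ce P \<theta>'' \<star>\<^bsub>B\<^esub> id2 B (ladj e)) \<odot>\<^bsub>B\<^esub> on_ce P u \<odot>\<^bsub>B\<^esub> n'"
    using s l' cs th(2) r f' by simp
  finally have "id2 B (radj e \<cdot>\<^bsub>B\<^esub> ladj e) \<odot>\<^bsub>B\<^esub> adj_unit e = ((on_ce P \<theta>'' \<star>\<^bsub>B\<^esub> id2 B (ladj e)) \<odot>\<^bsub>B\<^esub> on_ce P u \<odot>\<^bsub>B\<^esub> n')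
      \<odot>\<^bsub>B\<^esub> adj_unit e"
    by simp
  also have "\<dots> = (on_ce P \<theta>'' \<star>\<^bsub>B\<^esub> id2 B (ladj e)) \<odot>\<^bsub>B\<^esub> on_ce P u"
    using s l' cs n'(2) r f' e(2) by simp
  finally have "(on_ce P \<theta>'' \<star>\<^bsub>B\<^esub> id2 B (ladj e)) \<odot>\<^bsub>B\<^esub> on_ce P u = adj_unit e"
    using s l' cs by simp
  then have "map_adjeq P ?e' = e"
    using target.adjoint_equivalence_counit_unique[OF map_adjoint_equivalence[OF c] e(1)]
      e(2) th'(2) f' cs s' r by (simp add: map_adjeq_def)
  with c show ?thesis by (intro that[of ?e']) auto
qed

context two_category
begin

text \<open>
  The second axiom for an adjoint biequivalence, whiskered by \<open>f\<close> and precomposed with \<open>f\<eta>\<close>.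
  It is applied with \<open>p = f\<close>, \<open>q = fgf\<close>, \<open>r = fgfgf\<close>, \<open>u = f\<eta>\<close>, \<open>e = \<epsilon>f\<close>, \<open>v = f\<eta>gf\<close>, \<open>w = fgf\<eta>\<close>,
  \<open>a = fg\<epsilon>f\<close>, \<open>b = \<epsilon>fgf\<close>, \<open>S1 = fgS\<close>, \<open>S2 = Sgf\<close>, \<open>T1 = fTf\<close> and the interchange cells
  \<open>N = f\<eta>\<^sub>\<eta>\<close>, \<open>E = \<epsilon>\<^sub>\<epsilon>f\<close>, \<open>M = \<epsilon>\<close> at \<open>f\<eta>\<close>. Then \<open>H1\<close> is the first axiom, and \<open>H2\<close>, \<open>H3\<close> are
  the naturality of the interchange cells with respect to \<open>S\<close>.
\<close>

lemma swallowtail_swap: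
  assumes ob: "p \<in> Ob C" "q \<in> Ob C" "r \<in> Ob C"
    and ar: "arrow C u p q" "arrow C e q p" "arrow C v q r" "arrow C w q r"
      "arrow C a r q" "arrow C b r q"
    and S: "invertible_cell C S (e \<cdot> u) (id1 C p)"
    and ce: "cell C S1 (a \<cdot> w) (id1 C q)" "cell C S2 (b \<cdot> v) (id1 C q)" "cell C N (v \<cdot> u) (w \<cdot> u)"
      "cell C E (e \<cdot> a) (e \<cdot> b)" "cell C M (b \<cdot> w) (u \<cdot> e)" "cell C T1 (id1 C q) (a \<cdot> v)"
    and H1: "(S1 \<star> id2 C u) \<odot> (id2 C a \<star> N) \<odot> (T1 \<star> id2 C u) = id2 C u"
    and H2: "id2 C e \<star> S1 = (S \<star> id2 C e) \<odot> (id2 C e \<star> M) \<odot> (E \<star> id2 C w)"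
    and H3: "S2 \<star> id2 C u = (id2 C u \<star> S) \<odot> (M \<star> id2 C u) \<odot> (id2 C b \<star> N)"
  shows "(id2 C e \<star> S2 \<star> id2 C u) \<odot> (E \<star> id2 C (v \<cdot> u)) \<odot> (id2 C e \<star> T1 \<star> id2 C u) = id2 C (e \<cdot> u)"
proof -
  note t = ob ar[unfolded arrow_def] ce[unfolded cell_def] invertible_cell_simps[OF S]
  define x where "x = e \<cdot> u"
  have x: "x \<in> Ar C" "src C x = p" "trg C x = p" unfolding x_def using t by auto
  \<comment> \<open>Exchange of \<open>S\<close> with itself: as the codomain of \<open>S\<close> is
    an identity, one factor on each side reduces to \<open>S\<close>, which cancels.\<close>
  have "S \<odot> (S \<star> id2 C x) = S \<odot> (id2 C x \<star> S)"
    using exchange[of S S] t x by (simp add: x_def)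
  then have SS: "S \<star> id2 C x = id2 C x \<star> S"
    by (rule vcmp_cancel_left[OF S, rotated -1]) (use t x in \<open>auto simp: x_def\<close>)
  \<comment> \<open>\<open>H1\<close> whiskered by \<open>e\<close>. \<open>H2\<close> trades
    \<open>S1\<close> for \<open>S\<close>, and the exchange of \<open>N\<close> with
    \<open>E\<close> brings together the factors from which \<open>H3\<close> assembles
    \<open>S2\<close>; \<open>SS\<close> moves \<open>S\<close> to the side on which
    \<open>H3\<close> needs it.\<close>
  have "id2 C x = id2 C e \<star> ((S1 \<star> id2 C u) \<odot> (id2 C a \<star> N) \<odot> (T1 \<star> id2 C u))"
    unfolding H1 x_def using t by simp
  also have "\<dots> = ((id2 C e \<star> S1) \<star> id2 C u) \<odot> (id2 C (e \<cdot> a) \<star> N) \<odot> (id2 C e \<star> T1 \<star> id2 C u)"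
    using t by simp
  also have "\<dots> = (S \<star> id2 C x) \<odot> (id2 C e \<star> M \<star> id2 C u) \<odot> ((E \<star> id2 C (w \<cdot> u)) \<odot> (id2 C (e \<cdot> a) \<star> N))
     \<odot> (id2 C e \<star> T1 \<star> id2 C u)"
    unfolding H2 x_def using t by simp
  also have "(E \<star> id2 C (w \<cdot> u)) \<odot> (id2 C (e \<cdot> a) \<star> N) = (id2 C (e \<cdot> b) \<star> N) \<odot> (E \<star> id2 C (v \<cdot> u))"
    using exchange[of N E] t by simp
  finally have *: "id2 C x = (id2 C x \<star> S) \<odot> (id2 C e \<star> M \<star> id2 C u) \<odot> (id2 C (e \<cdot> b) \<star> N) \<odot>
     (E \<star> id2 C (v \<cdot> u)) \<odot> (id2 C e \<star> T1 \<star> id2 C u)" unfolding SS using t by simp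
  show ?thesis unfolding H3 using t * by (simp add: x_def)
qed

end

section \<open>Whiskering in Gray-categories\<close>

context gray_category
begin

sublocale H: two_category "Homs G"
  by (rule Homs)

abbreviation "H \<equiv> Homs G"
abbreviation "oo \<equiv> on_oo (gcomp G)"
abbreviation "ao \<equiv> on_ao (gcomp G)"
abbreviation "oa \<equiv> on_oa (gcomp G)"
abbreviation "to \<equiv> on_to (gcomp G)"
abbreviation "ot \<equiv> on_ot (gcomp G)"
abbreviation "aa \<equiv> on_aa (gcomp G)"

text \<open>\<open>hom\<close> only restricts the carriers of \<open>H\<close> and shares its
  operations. Since inverses and pseudo-inverses stay in the hom of the given cell, all notions
  transfer and the arguments can be carried out in the single 2-category \<open>H\<close>.\<close>

lemma hom_simps [simp]:
  "f \<in> Ob (hom G X Y) \<longleftrightarrow> f \<in> Ob H \<and> dom0 G f = X \<and> cod0 G f = Y"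
  "\<alpha> \<in> Ar (hom G X Y) \<longleftrightarrow> \<alpha> \<in> Ar H \<and> dom0 G (src H \<alpha>) = X \<and> cod0 G (src H \<alpha>) = Y"
  "\<Gamma> \<in> Ce (hom G X Y) \<longleftrightarrow>
     \<Gamma> \<in> Ce H \<and> dom0 G (src H (dom2 H \<Gamma>)) = X \<and> cod0 G (src H (dom2 H \<Gamma>)) = Y"
  "src (hom G X Y) = src H" "trg (hom G X Y) = trg H"
  "dom2 (hom G X Y) = dom2 H" "cod2 (hom G X Y) = cod2 H"
  "id1 (hom G X Y) = id1 H" "cmp1 (hom G X Y) = cmp1 H"
  "id2 (hom G X Y) = id2 H" "vcmp (hom G X Y) = vcmp H" "hcmp (hom G X Y) = hcmp H"
  by (auto simp: hom_def)

declare dom0_Obj [simp] cod0_Obj [simp] dom0_trg [simp] cod0_trg [simp]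

lemma arrow_hom:
  "arrow (hom G X Y) f a b \<longleftrightarrow> arrow H f a b \<and> dom0 G a = X \<and> cod0 G a = Y"
  by (auto simp: arrow_def)

lemma cell_hom:
  "cell (hom G X Y) \<sigma> f g \<longleftrightarrow> cell H \<sigma> f g \<and> dom0 G (src H f) = X \<and> cod0 G (src H f) = Y"
  by (auto simp: cell_def)

lemma invertible_cell_hom:
  "invertible_cell (hom G X Y) \<sigma> f g \<longleftrightarrow>
    invertible_cell H \<sigma> f g \<and> dom0 G (src H f) = X \<and> cod0 G (src H f) = Y"
  unfolding invertible_cell_def cell_hom by (auto simp: cell_def)

lemma equivalence_hom:
  "equivalence (hom G X Y) f a b \<longleftrightarrow> equivalence H f a b \<and> dom0 G a = X \<and> cod0 G a = Y"
proof -
  have "dom0 G b = dom0 G a \<and> cod0 G b = cod0 G a" if "arrow H f a b"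
    using that dom0_trg[of f] cod0_trg[of f] by (auto simp: arrow_def)
  moreover have "src H (id1 H a) = a \<and> src H (id1 H b) = b" if "arrow H f a b"
    using that by (auto simp: arrow_def)
  moreover have "src H (g \<cdot>\<^bsub>H\<^esub> f) = a \<and> src H (f \<cdot>\<^bsub>H\<^esub> g) = b" if "arrow H f a b" "arrow H g b a" for g
    using that by (auto simp: arrow_def)
  ultimately show ?thesis
    unfolding equivalence_def arrow_hom invertible_cell_hom by auto
qed

lemma adjoint_equivalence_hom:
  "adjoint_equivalence (hom G X Y) e a b \<longleftrightarrow> adjoint_equivalence H e a b \<and> dom0 G a = X \<and> cod0 G a = Y"
proof -
  have "dom0 G b = dom0 G a \<and> cod0 G b = cod0 G a \<and> src H (id1 H a) = a" if "arrow H f a b" for f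
    using that dom0_trg[of f] cod0_trg[of f] by (auto simp: arrow_def)
  moreover have "src H (f \<cdot>\<^bsub>H\<^esub> g) = b" if "arrow H f a b" "arrow H g b a" for f g
    using that by (auto simp: arrow_def)
  ultimately show ?thesis
    unfolding adjoint_equivalence_def arrow_hom invertible_cell_hom by auto
qed

lemma unit0_typing [simp]:
  "X \<in> Obj G \<Longrightarrow> unit0 G X \<in> Ob H"
  "X \<in> Obj G \<Longrightarrow> dom0 G (unit0 G X) = X"
  "X \<in> Obj G \<Longrightarrow> cod0 G (unit0 G X) = X"
  using unit_Ob by auto

lemma unit_whisker [simp]:
  "f \<in> Ob H \<Longrightarrow> cod0 G f = Y \<Longrightarrow> oo (unit0 G Y) f = f"
  "\<alpha> \<in> Ar H \<Longrightarrow> cod0 G (src H \<alpha>) = Y \<Longrightarrow> oa (unit0 G Y) \<alpha> = \<alpha>"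
  "\<Gamma> \<in> Ce H \<Longrightarrow> cod0 G (src H (dom2 H \<Gamma>)) = Y \<Longrightarrow> ot (unit0 G Y) \<Gamma> = \<Gamma>"
  "f \<in> Ob H \<Longrightarrow> dom0 G f = X \<Longrightarrow> oo f (unit0 G X) = f"
  "\<alpha> \<in> Ar H \<Longrightarrow> dom0 G (src H \<alpha>) = X \<Longrightarrow> ao \<alpha> (unit0 G X) = \<alpha>"
  "\<Gamma> \<in> Ce H \<Longrightarrow> dom0 G (src H (dom2 H \<Gamma>)) = X \<Longrightarrow> to \<Gamma> (unit0 G X) = \<Gamma>"
  by (auto intro!: unit_left_o unit_left_a unit_left_t unit_right_o unit_right_a unit_right_t)

lemma right_whisker_two_functor:
  assumes "f \<in> Ob H" "Z \<in> Obj G"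
  shows "two_functor (hom G (cod0 G f) Z) (hom G (dom0 G f) Z) (fix_right (gcomp G) f)"
  using gray_map.left_functor[OF comp_gray_map[of "dom0 G f" "cod0 G f" Z], of f] assms by auto

lemma left_whisker_two_functor:
  assumes "g \<in> Ob H" "X \<in> Obj G"
  shows "two_functor (hom G X (dom0 G g)) (hom G X (cod0 G g)) (fix_left (gcomp G) g)"
  using gray_map.right_functor[OF comp_gray_map[of X "dom0 G g" "cod0 G g"], of g] assms by auto

lemma oo_typing [simp]:
  assumes "f \<in> Ob H" "g \<in> Ob H" "cod0 G f = dom0 G g"
  shows "oo g f \<in> Ob H" "dom0 G (oo g f) = dom0 G f" "cod0 G (oo g f) = cod0 G g"
  using two_functor.map_ob[OF right_whisker_two_functor[of f "cod0 G g"], of g] assms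
  by (auto simp: fix_right_def)

lemma ao_simps [simp]:
  assumes "f \<in> Ob H" "\<alpha> \<in> Ar H" "cod0 G f = dom0 G (src H \<alpha>)"
  shows "ao \<alpha> f \<in> Ar H" "src H (ao \<alpha> f) = oo (src H \<alpha>) f" "trg H (ao \<alpha> f) = oo (trg H \<alpha>) f"
    "\<beta> \<in> Ar H \<Longrightarrow> trg H \<alpha> = src H \<beta> \<Longrightarrow> ao (\<beta> \<cdot>\<^bsub>H\<^esub> \<alpha>) f = ao \<beta> f \<cdot>\<^bsub>H\<^esub> ao \<alpha> f"
    "to (id2 H \<alpha>) f = id2 H (ao \<alpha> f)"
proof -
  interpret two_functor "hom G (cod0 G f) (cod0 G (src H \<alpha>))" "hom G (dom0 G f) (cod0 G (src H \<alpha>))"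
    "fix_right (gcomp G) f"
    using assms by (intro right_whisker_two_functor) auto
  show "ao \<alpha> f \<in> Ar H" "src H (ao \<alpha> f) = oo (src H \<alpha>) f" "trg H (ao \<alpha> f) = oo (trg H \<alpha>) f"
    "to (id2 H \<alpha>) f = id2 H (ao \<alpha> f)"
    using map_typing(1-3)[of \<alpha>] map_id2[of \<alpha>] assms by (auto simp: fix_right_def)
  show "ao (\<beta> \<cdot>\<^bsub>H\<^esub> \<alpha>) f = ao \<beta> f \<cdot>\<^bsub>H\<^esub> ao \<alpha> f" if "\<beta> \<in> Ar H" "trg H \<alpha> = src H \<beta>"
    using map_cmp(1)[of \<alpha> \<beta>] assms that dom0_trg[of \<alpha>] cod0_trg[of \<alpha>] by (simp add: fix_right_def)
qed

lemma oa_simps [simp]: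
  assumes "g \<in> Ob H" "\<alpha> \<in> Ar H" "cod0 G (src H \<alpha>) = dom0 G g"
  shows "oa g \<alpha> \<in> Ar H" "src H (oa g \<alpha>) = oo g (src H \<alpha>)" "trg H (oa g \<alpha>) = oo g (trg H \<alpha>)"
    "\<beta> \<in> Ar H \<Longrightarrow> trg H \<alpha> = src H \<beta> \<Longrightarrow> oa g (\<beta> \<cdot>\<^bsub>H\<^esub> \<alpha>) = oa g \<beta> \<cdot>\<^bsub>H\<^esub> oa g \<alpha>"
    "ot g (id2 H \<alpha>) = id2 H (oa g \<alpha>)"
proof -
  interpret two_functor "hom G (dom0 G (src H \<alpha>)) (dom0 G g)" "hom G (dom0 G (src H \<alpha>)) (cod0 G g)"
    "fix_left (gcomp G) g"
    using assms by (intro left_whisker_two_functor) auto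
  show "oa g \<alpha> \<in> Ar H" "src H (oa g \<alpha>) = oo g (src H \<alpha>)" "trg H (oa g \<alpha>) = oo g (trg H \<alpha>)"
    "ot g (id2 H \<alpha>) = id2 H (oa g \<alpha>)"
    using map_typing(1-3)[of \<alpha>] map_id2[of \<alpha>] assms by (auto simp: fix_left_def)
  show "oa g (\<beta> \<cdot>\<^bsub>H\<^esub> \<alpha>) = oa g \<beta> \<cdot>\<^bsub>H\<^esub> oa g \<alpha>" if "\<beta> \<in> Ar H" "trg H \<alpha> = src H \<beta>"
    using map_cmp(1)[of \<alpha> \<beta>] assms that dom0_trg[of \<alpha>] cod0_trg[of \<alpha>] by (simp add: fix_left_def)
qed

lemma whisker_id1 [simp]:
  assumes "f \<in> Ob H" "g \<in> Ob H" "cod0 G f = dom0 G g"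
  shows "ao (id1 H g) f = id1 H (oo g f)" "oa g (id1 H f) = id1 H (oo g f)"
  using two_functor.map_id1[OF right_whisker_two_functor[of f "cod0 G g"], of g]
    two_functor.map_id1[OF left_whisker_two_functor[of g "dom0 G f"], of f] assms
  by (auto simp: fix_left_def fix_right_def)

lemma to_simps [simp]:
  assumes "f \<in> Ob H" "\<sigma> \<in> Ce H" "cod0 G f = dom0 G (src H (dom2 H \<sigma>))"
  shows "to \<sigma> f \<in> Ce H" "dom2 H (to \<sigma> f) = ao (dom2 H \<sigma>) f" "cod2 H (to \<sigma> f) = ao (cod2 H \<sigma>) f"
    "\<tau> \<in> Ce H \<Longrightarrow> cod2 H \<sigma> = dom2 H \<tau> \<Longrightarrow> to (\<tau> \<odot>\<^bsub>H\<^esub> \<sigma>) f = to \<tau> f \<odot>\<^bsub>H\<^esub> to \<sigma> f"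
    "\<tau> \<in> Ce H \<Longrightarrow> trg H (dom2 H \<sigma>) = src H (dom2 H \<tau>) \<Longrightarrow> to (\<tau> \<star>\<^bsub>H\<^esub> \<sigma>) f = to \<tau> f \<star>\<^bsub>H\<^esub> to \<sigma> f"
proof -
  let ?Y = "cod0 G (src H (dom2 H \<sigma>))"
  interpret two_functor "hom G (cod0 G f) ?Y" "hom G (dom0 G f) ?Y" "fix_right (gcomp G) f"
    using assms by (intro right_whisker_two_functor) auto
  show "to \<sigma> f \<in> Ce H" "dom2 H (to \<sigma> f) = ao (dom2 H \<sigma>) f" "cod2 H (to \<sigma> f) = ao (cod2 H \<sigma>) f"
    using map_typing(4-6)[of \<sigma>] assms by (auto simp: fix_right_def)
  show "to (\<tau> \<odot>\<^bsub>H\<^esub> \<sigma>) f = to \<tau> f \<odot>\<^bsub>H\<^esub> to \<sigma> f" if "\<tau> \<in> Ce H" "cod2 H \<sigma> = dom2 H \<tau>"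
    using map_cmp(2)[of \<sigma> \<tau>] assms that H.src_cod2[of \<sigma>] by (simp add: fix_right_def)
  show "to (\<tau> \<star>\<^bsub>H\<^esub> \<sigma>) f = to \<tau> f \<star>\<^bsub>H\<^esub> to \<sigma> f"
    if "\<tau> \<in> Ce H" "trg H (dom2 H \<sigma>) = src H (dom2 H \<tau>)"
    using map_cmp(3)[of \<sigma> \<tau>] assms that dom0_trg[of "dom2 H \<sigma>"] cod0_trg[of "dom2 H \<sigma>"]
    by (simp add: fix_right_def)
qed

lemma ot_simps [simp]:
  assumes "g \<in> Ob H" "\<sigma> \<in> Ce H" "cod0 G (src H (dom2 H \<sigma>)) = dom0 G g"
  shows "ot g \<sigma> \<in> Ce H" "dom2 H (ot g \<sigma>) = oa g (dom2 H \<sigma>)" "cod2 H (ot g \<sigma>) = oa g (cod2 H \<sigma>)"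
    "\<tau> \<in> Ce H \<Longrightarrow> cod2 H \<sigma> = dom2 H \<tau> \<Longrightarrow> ot g (\<tau> \<odot>\<^bsub>H\<^esub> \<sigma>) = ot g \<tau> \<odot>\<^bsub>H\<^esub> ot g \<sigma>"
    "\<tau> \<in> Ce H \<Longrightarrow> trg H (dom2 H \<sigma>) = src H (dom2 H \<tau>) \<Longrightarrow> ot g (\<tau> \<star>\<^bsub>H\<^esub> \<sigma>) = ot g \<tau> \<star>\<^bsub>H\<^esub> ot g \<sigma>"
proof -
  let ?X = "dom0 G (src H (dom2 H \<sigma>))"
  interpret two_functor "hom G ?X (dom0 G g)" "hom G ?X (cod0 G g)" "fix_left (gcomp G) g"
    using assms by (intro left_whisker_two_functor) auto
  show "ot g \<sigma> \<in> Ce H" "dom2 H (ot g \<sigma>) = oa g (dom2 H \<sigma>)" "cod2 H (ot g \<sigma>) = oa g (cod2 H \<sigma>)"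
    using map_typing(4-6)[of \<sigma>] assms by (auto simp: fix_left_def)
  show "ot g (\<tau> \<odot>\<^bsub>H\<^esub> \<sigma>) = ot g \<tau> \<odot>\<^bsub>H\<^esub> ot g \<sigma>" if "\<tau> \<in> Ce H" "cod2 H \<sigma> = dom2 H \<tau>"
    using map_cmp(2)[of \<sigma> \<tau>] assms that H.src_cod2[of \<sigma>] by (simp add: fix_left_def)
  show "ot g (\<tau> \<star>\<^bsub>H\<^esub> \<sigma>) = ot g \<tau> \<star>\<^bsub>H\<^esub> ot g \<sigma>"
    if "\<tau> \<in> Ce H" "trg H (dom2 H \<sigma>) = src H (dom2 H \<tau>)"
    using map_cmp(3)[of \<sigma> \<tau>] assms that dom0_trg[of "dom2 H \<sigma>"] cod0_trg[of "dom2 H \<sigma>"]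
    by (simp add: fix_left_def)
qed

lemma whisker_invertible:
  assumes "f \<in> Ob H" "invertible_cell H \<sigma> \<alpha> \<beta>"
  shows "cod0 G f = dom0 G (src H \<alpha>) \<Longrightarrow> invertible_cell H (to \<sigma> f) (ao \<alpha> f) (ao \<beta> f)"
    and "cod0 G (src H \<alpha>) = dom0 G f \<Longrightarrow> invertible_cell H (ot f \<sigma>) (oa f \<alpha>) (oa f \<beta>)"
proof -
  note ab = H.invertible_cell_Ar[OF assms(2)]
  show "invertible_cell H (to \<sigma> f) (ao \<alpha> f) (ao \<beta> f)" if "cod0 G f = dom0 G (src H \<alpha>)"
    using two_functor.map_invertible_cell[OF right_whisker_two_functor[of f "cod0 G (src H \<alpha>)"], of \<sigma> \<alpha> \<beta>]
      assms that ab by (simp add: fix_right_def invertible_cell_hom)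
  show "invertible_cell H (ot f \<sigma>) (oa f \<alpha>) (oa f \<beta>)" if "cod0 G (src H \<alpha>) = dom0 G f"
    using two_functor.map_invertible_cell[OF left_whisker_two_functor[of f "dom0 G (src H \<alpha>)"], of \<sigma> \<alpha> \<beta>]
      assms that ab by (simp add: fix_left_def invertible_cell_hom)
qed

lemma whisker_equivalence:
  assumes "f \<in> Ob H" "equivalence H \<alpha> a b"
  shows "cod0 G f = dom0 G a \<Longrightarrow> equivalence H (ao \<alpha> f) (oo a f) (oo b f)"
    and "cod0 G a = dom0 G f \<Longrightarrow> equivalence H (oa f \<alpha>) (oo f a) (oo f b)"
proof -
  note ab = H.equivalence_Ob[OF assms(2)]
  show "equivalence H (ao \<alpha> f) (oo a f) (oo b f)" if "cod0 G f = dom0 G a"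
    using two_functor.map_equivalence[OF right_whisker_two_functor[of f "cod0 G a"], of \<alpha> a b]
      assms that ab by (simp add: fix_right_def equivalence_hom)
  show "equivalence H (oa f \<alpha>) (oo f a) (oo f b)" if "cod0 G a = dom0 G f"
    using two_functor.map_equivalence[OF left_whisker_two_functor[of f "dom0 G a"], of \<alpha> a b]
      assms that ab by (simp add: fix_left_def equivalence_hom)
qed

lemma whisker_assoc_o [simp]:
  assumes "f \<in> Ob H" "g \<in> Ob H" "cod0 G f = dom0 G g"
  shows "h \<in> Ob H \<Longrightarrow> cod0 G g = dom0 G h \<Longrightarrow> oo (oo h g) f = oo h (oo g f)"
    "\<gamma> \<in> Ar H \<Longrightarrow> cod0 G g = dom0 G (src H \<gamma>) \<Longrightarrow> ao (ao \<gamma> g) f = ao \<gamma> (oo g f)"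
    "\<Gamma> \<in> Ce H \<Longrightarrow> cod0 G g = dom0 G (src H (dom2 H \<Gamma>)) \<Longrightarrow> to (to \<Gamma> g) f = to \<Gamma> (oo g f)"
    "\<alpha> \<in> Ar H \<Longrightarrow> cod0 G (src H \<alpha>) = dom0 G f \<Longrightarrow> oa (oo g f) \<alpha> = oa g (oa f \<alpha>)"
    "\<Gamma> \<in> Ce H \<Longrightarrow> cod0 G (src H (dom2 H \<Gamma>)) = dom0 G f \<Longrightarrow> ot (oo g f) \<Gamma> = ot g (ot f \<Gamma>)"
  using assms
  by (auto intro!: assoc_ooo[OF iffD2[OF hom_simps(1)] iffD2[OF hom_simps(1)] iffD2[OF hom_simps(1)]]
    assoc_aoo[OF iffD2[OF hom_simps(1)] iffD2[OF hom_simps(1)] iffD2[OF hom_simps(2)]]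
    assoc_ooa[OF iffD2[OF hom_simps(2)] iffD2[OF hom_simps(1)] iffD2[OF hom_simps(1)]]
    assoc_too[OF iffD2[OF hom_simps(1)] iffD2[OF hom_simps(1)] iffD2[OF hom_simps(3)]]
    assoc_oot[OF iffD2[OF hom_simps(3)] iffD2[OF hom_simps(1)] iffD2[OF hom_simps(1)]])

lemma whisker_assoc_mixed [simp]:
  assumes "f \<in> Ob H" "h \<in> Ob H"
  shows "\<beta> \<in> Ar H \<Longrightarrow> cod0 G f = dom0 G (src H \<beta>) \<Longrightarrow> cod0 G (src H \<beta>) = dom0 G h \<Longrightarrow>
      ao (oa h \<beta>) f = oa h (ao \<beta> f)"
    "\<Gamma> \<in> Ce H \<Longrightarrow> cod0 G f = dom0 G (src H (dom2 H \<Gamma>)) \<Longrightarrow> cod0 G (src H (dom2 H \<Gamma>)) = dom0 G h \<Longrightarrow>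
      to (ot h \<Gamma>) f = ot h (to \<Gamma> f)"
  using assms
  by (auto intro!: assoc_oao[OF iffD2[OF hom_simps(1)] iffD2[OF hom_simps(2)] iffD2[OF hom_simps(1)]]
    assoc_oto[OF iffD2[OF hom_simps(1)] iffD2[OF hom_simps(3)] iffD2[OF hom_simps(1)]])

lemma aa_assoc:
  assumes "\<alpha> \<in> Ar H" "\<beta> \<in> Ar H"
  shows "f \<in> Ob H \<Longrightarrow> cod0 G f = dom0 G (src H \<alpha>) \<Longrightarrow> cod0 G (src H \<alpha>) = dom0 G (src H \<beta>) \<Longrightarrow>
      to (aa \<beta> \<alpha>) f = aa \<beta> (ao \<alpha> f)"
    "g \<in> Ob H \<Longrightarrow> cod0 G (src H \<alpha>) = dom0 G g \<Longrightarrow> cod0 G g = dom0 G (src H \<beta>) \<Longrightarrow>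
      aa (ao \<beta> g) \<alpha> = aa \<beta> (oa g \<alpha>)"
    "h \<in> Ob H \<Longrightarrow> cod0 G (src H \<alpha>) = dom0 G (src H \<beta>) \<Longrightarrow> cod0 G (src H \<beta>) = dom0 G h \<Longrightarrow>
      aa (oa h \<beta>) \<alpha> = ot h (aa \<beta> \<alpha>)"
  using assms
  by (auto intro!: assoc_aao[OF iffD2[OF hom_simps(1)] iffD2[OF hom_simps(2)] iffD2[OF hom_simps(2)]]
    assoc_aoa[OF iffD2[OF hom_simps(2)] iffD2[OF hom_simps(1)] iffD2[OF hom_simps(2)]]
    assoc_oaa[OF iffD2[OF hom_simps(2)] iffD2[OF hom_simps(2)] iffD2[OF hom_simps(1)]])

text \<open>The \<open>gray_map\<close> axioms restated over \<open>H\<close>, with all boundaries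
  computed from the cells, so that no hom has to be named when they are used.\<close>

lemma aa_simps:
  assumes "\<alpha> \<in> Ar H" "\<beta> \<in> Ar H" "cod0 G (src H \<alpha>) = dom0 G (src H \<beta>)"
  shows aa_invertible: "invertible_cell H (aa \<beta> \<alpha>) (ao \<beta> (trg H \<alpha>) \<cdot>\<^bsub>H\<^esub> oa (src H \<beta>) \<alpha>)
      (oa (trg H \<beta>) \<alpha> \<cdot>\<^bsub>H\<^esub> ao \<beta> (src H \<alpha>))"
    and aa_cmp_left: "\<gamma> \<in> Ar H \<Longrightarrow> trg H \<beta> = src H \<gamma> \<Longrightarrow> aa (\<gamma> \<cdot>\<^bsub>H\<^esub> \<beta>) \<alpha> =
      (aa \<gamma> \<alpha> \<star>\<^bsub>H\<^esub> id2 H (ao \<beta> (src H \<alpha>))) \<odot>\<^bsub>H\<^esub> (id2 H (ao \<gamma> (trg H \<alpha>)) \<star>\<^bsub>H\<^esub> aa \<beta> \<alpha>)"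
    and aa_cmp_right: "\<gamma> \<in> Ar H \<Longrightarrow> trg H \<alpha> = src H \<gamma> \<Longrightarrow> aa \<beta> (\<gamma> \<cdot>\<^bsub>H\<^esub> \<alpha>) =
      (id2 H (oa (trg H \<beta>) \<gamma>) \<star>\<^bsub>H\<^esub> aa \<beta> \<alpha>) \<odot>\<^bsub>H\<^esub> (aa \<beta> \<gamma> \<star>\<^bsub>H\<^esub> id2 H (oa (src H \<beta>) \<alpha>))"
    and aa_natural: "\<sigma> \<in> Ce H \<Longrightarrow> \<tau> \<in> Ce H \<Longrightarrow> dom2 H \<sigma> = \<beta> \<Longrightarrow> dom2 H \<tau> = \<alpha> \<Longrightarrow>
      aa (cod2 H \<sigma>) (cod2 H \<tau>) \<odot>\<^bsub>H\<^esub> (to \<sigma> (trg H \<alpha>) \<star>\<^bsub>H\<^esub> ot (src H \<beta>) \<tau>) =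
      (ot (trg H \<beta>) \<tau> \<star>\<^bsub>H\<^esub> to \<sigma> (src H \<alpha>)) \<odot>\<^bsub>H\<^esub> aa \<beta> \<alpha>"
proof -
  let ?X = "dom0 G (src H \<alpha>)" and ?Y = "cod0 G (src H \<alpha>)" and ?Z = "cod0 G (src H \<beta>)"
  interpret gray_map "hom G ?Y ?Z" "hom G ?X ?Y" "hom G ?X ?Z" "gcomp G"
    using assms by (intro comp_gray_map) auto
  have a: "arrow (hom G ?Y ?Z) \<beta> (src H \<beta>) (trg H \<beta>)" "arrow (hom G ?X ?Y) \<alpha> (src H \<alpha>) (trg H \<alpha>)"
    using assms by (auto simp: arrow_def)
  show "invertible_cell H (aa \<beta> \<alpha>) (ao \<beta> (trg H \<alpha>) \<cdot>\<^bsub>H\<^esub> oa (src H \<beta>) \<alpha>)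
      (oa (trg H \<beta>) \<alpha> \<cdot>\<^bsub>H\<^esub> ao \<beta> (src H \<alpha>))"
    using aa_invertible[OF a] by (simp add: invertible_cell_hom)
  show "aa (\<gamma> \<cdot>\<^bsub>H\<^esub> \<beta>) \<alpha> =
      (aa \<gamma> \<alpha> \<star>\<^bsub>H\<^esub> id2 H (ao \<beta> (src H \<alpha>))) \<odot>\<^bsub>H\<^esub> (id2 H (ao \<gamma> (trg H \<alpha>)) \<star>\<^bsub>H\<^esub> aa \<beta> \<alpha>)"
    if "\<gamma> \<in> Ar H" "trg H \<beta> = src H \<gamma>"
  proof -
    have "arrow (hom G ?Y ?Z) \<gamma> (trg H \<beta>) (trg H \<gamma>)"
      using that assms dom0_trg[of \<beta>] cod0_trg[of \<beta>] by (simp add: arrow_def)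
    from aa_cmp_left[OF a(1) this a(2)] show ?thesis by simp
  qed
  show "aa \<beta> (\<gamma> \<cdot>\<^bsub>H\<^esub> \<alpha>) =
      (id2 H (oa (trg H \<beta>) \<gamma>) \<star>\<^bsub>H\<^esub> aa \<beta> \<alpha>) \<odot>\<^bsub>H\<^esub> (aa \<beta> \<gamma> \<star>\<^bsub>H\<^esub> id2 H (oa (src H \<beta>) \<alpha>))"
    if "\<gamma> \<in> Ar H" "trg H \<alpha> = src H \<gamma>"
  proof -
    have "arrow (hom G ?X ?Y) \<gamma> (trg H \<alpha>) (trg H \<gamma>)"
      using that assms dom0_trg[of \<alpha>] cod0_trg[of \<alpha>] by (simp add: arrow_def)
    from aa_cmp_right[OF a(1,2) this] show ?thesis by simp
  qed
  show "aa (cod2 H \<sigma>) (cod2 H \<tau>) \<odot>\<^bsub>H\<^esub> (to \<sigma> (trg H \<alpha>) \<star>\<^bsub>H\<^esub> ot (src H \<beta>) \<tau>) =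
      (ot (trg H \<beta>) \<tau> \<star>\<^bsub>H\<^esub> to \<sigma> (src H \<alpha>)) \<odot>\<^bsub>H\<^esub> aa \<beta> \<alpha>"
    if "\<sigma> \<in> Ce H" "\<tau> \<in> Ce H" "dom2 H \<sigma> = \<beta>" "dom2 H \<tau> = \<alpha>"
    using aa_natural[OF a, of \<sigma> "cod2 H \<sigma>" \<tau> "cod2 H \<tau>"] that assms by (simp add: cell_def)
qed

lemma aa_typing [simp]:
  assumes "\<alpha> \<in> Ar H" "\<beta> \<in> Ar H" "cod0 G (src H \<alpha>) = dom0 G (src H \<beta>)"
  shows "aa \<beta> \<alpha> \<in> Ce H"
    "dom2 H (aa \<beta> \<alpha>) = ao \<beta> (trg H \<alpha>) \<cdot>\<^bsub>H\<^esub> oa (src H \<beta>) \<alpha>"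
    "cod2 H (aa \<beta> \<alpha>) = oa (trg H \<beta>) \<alpha> \<cdot>\<^bsub>H\<^esub> ao \<beta> (src H \<alpha>)"
  using H.invertible_cell_simps[OF aa_invertible[OF assms]] .

lemma aa_id1 [simp]:
  "g \<in> Ob H \<Longrightarrow> \<alpha> \<in> Ar H \<Longrightarrow> cod0 G (src H \<alpha>) = dom0 G g \<Longrightarrow> aa (id1 H g) \<alpha> = id2 H (oa g \<alpha>)"
  "f \<in> Ob H \<Longrightarrow> \<beta> \<in> Ar H \<Longrightarrow> cod0 G f = dom0 G (src H \<beta>) \<Longrightarrow> aa \<beta> (id1 H f) = id2 H (ao \<beta> f)"
  using gray_map.aa_id_left[OF comp_gray_map[of "dom0 G (src H \<alpha>)" "dom0 G g" "cod0 G g"], of g \<alpha>]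
    gray_map.aa_id_right[OF comp_gray_map[of "dom0 G f" "cod0 G f" "cod0 G (src H \<beta>)"], of \<beta> f]
  by auto

section \<open>Biequivalences\<close>

text \<open>Says that the classes of \<open>f\<close> and \<open>g\<close> are mutually inverse in
  \<open>\<pi>\<^sub>*G\<close>. The two equivalences are only asserted to exist, with no coherence
  between them, which makes the relation symmetric and invariant under equivalence.\<close>

definition weak_inverse :: "'a \<Rightarrow> 'a \<Rightarrow> bool" where
  "weak_inverse f g \<longleftrightarrow> f \<in> Ob H \<and> g \<in> Ob H \<and> dom0 G g = cod0 G f \<and> cod0 G g = dom0 G f \<and>
     (\<exists>e. equivalence H e (oo g f) (unit0 G (dom0 G f))) \<and>
     (\<exists>e. equivalence H e (oo f g) (unit0 G (cod0 G f)))"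

lemma weak_inverse_simps:
  assumes "weak_inverse f g"
  shows "f \<in> Ob H" "g \<in> Ob H" "dom0 G g = cod0 G f" "cod0 G g = dom0 G f"
  using assms by (auto simp: weak_inverse_def)

lemma weak_inverse_sym: "weak_inverse f g \<Longrightarrow> weak_inverse g f"
  by (auto simp: weak_inverse_def)

text \<open>Naturality of the interchange cells \<open>c\<^sub>e\<close> in the 1-cell
  \<open>c\<close> of a hom. Whiskering by the target of \<open>e\<close>, a unit, disappears, so
  the square relates \<sigma> itself to \<open>to \<sigma> p\<close>.\<close>

lemma counit_natural:
  assumes "equivalence H e p (unit0 G Y)" "Y \<in> Obj G" "\<sigma> \<in> Ce H" "dom0 G (src H (dom2 H \<sigma>)) = Y"
  shows "aa (cod2 H \<sigma>) e \<odot>\<^bsub>H\<^esub> (\<sigma> \<star>\<^bsub>H\<^esub> id2 H (oa (src H (dom2 H \<sigma>)) e)) =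
    (id2 H (oa (trg H (dom2 H \<sigma>)) e) \<star>\<^bsub>H\<^esub> to \<sigma> p) \<odot>\<^bsub>H\<^esub> aa (dom2 H \<sigma>) e"
proof -
  note e = H.equivalence_arrow[OF assms(1)] H.equivalence_Ob[OF assms(1)]
  have "dom0 G p = Y" "cod0 G p = Y"
    using dom0_trg[of e] cod0_trg[of e] e assms(2) by auto
  then show ?thesis
    using aa_natural[of e "dom2 H \<sigma>" \<sigma> "id2 H e"] assms e by simp
qed

lemma unit_equivalence_dom:
  assumes "equivalence H e p (unit0 G Y)" "Y \<in> Obj G"
  shows "p \<in> Ob H" "dom0 G p = Y" "cod0 G p = Y"
  using H.equivalence_arrow[OF assms(1)] dom0_trg[of e] cod0_trg[of e] assms(2) by auto

text \<open>
  An equivalence \<open>e : p \<rightarrow> 1\<close> makes whiskering by \<open>p\<close> pseudonaturally equivalent to the identity.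
\<close>

lemma whisker_unit_faithful:
  assumes e: "equivalence H e p (unit0 G Y)" "Y \<in> Obj G"
    and s: "\<sigma> \<in> Ce H" "\<sigma>' \<in> Ce H" "dom2 H \<sigma> = dom2 H \<sigma>'" "cod2 H \<sigma> = cod2 H \<sigma>'"
      "dom0 G (src H (dom2 H \<sigma>)) = Y" and eq: "to \<sigma> p = to \<sigma>' p"
  shows "\<sigma> = \<sigma>'"
proof -
  let ?h = "src H (dom2 H \<sigma>)"
  note et = H.equivalence_arrow[OF e(1)] unit_equivalence_dom[OF e]
  have "aa (cod2 H \<sigma>) e \<odot>\<^bsub>H\<^esub> (\<sigma> \<star>\<^bsub>H\<^esub> id2 H (oa ?h e)) =
    aa (cod2 H \<sigma>) e \<odot>\<^bsub>H\<^esub> (\<sigma>' \<star>\<^bsub>H\<^esub> id2 H (oa ?h e))"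
    using counit_natural[OF e, of \<sigma>] counit_natural[OF e, of \<sigma>'] s eq by simp
  then have "\<sigma> \<star>\<^bsub>H\<^esub> id2 H (oa ?h e) = \<sigma>' \<star>\<^bsub>H\<^esub> id2 H (oa ?h e)"
    by (rule H.vcmp_cancel_left[OF aa_invertible, rotated -1]) (use s e et in auto)
  then show ?thesis
    by (rule H.precomp_faithful[OF whisker_equivalence(2)[OF _ e(1)], rotated -1])
      (use s e et in auto)
qed

lemma whisker_unit_full:
  assumes e: "equivalence H e p (unit0 G Y)" "Y \<in> Obj G"
    and c: "c \<in> Ar H" "c' \<in> Ar H" "src H c = src H c'" "trg H c = trg H c'" "dom0 G (src H c) = Y"
    and d: "invertible_cell H \<delta> (ao c p) (ao c' p)"
  obtains \<sigma> where "invertible_cell H \<sigma> c c'" "to \<sigma> p = \<delta>"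
proof -
  let ?h = "src H c" and ?k = "trg H c"
  note et = H.equivalence_arrow[OF e(1)] unit_equivalence_dom[OF e]
  have dk: "dom0 G ?k = Y" "dom0 G (trg H c') = Y" "dom0 G (src H c') = Y"
    using dom0_trg[of c] dom0_trg[of c'] c by auto
  have he: "equivalence H (oa ?h e) (oo ?h p) ?h" "equivalence H (oa ?k e) (oo ?k p) ?k"
    using whisker_equivalence(2)[OF _ e(1), of ?h] whisker_equivalence(2)[OF _ e(1), of ?k] c dk e et
    by auto
  have i: "invertible_cell H (aa c e) (c \<cdot>\<^bsub>H\<^esub> oa ?h e) (oa ?k e \<cdot>\<^bsub>H\<^esub> ao c p)"
    "invertible_cell H (aa c' e) (c' \<cdot>\<^bsub>H\<^esub> oa ?h e) (oa ?k e \<cdot>\<^bsub>H\<^esub> ao c' p)"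
    using aa_invertible[of e c] aa_invertible[of e c'] c et e dk by auto
  obtain j where j: "invertible_cell H j (oa ?k e \<cdot>\<^bsub>H\<^esub> ao c' p) (c' \<cdot>\<^bsub>H\<^esub> oa ?h e)"
    "aa c' e \<odot>\<^bsub>H\<^esub> j = id2 H (oa ?k e \<cdot>\<^bsub>H\<^esub> ao c' p)"
    by (rule H.invertible_cell_inverse[OF i(2)])
  have kd: "invertible_cell H (id2 H (oa ?k e) \<star>\<^bsub>H\<^esub> \<delta>) (oa ?k e \<cdot>\<^bsub>H\<^esub> ao c p) (oa ?k e \<cdot>\<^bsub>H\<^esub> ao c' p)"
    using H.invertible_whisker(1)[OF d, of "oa ?k e"] c dk et e by simp
  \<comment> \<open>The right-hand side is the value that \<open>counit_natural\<close> forces on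
    the whiskered \<sigma> if \<open>to \<sigma> p\<close> is to be \<delta>; here \<open>j\<close>
    is the inverse of \<open>aa c' e\<close>.\<close>
  obtain \<sigma> where s: "invertible_cell H \<sigma> c c'"
    "\<sigma> \<star>\<^bsub>H\<^esub> id2 H (oa ?h e) = j \<odot>\<^bsub>H\<^esub> (id2 H (oa ?k e) \<star>\<^bsub>H\<^esub> \<delta>) \<odot>\<^bsub>H\<^esub> aa c e"
    by (rule H.precomp_full[OF he(1) c(1,2) refl c(3)[symmetric] c(4)
        H.invertible_vcmp[OF H.invertible_vcmp[OF i(1) kd] j(1)]])
  note cs = H.invertible_cell_simps[OF s(1)] H.invertible_cell_simps[OF j(1)]
    H.invertible_cell_simps[OF i(1)] H.invertible_cell_simps[OF i(2)] H.invertible_cell_simps[OF d]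
    H.invertible_cell_simps[OF kd]
  have "(id2 H (oa ?k e) \<star>\<^bsub>H\<^esub> to \<sigma> p) \<odot>\<^bsub>H\<^esub> aa c e = aa c' e \<odot>\<^bsub>H\<^esub> (\<sigma> \<star>\<^bsub>H\<^esub> id2 H (oa ?h e))"
    using counit_natural[OF e, of \<sigma>] cs c by simp
  also have "\<dots> = (aa c' e \<odot>\<^bsub>H\<^esub> j) \<odot>\<^bsub>H\<^esub> (id2 H (oa ?k e) \<star>\<^bsub>H\<^esub> \<delta>) \<odot>\<^bsub>H\<^esub> aa c e"
    unfolding s(2)
    by (rule H.vcmp_assoc'[symmetric]) (use cs in auto)
  also have "\<dots> = (id2 H (oa ?k e) \<star>\<^bsub>H\<^esub> \<delta>) \<odot>\<^bsub>H\<^esub> aa c e"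
    unfolding j(2) by (rule H.vcmp_id) (use cs in auto)
  finally have "id2 H (oa ?k e) \<star>\<^bsub>H\<^esub> to \<sigma> p = id2 H (oa ?k e) \<star>\<^bsub>H\<^esub> \<delta>"
    by (rule H.vcmp_cancel_right[OF i(1), rotated -1]) (use cs c dk et e in auto)
  then have "to \<sigma> p = \<delta>"
    by (rule H.postcomp_faithful[OF he(2), rotated -1]) (use cs c dk et e in auto)
  with s(1) show ?thesis by (rule that)
qed

lemma whisker_unit_essentially_surjective:
  assumes e: "equivalence H e p (unit0 G Y)" "Y \<in> Obj G"
    and h: "h \<in> Ob H" "k \<in> Ob H" "dom0 G h = Y" "dom0 G k = Y" "cod0 G h = cod0 G k"
    and d: "d \<in> Ar H" "src H d = oo h p" "trg H d = oo k p"
  obtains c \<sigma> where "c \<in> Ar H" "src H c = h" "trg H c = k" "invertible_cell H \<sigma> (ao c p) d"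
proof -
  note et = H.equivalence_arrow[OF e(1)] unit_equivalence_dom[OF e]
  have he: "equivalence H (oa h e) (oo h p) h" "equivalence H (oa k e) (oo k p) k"
    using whisker_equivalence(2)[OF _ e(1), of h] whisker_equivalence(2)[OF _ e(1), of k] h e et
    by auto
  \<comment> \<open>\<open>c\<close> is \<open>d\<close> conjugated by the equivalences
    \<open>he : hp \<rightarrow> h\<close> and \<open>ke : kp \<rightarrow> k\<close>. Combining
    \<rho> with the interchange cell \<open>c\<^sub>e\<close> gives
    \<open>ke.cp \<cong> ke.d\<close>, from which the equivalence \<open>ke\<close> is
    cancelled.\<close>
  obtain c \<rho> where c: "c \<in> Ar H" "src H c = h" "trg H c = k"
    and r: "invertible_cell H \<rho> (c \<cdot>\<^bsub>H\<^esub> oa h e) (oa k e \<cdot>\<^bsub>H\<^esub> d)"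
    using H.precomp_essentially_surjective[OF he(1), of "oa k e \<cdot>\<^bsub>H\<^esub> d"] d h et e by auto
  have i: "invertible_cell H (aa c e) (c \<cdot>\<^bsub>H\<^esub> oa h e) (oa k e \<cdot>\<^bsub>H\<^esub> ao c p)"
    using aa_invertible[of e c] c et e h by auto
  obtain j where j: "invertible_cell H j (oa k e \<cdot>\<^bsub>H\<^esub> ao c p) (c \<cdot>\<^bsub>H\<^esub> oa h e)"
    using H.invertible_cell_inverse[OF i] .
  obtain \<sigma> where "invertible_cell H \<sigma> (ao c p) d"
    using H.postcomp_full[OF he(2) _ _ _ _ _ H.invertible_vcmp[OF j r]] c d h et by auto
  with c show ?thesis by (rule that)
qed

text \<open>
  Whiskering by \<open>fg\<close> and by \<open>gf\<close> are local equivalences, hence so is whiskering by \<open>f\<close>.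
\<close>

lemma whisker_faithful:
  assumes fg: "weak_inverse f g"
    and s: "\<sigma> \<in> Ce H" "\<sigma>' \<in> Ce H" "dom2 H \<sigma> = dom2 H \<sigma>'" "cod2 H \<sigma> = cod2 H \<sigma>'"
      "dom0 G (src H (dom2 H \<sigma>)) = cod0 G f" and eq: "to \<sigma> f = to \<sigma>' f"
  shows "\<sigma> = \<sigma>'"
proof -
  obtain e where e: "equivalence H e (oo f g) (unit0 G (cod0 G f))"
    using fg by (auto simp: weak_inverse_def)
  note t = weak_inverse_simps[OF fg]
  have "to \<sigma> (oo f g) = to \<sigma>' (oo f g)"
    using arg_cong[OF eq, of "\<lambda>x. to x g"] s t by simp
  with whisker_unit_faithful[OF e _ s] t show ?thesis by simp
qed

text \<open>A preimage of \<open>\<delta>g\<close> under whiskering by \<open>fg\<close> is already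
  a preimage of \<delta> under whiskering by \<open>f\<close>, because whiskering by the
  biequivalence \<open>g\<close> is faithful.\<close>

lemma whisker_full:
  assumes fg: "weak_inverse f g"
    and c: "c \<in> Ar H" "c' \<in> Ar H" "src H c = src H c'" "trg H c = trg H c'" "dom0 G (src H c) = cod0 G f"
    and d: "invertible_cell H \<delta> (ao c f) (ao c' f)"
  obtains \<sigma> where "invertible_cell H \<sigma> c c'" "to \<sigma> f = \<delta>"
proof -
  obtain e where e: "equivalence H e (oo f g) (unit0 G (cod0 G f))"
    using fg by (auto simp: weak_inverse_def)
  note t = weak_inverse_simps[OF fg]
  have "invertible_cell H (to \<delta> g) (ao c (oo f g)) (ao c' (oo f g))"
    using whisker_invertible(1)[OF _ d, of g] t c by simp
  then obtain \<sigma> where s: "invertible_cell H \<sigma> c c'" "to \<sigma> (oo f g) = to \<delta> g"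
    using whisker_unit_full[OF e _ c] t by auto
  note cs = H.invertible_cell_simps[OF s(1)] H.invertible_cell_simps[OF d]
  have "to (to \<sigma> f) g = to \<delta> g"
    using s(2) t c cs by simp
  then have "to \<sigma> f = \<delta>"
    by (rule whisker_faithful[OF weak_inverse_sym[OF fg], rotated -1]) (use t c cs in auto)
  with s(1) show ?thesis by (rule that)
qed

text \<open>Essential surjectivity for \<open>fg\<close> gives \<open>c\<close> with
  \<open>cfg \<cong> dg\<close>, and fullness of whiskering by \<open>g\<close> removes
  \<open>g\<close>.\<close>

lemma whisker_essentially_surjective:
  assumes fg: "weak_inverse f g"
    and h: "h \<in> Ob H" "k \<in> Ob H" "dom0 G h = cod0 G f" "dom0 G k = cod0 G f" "cod0 G h = cod0 G k"
    and d: "d \<in> Ar H" "src H d = oo h f" "trg H d = oo k f"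
  obtains c \<sigma> where "c \<in> Ar H" "src H c = h" "trg H c = k" "invertible_cell H \<sigma> (ao c f) d"
proof -
  obtain e where e: "equivalence H e (oo f g) (unit0 G (cod0 G f))"
    using fg by (auto simp: weak_inverse_def)
  note t = weak_inverse_simps[OF fg]
  obtain c \<rho> where c: "c \<in> Ar H" "src H c = h" "trg H c = k"
    and r: "invertible_cell H \<rho> (ao c (oo f g)) (ao d g)"
    using whisker_unit_essentially_surjective[OF e _ h, of "ao d g"] d t h by auto
  have "invertible_cell H \<rho> (ao (ao c f) g) (ao d g)" using r c t h by simp
  then obtain \<sigma> where "invertible_cell H \<sigma> (ao c f) d"
    using whisker_full[OF weak_inverse_sym[OF fg], of "ao c f" d \<rho>] t c d h by auto
  with c show ?thesis by (rule that)
qed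

text \<open>A pseudo-inverse of \<open>cf\<close> is isomorphic to some \<open>c'f\<close> by
  essential surjectivity, and the two isomorphisms exhibiting it as pseudo-inverse come from
  \<open>c'\<close> and \<open>c\<close> by fullness.\<close>

lemma whisker_reflects_equivalence:
  assumes fg: "weak_inverse f g"
    and c: "c \<in> Ar H" "src H c = h" "trg H c = k" "dom0 G h = cod0 G f"
    and eq: "equivalence H (ao c f) (oo h f) (oo k f)"
  shows "equivalence H c h k"
proof -
  note t = weak_inverse_simps[OF fg]
  have k: "dom0 G k = cod0 G f" "cod0 G h = cod0 G k" "h \<in> Ob H" "k \<in> Ob H"
    using dom0_trg[of c] cod0_trg[of c] c by auto
  obtain d \<sigma> \<tau> where d: "equivalence H d (oo k f) (oo h f)"
    and s: "invertible_cell H \<sigma> (d \<cdot>\<^bsub>H\<^esub> ao c f) (id1 H (oo h f))"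
    and u: "invertible_cell H \<tau> (ao c f \<cdot>\<^bsub>H\<^esub> d) (id1 H (oo k f))"
    by (rule H.equivalence_inverse[OF eq])
  note dt = H.equivalence_arrow[OF d]
  obtain c' \<rho> where c': "c' \<in> Ar H" "src H c' = k" "trg H c' = h"
    and r: "invertible_cell H \<rho> (ao c' f) d"
    using whisker_essentially_surjective[OF fg k(4) k(3) k(1) c(4) k(2)[symmetric] dt] by auto
  have "invertible_cell H (\<rho> \<star>\<^bsub>H\<^esub> id2 H (ao c f)) (ao c' f \<cdot>\<^bsub>H\<^esub> ao c f) (d \<cdot>\<^bsub>H\<^esub> ao c f)"
    "invertible_cell H (id2 H (ao c f) \<star>\<^bsub>H\<^esub> \<rho>) (ao c f \<cdot>\<^bsub>H\<^esub> ao c' f) (ao c f \<cdot>\<^bsub>H\<^esub> d)"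
    using H.invertible_whisker[OF r, of "ao c f"] t c c' k by auto
  from H.invertible_vcmp[OF this(1) s] H.invertible_vcmp[OF this(2) u]
  have i: "invertible_cell H (\<sigma> \<odot>\<^bsub>H\<^esub> (\<rho> \<star>\<^bsub>H\<^esub> id2 H (ao c f))) (ao (c' \<cdot>\<^bsub>H\<^esub> c) f) (ao (id1 H h) f)"
    "invertible_cell H (\<tau> \<odot>\<^bsub>H\<^esub> (id2 H (ao c f) \<star>\<^bsub>H\<^esub> \<rho>)) (ao (c \<cdot>\<^bsub>H\<^esub> c') f) (ao (id1 H k) f)"
    using t c c' k by auto
  obtain \<sigma>' where "invertible_cell H \<sigma>' (c' \<cdot>\<^bsub>H\<^esub> c) (id1 H h)"
    by (rule whisker_full[OF fg _ _ _ _ _ i(1)]) (use c c' k in auto)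
  moreover obtain \<tau>' where "invertible_cell H \<tau>' (c \<cdot>\<^bsub>H\<^esub> c') (id1 H k)"
    by (rule whisker_full[OF fg _ _ _ _ _ i(2)]) (use c c' k in auto)
  ultimately show ?thesis using c c' by (intro H.equivalenceI[of c h k c'])
qed

text \<open>For fixed \<open>f\<close>, the pair of a pseudo-inverse and its unit is unique up to
  equivalence. \<theta> is found by solving \<open>x.\<eta> \<cong> d\<close> and then
  \<open>\<theta>f \<cong> x\<close>; \<open>\<theta>f\<close> is an equivalence by cancellation,
  and whiskering by \<open>f\<close> reflects this.\<close>

lemma unit_transport:
  assumes fg: "weak_inverse f g" and X: "dom0 G f = X"
    and \<eta>: "equivalence H \<eta> (unit0 G X) (oo g f)"
    and k: "k \<in> Ob H" "dom0 G k = cod0 G f" "cod0 G k = cod0 G g"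
    and d: "equivalence H d (unit0 G X) (oo k f)"
  obtains \<theta> \<sigma> where "equivalence H \<theta> g k" "invertible_cell H \<sigma> (ao \<theta> f \<cdot>\<^bsub>H\<^esub> \<eta>) d"
proof -
  note t = weak_inverse_simps[OF fg]
  note et = H.equivalence_arrow[OF \<eta>] and dt = H.equivalence_arrow[OF d]
  obtain c \<sigma> where c: "c \<in> Ar H" "src H c = oo g f" "trg H c = oo k f"
    and s: "invertible_cell H \<sigma> (c \<cdot>\<^bsub>H\<^esub> \<eta>) d"
    using H.precomp_essentially_surjective[OF \<eta>, of d] dt by auto
  obtain \<theta> \<rho> where th: "\<theta> \<in> Ar H" "src H \<theta> = g" "trg H \<theta> = k" and r: "invertible_cell H \<rho> (ao \<theta> f) c"
    using whisker_essentially_surjective[OF fg, of g k c] t c k by auto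
  have "invertible_cell H (\<rho> \<star>\<^bsub>H\<^esub> id2 H \<eta>) (ao \<theta> f \<cdot>\<^bsub>H\<^esub> \<eta>) (c \<cdot>\<^bsub>H\<^esub> \<eta>)"
    using H.invertible_whisker(2)[OF r, of \<eta>] et t th c by simp
  then have i: "invertible_cell H (\<sigma> \<odot>\<^bsub>H\<^esub> (\<rho> \<star>\<^bsub>H\<^esub> id2 H \<eta>)) (ao \<theta> f \<cdot>\<^bsub>H\<^esub> \<eta>) d"
    using H.invertible_vcmp s by blast
  have "equivalence H (ao \<theta> f) (oo g f) (oo k f)"
    using H.equivalence_cancel_right[OF \<eta> d i] t th by simp
  then have "equivalence H \<theta> g k"
    using whisker_reflects_equivalence[OF fg th] t by simp
  with i show ?thesis by (rule that[rotated])
qed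

text \<open>That the solution \<epsilon> of \<open>xf.f\<eta> \<cong> 1\<close> is an equivalence
  needs an argument: \<open>\<epsilon>f\<close> is one by cancelling the equivalence
  \<open>f\<eta>\<close>, and whiskering by \<open>f\<close> reflects equivalences.\<close>

lemma counit_exists:
  assumes fg: "weak_inverse f g" and X: "dom0 G f = X"
    and \<eta>: "equivalence H \<eta> (unit0 G X) (oo g f)"
  obtains \<epsilon> S where "equivalence H \<epsilon> (oo f g) (unit0 G (cod0 G f))"
    "invertible_cell H S (ao \<epsilon> f \<cdot>\<^bsub>H\<^esub> oa f \<eta>) (id1 H f)"
proof -
  note t = weak_inverse_simps[OF fg]
  have XO: "X \<in> Obj G" using t X by auto
  have f\<eta>: "equivalence H (oa f \<eta>) f (oo f (oo g f))"
    using whisker_equivalence(2)[OF t(1) \<eta>] t X XO by simp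
  obtain c \<sigma> where c: "c \<in> Ar H" "src H c = oo f (oo g f)" "trg H c = f"
    and s: "invertible_cell H \<sigma> (c \<cdot>\<^bsub>H\<^esub> oa f \<eta>) (id1 H f)"
    using H.precomp_essentially_surjective[OF f\<eta>, of "id1 H f"] t by auto
  obtain \<epsilon> \<rho> where ep: "\<epsilon> \<in> Ar H" "src H \<epsilon> = oo f g" "trg H \<epsilon> = unit0 G (cod0 G f)"
    and r: "invertible_cell H \<rho> (ao \<epsilon> f) c"
    using whisker_essentially_surjective[OF fg, of "oo f g" "unit0 G (cod0 G f)" c] t c by auto
  have "invertible_cell H (\<rho> \<star>\<^bsub>H\<^esub> id2 H (oa f \<eta>)) (ao \<epsilon> f \<cdot>\<^bsub>H\<^esub> oa f \<eta>) (c \<cdot>\<^bsub>H\<^esub> oa f \<eta>)"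
    using H.invertible_whisker(2)[OF r, of "oa f \<eta>"] H.equivalence_arrow[OF f\<eta>] t ep by simp
  then have i: "invertible_cell H (\<sigma> \<odot>\<^bsub>H\<^esub> (\<rho> \<star>\<^bsub>H\<^esub> id2 H (oa f \<eta>))) (ao \<epsilon> f \<cdot>\<^bsub>H\<^esub> oa f \<eta>) (id1 H f)"
    using H.invertible_vcmp s by blast
  have "equivalence H (ao \<epsilon> f) (oo f (oo g f)) f"
    using H.equivalence_cancel_right[OF f\<eta> H.equivalence_id1[OF t(1)] i] t ep by simp
  then have "equivalence H \<epsilon> (oo f g) (unit0 G (cod0 G f))"
    using whisker_reflects_equivalence[OF fg ep] t by simp
  with i show ?thesis by (rule that[rotated])
qed

lemma adjoint_biequivalence_T_exists:
  assumes fg: "weak_inverse f g" "dom0 G f = X" "cod0 G f = Y"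
    and e: "adjoint_equivalence H e (unit0 G X) (oo g f)"
    and d: "adjoint_equivalence H d (oo f g) (unit0 G Y)"
    and S: "invertible_cell H S (ao (ladj d) f \<cdot>\<^bsub>H\<^esub> oa f (ladj e)) (id1 H f)"
  obtains T where "adjoint_biequivalence G \<lparr>fwd = f, bwd = g, eta = e, eps = d, S3 = S, T3 = T\<rparr> X Y"
proof -
  note t = weak_inverse_simps[OF fg(1)] fg(2,3)
  have O: "X \<in> Obj G" "Y \<in> Obj G" using t by auto
  define \<eta> \<epsilon> where "\<eta> = ladj e" and "\<epsilon> = ladj d"
  have \<eta>: "equivalence H \<eta> (unit0 G X) (oo g f)" and \<epsilon>: "equivalence H \<epsilon> (oo f g) (unit0 G Y)"
    using H.adjoint_equivalence_equivalence e d by (auto simp: \<eta>_def \<epsilon>_def)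
  note \<eta>t = H.equivalence_arrow[OF \<eta>] and \<epsilon>t = H.equivalence_arrow[OF \<epsilon>]
  note S' = S[folded \<eta>_def \<epsilon>_def]
  note T = t O \<eta>t \<epsilon>t H.invertible_cell_simps[OF S']
  \<comment> \<open>\<open>w\<close> is \<open>(g\<epsilon>.\<eta>g)f\<close>, the codomain required
    of \<open>Tf\<close>, and \<open>R\<close> consists of the two factors of the first axiom that
    do not involve \<open>T\<close>. The axiom thus asks that \<open>(Tf).\<eta>\<close> be the
    inverse \<open>R'\<close>.\<close>
  define w where "w = oa g (ao \<epsilon> f) \<cdot>\<^bsub>H\<^esub> ao \<eta> (oo g f)"
  define R where "R = (ot g S \<star>\<^bsub>H\<^esub> id2 H \<eta>) \<odot>\<^bsub>H\<^esub> (id2 H (oa g (ao \<epsilon> f)) \<star>\<^bsub>H\<^esub> aa \<eta> \<eta>)"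
  have R1: "invertible_cell H (id2 H (oa g (ao \<epsilon> f)) \<star>\<^bsub>H\<^esub> aa \<eta> \<eta>) (w \<cdot>\<^bsub>H\<^esub> \<eta>)
      (oa g (ao \<epsilon> f) \<cdot>\<^bsub>H\<^esub> oa g (oa f \<eta>) \<cdot>\<^bsub>H\<^esub> \<eta>)"
    using H.invertible_whisker(1)[OF aa_invertible[of \<eta> \<eta>], of "oa g (ao \<epsilon> f)"] T by (simp add: w_def)
  have R2: "invertible_cell H (ot g S \<star>\<^bsub>H\<^esub> id2 H \<eta>) (oa g (ao \<epsilon> f) \<cdot>\<^bsub>H\<^esub> oa g (oa f \<eta>) \<cdot>\<^bsub>H\<^esub> \<eta>) \<eta>"
    using H.invertible_whisker(2)[OF whisker_invertible(2)[OF _ S', of g], of \<eta>] T by simp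
  have R: "invertible_cell H R (w \<cdot>\<^bsub>H\<^esub> \<eta>) \<eta>"
    unfolding R_def by (rule H.invertible_vcmp[OF R1 R2])
  obtain R' where R': "invertible_cell H R' \<eta> (w \<cdot>\<^bsub>H\<^esub> \<eta>)" "R \<odot>\<^bsub>H\<^esub> R' = id2 H \<eta>"
    by (rule H.invertible_cell_inverse[OF R])
  \<comment> \<open>First \<eta> is stripped off by fullness of precomposition, then
    \<open>f\<close> by fullness of whiskering.\<close>
  obtain T0 where T0: "invertible_cell H T0 (id1 H (oo g f)) w" "T0 \<star>\<^bsub>H\<^esub> id2 H \<eta> = R'"
    using H.precomp_full[OF \<eta>, of "id1 H (oo g f)" w R'] R' T by (auto simp: w_def)
  obtain T' where T': "invertible_cell H T' (id1 H g) (oa g \<epsilon> \<cdot>\<^bsub>H\<^esub> ao \<eta> g)" "to T' f = T0"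
    using whisker_full[OF fg(1), of "id1 H g" "oa g \<epsilon> \<cdot>\<^bsub>H\<^esub> ao \<eta> g" T0] T0 T by (auto simp: w_def)
  note T = T H.invertible_cell_simps[OF T'(1)]
  have ax1: "(ot g S \<star>\<^bsub>H\<^esub> id2 H \<eta>) \<odot>\<^bsub>H\<^esub> (id2 H (oa g (ao \<epsilon> f)) \<star>\<^bsub>H\<^esub> aa \<eta> \<eta>) \<odot>\<^bsub>H\<^esub> (to T' f \<star>\<^bsub>H\<^esub> id2 H \<eta>)
    = id2 H \<eta>"
    using R'(2) T unfolding T0(2)[symmetric] T'(2)[symmetric] R_def by simp
  \<comment> \<open>The left side of the second axiom. To show that it is an identity, it is
    whiskered by \<open>f\<close> and precomposed with \<open>f\<eta>\<close>; both operations are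
    faithful.\<close>
  define Q where "Q = (id2 H \<epsilon> \<star>\<^bsub>H\<^esub> to S g) \<odot>\<^bsub>H\<^esub> (aa \<epsilon> \<epsilon> \<star>\<^bsub>H\<^esub> id2 H (oa f (ao \<eta> g)))
          \<odot>\<^bsub>H\<^esub> (id2 H \<epsilon> \<star>\<^bsub>H\<^esub> ot f T')"
  have Q: "Q \<in> Ce H" "dom2 H Q = \<epsilon>" "cod2 H Q = \<epsilon>" unfolding Q_def using T by auto
  have H1: "(ot f (ot g S) \<star>\<^bsub>H\<^esub> id2 H (oa f \<eta>)) \<odot>\<^bsub>H\<^esub> (id2 H (oa f (oa g (ao \<epsilon> f))) \<star>\<^bsub>H\<^esub> ot f (aa \<eta> \<eta>))
      \<odot>\<^bsub>H\<^esub> (ot f (to T' f) \<star>\<^bsub>H\<^esub> id2 H (oa f \<eta>)) = id2 H (oa f \<eta>)"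
    using arg_cong[OF ax1, of "ot f"] T by simp
  \<comment> \<open>Naturality in the second variable of the interchange cells of \<epsilon>, at
    \<open>S\<close>. The interchange cell at the codomain of \<open>S\<close>, an identity, is
    trivial; the one at its domain splits into two.\<close>
  have H2: "id2 H (ao \<epsilon> f) \<star>\<^bsub>H\<^esub> ot f (ot g S) = (S \<star>\<^bsub>H\<^esub> id2 H (ao \<epsilon> f))
      \<odot>\<^bsub>H\<^esub> (id2 H (ao \<epsilon> f) \<star>\<^bsub>H\<^esub> aa \<epsilon> (oa f \<eta>)) \<odot>\<^bsub>H\<^esub> (aa \<epsilon> (ao \<epsilon> f) \<star>\<^bsub>H\<^esub> id2 H (oa f (oa g (oa f \<eta>))))"
    using aa_natural[of "ao \<epsilon> f \<cdot>\<^bsub>H\<^esub> oa f \<eta>" \<epsilon> "id2 H \<epsilon>" S] aa_cmp_right[of "oa f \<eta>" \<epsilon> "ao \<epsilon> f"] T by simp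
  \<comment> \<open>The corresponding naturality in the first variable, at \<open>S\<close> and with
    \<eta> fixed.\<close>
  have H3: "to S (oo g f) \<star>\<^bsub>H\<^esub> id2 H (oa f \<eta>) = (id2 H (oa f \<eta>) \<star>\<^bsub>H\<^esub> S)
      \<odot>\<^bsub>H\<^esub> (aa \<epsilon> (oa f \<eta>) \<star>\<^bsub>H\<^esub> id2 H (oa f \<eta>)) \<odot>\<^bsub>H\<^esub> (id2 H (ao \<epsilon> (oo f (oo g f))) \<star>\<^bsub>H\<^esub> ot f (aa \<eta> \<eta>))"
    using aa_natural[of \<eta> "ao \<epsilon> f \<cdot>\<^bsub>H\<^esub> oa f \<eta>" S "id2 H \<eta>"] aa_cmp_left[of \<eta> "oa f \<eta>" "ao \<epsilon> f"]
      aa_assoc(2)[of \<eta> \<epsilon> f] aa_assoc(3)[of \<eta> \<eta> f] T by simp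
  have "to Q f \<star>\<^bsub>H\<^esub> id2 H (oa f \<eta>) = (id2 H (ao \<epsilon> f) \<star>\<^bsub>H\<^esub> to S (oo g f) \<star>\<^bsub>H\<^esub> id2 H (oa f \<eta>))
     \<odot>\<^bsub>H\<^esub> (aa \<epsilon> (ao \<epsilon> f) \<star>\<^bsub>H\<^esub> id2 H (oa f (ao \<eta> (oo g f)) \<cdot>\<^bsub>H\<^esub> oa f \<eta>))
     \<odot>\<^bsub>H\<^esub> (id2 H (ao \<epsilon> f) \<star>\<^bsub>H\<^esub> ot f (to T' f) \<star>\<^bsub>H\<^esub> id2 H (oa f \<eta>))"
    unfolding Q_def using T aa_assoc(1)[of \<epsilon> \<epsilon> f] by simp
  also have "\<dots> = id2 H (ao \<epsilon> f \<cdot>\<^bsub>H\<^esub> oa f \<eta>)"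
    by (rule H.swallowtail_swap[OF _ _ _ _ _ _ _ _ _ S' _ _ _ _ _ _ H1 H2 H3,
        of "oo f (oo g f)" "oo f (oo g (oo f (oo g f)))"])
      (use T in \<open>simp_all add: arrow_def cell_def\<close>)
  finally have "to Q f \<star>\<^bsub>H\<^esub> id2 H (oa f \<eta>) = id2 H (ao \<epsilon> f) \<star>\<^bsub>H\<^esub> id2 H (oa f \<eta>)"
    using T by simp
  then have "to Q f = id2 H (ao \<epsilon> f)"
    by (rule H.precomp_faithful[OF whisker_equivalence(2)[OF _ \<eta>], rotated -1]) (use T Q in auto)
  then have "to Q f = to (id2 H \<epsilon>) f" using T by simp
  then have "Q = id2 H \<epsilon>"
    by (rule whisker_faithful[OF fg(1), rotated -1]) (use T Q in auto)
  then show ?thesis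
    using ax1 T T' e d S' that[of T']
    unfolding adjoint_biequivalence_def adjoint_equivalence_hom invertible_cell_hom Q_def
    by (simp add: Let_def flip: \<eta>_def \<epsilon>_def)
qed

lemma adjoint_biequivalenceD:
  assumes "adjoint_biequivalence G x X Y"
  shows "weak_inverse (fwd x) (bwd x)" "dom0 G (fwd x) = X" "cod0 G (fwd x) = Y"
    "adjoint_equivalence H (eta x) (unit0 G X) (oo (bwd x) (fwd x))"
    "adjoint_equivalence H (eps x) (oo (fwd x) (bwd x)) (unit0 G Y)"
    "invertible_cell H (S3 x) (ao (ladj (eps x)) (fwd x) \<cdot>\<^bsub>H\<^esub> oa (fwd x) (ladj (eta x))) (id1 H (fwd x))"
    "invertible_cell H (T3 x) (id1 H (bwd x)) (oa (bwd x) (ladj (eps x)) \<cdot>\<^bsub>H\<^esub> ao (ladj (eta x)) (bwd x))"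
    "(ot (bwd x) (S3 x) \<star>\<^bsub>H\<^esub> id2 H (ladj (eta x)))
      \<odot>\<^bsub>H\<^esub> (id2 H (oa (bwd x) (ao (ladj (eps x)) (fwd x))) \<star>\<^bsub>H\<^esub> aa (ladj (eta x)) (ladj (eta x)))
      \<odot>\<^bsub>H\<^esub> (to (T3 x) (fwd x) \<star>\<^bsub>H\<^esub> id2 H (ladj (eta x))) = id2 H (ladj (eta x))"
proof -
  show *: "dom0 G (fwd x) = X" "cod0 G (fwd x) = Y"
    "adjoint_equivalence H (eta x) (unit0 G X) (oo (bwd x) (fwd x))"
    "adjoint_equivalence H (eps x) (oo (fwd x) (bwd x)) (unit0 G Y)"
    "invertible_cell H (S3 x) (ao (ladj (eps x)) (fwd x) \<cdot>\<^bsub>H\<^esub> oa (fwd x) (ladj (eta x))) (id1 H (fwd x))"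
    "invertible_cell H (T3 x) (id1 H (bwd x)) (oa (bwd x) (ladj (eps x)) \<cdot>\<^bsub>H\<^esub> ao (ladj (eta x)) (bwd x))"
    "(ot (bwd x) (S3 x) \<star>\<^bsub>H\<^esub> id2 H (ladj (eta x)))
      \<odot>\<^bsub>H\<^esub> (id2 H (oa (bwd x) (ao (ladj (eps x)) (fwd x))) \<star>\<^bsub>H\<^esub> aa (ladj (eta x)) (ladj (eta x)))
      \<odot>\<^bsub>H\<^esub> (to (T3 x) (fwd x) \<star>\<^bsub>H\<^esub> id2 H (ladj (eta x))) = id2 H (ladj (eta x))"
    using assms
    unfolding adjoint_biequivalence_def adjoint_equivalence_hom invertible_cell_hom Let_def by auto
  obtain g where "equivalence H g (oo (bwd x) (fwd x)) (unit0 G X)"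
    using H.equivalence_inverse[OF H.adjoint_equivalence_equivalence[OF *(3)]] .
  moreover have "equivalence H (ladj (eps x)) (oo (fwd x) (bwd x)) (unit0 G Y)"
    using H.adjoint_equivalence_equivalence[OF *(4)] .
  ultimately show "weak_inverse (fwd x) (bwd x)"
    using assms * unfolding adjoint_biequivalence_def weak_inverse_def Let_def by auto
qed

text \<open>In the first axiom the factors other than \<open>(Tf).\<eta>\<close> are invertible, so
  they determine it; precomposition with \<eta> and whiskering by \<open>f\<close> are faithful.
  Hence the image of any \<open>T\<close> chosen upstairs is the prescribed one as soon as all other
  data agree.\<close>

lemma adjoint_biequivalence_T_unique:
  assumes "adjoint_biequivalence G x X Y" "adjoint_biequivalence G x' X Y" "fwd x = fwd x'"
    "bwd x = bwd x'" "eta x = eta x'" "eps x = eps x'" "S3 x = S3 x'"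
  shows "x = x'"
proof -
  define f g \<eta> \<epsilon> S where "f = fwd x" "g = bwd x" "\<eta> = ladj (eta x)" "\<epsilon> = ladj (eps x)" "S = S3 x"
  note defs = this
  note x = adjoint_biequivalenceD[OF assms(1), folded defs]
    and x' = adjoint_biequivalenceD[OF assms(2), folded assms(3-7), folded defs]
  note t = weak_inverse_simps[OF x(1)] x(2,3)
  have \<eta>: "equivalence H \<eta> (unit0 G X) (oo g f)" and \<epsilon>: "equivalence H \<epsilon> (oo f g) (unit0 G Y)"
    using H.adjoint_equivalence_equivalence x(4,5) by (auto simp: defs)
  note T = t H.equivalence_arrow[OF \<eta>] H.equivalence_arrow[OF \<epsilon>] H.invertible_cell_simps[OF x(6)]
    H.invertible_cell_simps[OF x(7)] H.invertible_cell_simps[OF x'(7)]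
  have O: "X \<in> Obj G" "Y \<in> Obj G" using t by auto
  have R1: "invertible_cell H (id2 H (oa g (ao \<epsilon> f)) \<star>\<^bsub>H\<^esub> aa \<eta> \<eta>)
      (oa g (ao \<epsilon> f) \<cdot>\<^bsub>H\<^esub> ao \<eta> (oo g f) \<cdot>\<^bsub>H\<^esub> \<eta>) (oa g (ao \<epsilon> f) \<cdot>\<^bsub>H\<^esub> oa g (oa f \<eta>) \<cdot>\<^bsub>H\<^esub> \<eta>)"
    using H.invertible_whisker(1)[OF aa_invertible[of \<eta> \<eta>], of "oa g (ao \<epsilon> f)"] T O by simp
  have R2: "invertible_cell H (ot g S \<star>\<^bsub>H\<^esub> id2 H \<eta>) (oa g (ao \<epsilon> f) \<cdot>\<^bsub>H\<^esub> oa g (oa f \<eta>) \<cdot>\<^bsub>H\<^esub> \<eta>) \<eta>"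
    using H.invertible_whisker(2)[OF whisker_invertible(2)[OF _ x(6), of g], of \<eta>] T O by simp
  let ?R = "(ot g S \<star>\<^bsub>H\<^esub> id2 H \<eta>) \<odot>\<^bsub>H\<^esub> (id2 H (oa g (ao \<epsilon> f)) \<star>\<^bsub>H\<^esub> aa \<eta> \<eta>)"
  have "?R \<odot>\<^bsub>H\<^esub> (to (T3 x) f \<star>\<^bsub>H\<^esub> id2 H \<eta>) = ?R \<odot>\<^bsub>H\<^esub> (to (T3 x') f \<star>\<^bsub>H\<^esub> id2 H \<eta>)"
    using x(8) x'(8) T O by simp
  then have "to (T3 x) f \<star>\<^bsub>H\<^esub> id2 H \<eta> = to (T3 x') f \<star>\<^bsub>H\<^esub> id2 H \<eta>"
    by (rule H.vcmp_cancel_left[OF H.invertible_vcmp[OF R1 R2], rotated -1]) (use T O in auto)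
  then have "to (T3 x) f = to (T3 x') f"
    by (rule H.precomp_faithful[OF \<eta>, rotated -1]) (use T O in auto)
  then have "T3 x = T3 x'"
    by (rule whisker_faithful[OF x(1), rotated -1]) (use T O in auto)
  with assms show ?thesis by (cases x; cases x') auto
qed

lemma weak_inverse_cong:
  assumes fg: "weak_inverse f g" and th: "equivalence H \<theta> g' g"
  shows "weak_inverse f g'"
proof -
  note t = weak_inverse_simps[OF fg]
  note tt = H.equivalence_arrow[OF th] H.equivalence_Ob[OF th]
  have g': "dom0 G g' = cod0 G f" "cod0 G g' = dom0 G f"
    using dom0_trg[of \<theta>] cod0_trg[of \<theta>] t tt by auto
  have "equivalence H (ao \<theta> f) (oo g' f) (oo g f)" "equivalence H (oa f \<theta>) (oo f g') (oo f g)"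
    using whisker_equivalence[OF t(1) th] g' by auto
  then show ?thesis
    using fg g' tt t H.equivalence_comp unfolding weak_inverse_def by blast
qed

section \<open>1-cells modulo equivalence, and their isomorphisms\<close>

lemma pi_rel_iff:
  "(f, g) \<in> pi_rel G X Y \<longleftrightarrow>
    f \<in> Ob H \<and> dom0 G f = X \<and> cod0 G f = Y \<and> (\<exists>e. equivalence H e f g)"
proof -
  have "g \<in> Ob H \<and> dom0 G g = dom0 G f \<and> cod0 G g = cod0 G f" if "equivalence H e f g" for e
    using H.equivalence_arrow[OF that] dom0_trg[of e] cod0_trg[of e] by auto
  then show ?thesis
    unfolding pi_rel_def equivalent_obs_def equivalence_hom by auto
qed

lemma pi_rel_refl: "f \<in> Ob (hom G X Y) \<Longrightarrow> (f, f) \<in> pi_rel G X Y"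
  using H.equivalence_id1[of f] unfolding pi_rel_iff by (simp, blast)

lemma equiv_pi_rel: "equiv (Ob (hom G X Y)) (pi_rel G X Y)"
proof (rule equivI)
  show "pi_rel G X Y \<subseteq> Ob (hom G X Y) \<times> Ob (hom G X Y)" by (auto simp: pi_rel_def)
  show "refl_on (Ob (hom G X Y)) (pi_rel G X Y)"
    using pi_rel_refl unfolding refl_on_def by blast
  show "sym (pi_rel G X Y)"
  proof (rule symI)
    fix f g assume a: "(f, g) \<in> pi_rel G X Y"
    then obtain e where "equivalence H e f g" unfolding pi_rel_iff by blast
    then obtain e' where "equivalence H e' g f" by (rule H.equivalence_inverse)
    then show "(g, f) \<in> pi_rel G X Y" using a by (auto simp: pi_rel_def equivalent_obs_def equivalence_hom)
  qed
  show "trans (pi_rel G X Y)"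
    using H.equivalence_comp unfolding trans_def pi_rel_iff by blast
qed

lemma pi_rel_class_eq_iff:
  assumes "f \<in> Ob (hom G X Y)" "g \<in> Ob (hom G X Y)"
  shows "pi_rel G X Y `` {f} = pi_rel G X Y `` {g} \<longleftrightarrow> (\<exists>e. equivalence H e f g)"
  using eq_equiv_class_iff[OF equiv_pi_rel assms] assms by (simp add: pi_rel_iff)

text \<open>Whiskering preserves equivalences, so all the classes in the union defining
  \<open>pi_comp\<close> coincide.\<close>

lemma pi_comp_class:
  assumes f: "f \<in> Ob (hom G X Y)" and g: "g \<in> Ob (hom G Y Z)"
  shows "pi_comp G X Y Z (pi_rel G Y Z `` {g}) (pi_rel G X Y `` {f}) = pi_rel G X Z `` {oo g f}"
proof -
  have "pi_rel G X Z `` {oo g' f'} = pi_rel G X Z `` {oo g f}"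
    if rel: "(f, f') \<in> pi_rel G X Y" "(g, g') \<in> pi_rel G Y Z" for f' g'
  proof -
    obtain d e where d: "equivalence H d f f'" and e: "equivalence H e g g'"
      using rel unfolding pi_rel_iff by blast
    have o: "f' \<in> Ob (hom G X Y)" "g' \<in> Ob (hom G Y Z)" using rel by (auto simp: pi_rel_def)
    have "equivalence H (ao e f) (oo g f) (oo g' f)" "equivalence H (oa g' d) (oo g' f) (oo g' f')"
      using whisker_equivalence(1)[OF _ e, of f] whisker_equivalence(2)[OF _ d, of g'] f g o by auto
    then have "equivalence H (oa g' d \<cdot>\<^bsub>H\<^esub> ao e f) (oo g f) (oo g' f')"
      by (rule H.equivalence_comp)
    then show ?thesis using pi_rel_class_eq_iff[of "oo g f" X Z "oo g' f'"] f g o by auto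
  qed
  moreover have "(f, f) \<in> pi_rel G X Y" "(g, g) \<in> pi_rel G Y Z"
    using f g pi_rel_refl by blast+
  ultimately show ?thesis unfolding pi_comp_def by blast
qed

lemma pi_iso_class:
  assumes fg: "weak_inverse f g" and X: "dom0 G f = X" "cod0 G f = Y"
  shows "pi_iso G (pi_rel G X Y `` {f}) X Y"
proof -
  note t = weak_inverse_simps[OF fg]
  have o: "f \<in> Ob (hom G X Y)" "g \<in> Ob (hom G Y X)" "X \<in> Obj G" "Y \<in> Obj G" using t X by auto
  have "pi_rel G X Y `` {f} \<in> pi_hom G X Y" "pi_rel G Y X `` {g} \<in> pi_hom G Y X"
    using o unfolding pi_hom_def by (auto intro: quotientI)
  moreover have "pi_comp G X Y X (pi_rel G Y X `` {g}) (pi_rel G X Y `` {f}) = pi_id G X"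
    "pi_comp G Y X Y (pi_rel G X Y `` {f}) (pi_rel G Y X `` {g}) = pi_id G Y"
    unfolding pi_comp_class[OF o(1,2)] pi_comp_class[OF o(2,1)] pi_id_def
    using fg o X pi_rel_class_eq_iff[of "oo g f" X X "unit0 G X"]
      pi_rel_class_eq_iff[of "oo f g" Y Y "unit0 G Y"] by (auto simp: weak_inverse_def)
  ultimately show ?thesis unfolding pi_iso_def by blast
qed

text \<open>Stated for an arbitrary representative \<open>f\<close> of the class, so that a
  representative can be exchanged for an equivalent one later without losing invertibility.\<close>

lemma pi_isoE:
  assumes "pi_iso G u X Y" "f \<in> u" and O: "X \<in> Obj G" "Y \<in> Obj G"
  obtains g where "weak_inverse f g" "dom0 G f = X" "cod0 G f = Y" "u = pi_rel G X Y `` {f}"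
proof -
  obtain v where u: "u \<in> pi_hom G X Y" and v: "v \<in> pi_hom G Y X"
    "pi_comp G X Y X v u = pi_id G X" "pi_comp G Y X Y u v = pi_id G Y"
    using assms unfolding pi_iso_def by blast
  obtain f' where f': "u = pi_rel G X Y `` {f'}" "f' \<in> Ob (hom G X Y)"
    using u unfolding pi_hom_def by (rule quotientE)
  then have "(f', f) \<in> pi_rel G X Y" using assms by blast
  then have f: "u = pi_rel G X Y `` {f}" "f \<in> Ob (hom G X Y)"
    using equiv_class_eq[OF equiv_pi_rel] f' by (auto simp: pi_rel_def)
  obtain g where g: "v = pi_rel G Y X `` {g}" "g \<in> Ob (hom G Y X)"
    using v unfolding pi_hom_def by (elim quotientE)
  have "\<exists>e. equivalence H e (oo g f) (unit0 G X)" "\<exists>e. equivalence H e (oo f g) (unit0 G Y)"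
    using v(2,3) pi_rel_class_eq_iff[of "oo g f" X X "unit0 G X"]
      pi_rel_class_eq_iff[of "oo f g" Y Y "unit0 G Y"] f g O
    unfolding f(1) g(1) pi_id_def pi_comp_class[OF f(2) g(2)] pi_comp_class[OF g(2) f(2)] by auto
  then show ?thesis using that f g by (auto simp: weak_inverse_def)
qed

lemma adjoint_biequivalence_exists:
  assumes fg: "weak_inverse f g" and X: "dom0 G f = X" "cod0 G f = Y"
  obtains x where "adjoint_biequivalence G x X Y" "fwd x = f"
proof -
  obtain e where e: "equivalence H e (oo g f) (unit0 G X)"
    using fg X by (auto simp: weak_inverse_def)
  obtain \<eta> where \<eta>: "equivalence H \<eta> (unit0 G X) (oo g f)"
    by (rule H.equivalence_inverse[OF e])
  obtain \<epsilon> S where \<epsilon>: "equivalence H \<epsilon> (oo f g) (unit0 G Y)"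
    and S: "invertible_cell H S (ao \<epsilon> f \<cdot>\<^bsub>H\<^esub> oa f \<eta>) (id1 H f)"
    using counit_exists[OF fg X(1) \<eta>] X by auto
  obtain \<eta>' where \<eta>': "adjoint_equivalence H \<eta>' (unit0 G X) (oo g f)" "ladj \<eta>' = \<eta>"
    using H.adjoint_equivalence_exists[OF \<eta>] .
  obtain \<epsilon>' where \<epsilon>': "adjoint_equivalence H \<epsilon>' (oo f g) (unit0 G Y)" "ladj \<epsilon>' = \<epsilon>"
    using H.adjoint_equivalence_exists[OF \<epsilon>] .
  obtain T where "adjoint_biequivalence G \<lparr>fwd = f, bwd = g, eta = \<eta>', eps = \<epsilon>', S3 = S, T3 = T\<rparr> X Y"
    using adjoint_biequivalence_T_exists[OF fg X \<eta>'(1) \<epsilon>'(1), of S] S \<eta>'(2) \<epsilon>'(2) by auto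
  then show ?thesis by (rule that) simp
qed

end

section \<open>Lifting along Gray-functors\<close>

context gray_functor
begin

abbreviation "F0 \<equiv> on_ob (on_hom F)"
abbreviation "F1 \<equiv> on_ar (on_hom F)"
abbreviation "F2 \<equiv> on_ce (on_hom F)"

declare map_Obj [simp] map_unit [simp]

lemma map_Ob [simp]:
  assumes "f \<in> Ob source.H"
  shows "F0 f \<in> Ob target.H" "dom0 B (F0 f) = on_Obj F (dom0 A f)" "cod0 B (F0 f) = on_Obj F (cod0 A f)"
    "F1 (id1 source.H f) = id1 target.H (F0 f)"
  using two_functor.map_ob[OF map_hom[of "dom0 A f" "cod0 A f"], of f]
    two_functor.map_id1[OF map_hom[of "dom0 A f" "cod0 A f"], of f] assms by auto

lemma map_Ar [simp]:
  assumes "\<alpha> \<in> Ar source.H"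
  shows "F1 \<alpha> \<in> Ar target.H" "src target.H (F1 \<alpha>) = F0 (src source.H \<alpha>)"
    "trg target.H (F1 \<alpha>) = F0 (trg source.H \<alpha>)"
    "\<beta> \<in> Ar source.H \<Longrightarrow> trg source.H \<alpha> = src source.H \<beta> \<Longrightarrow>
      F1 (\<beta> \<cdot>\<^bsub>source.H\<^esub> \<alpha>) = F1 \<beta> \<cdot>\<^bsub>target.H\<^esub> F1 \<alpha>"
    "F2 (id2 source.H \<alpha>) = id2 target.H (F1 \<alpha>)"
proof -
  let ?X = "dom0 A (src source.H \<alpha>)" and ?Y = "cod0 A (src source.H \<alpha>)"
  interpret P: two_functor "hom A ?X ?Y" "hom B (on_Obj F ?X) (on_Obj F ?Y)" "on_hom F"
    using assms by (intro map_hom) auto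
  show "F1 \<alpha> \<in> Ar target.H" "src target.H (F1 \<alpha>) = F0 (src source.H \<alpha>)"
    "trg target.H (F1 \<alpha>) = F0 (trg source.H \<alpha>)" "F2 (id2 source.H \<alpha>) = id2 target.H (F1 \<alpha>)"
    using P.map_typing(1-3)[of \<alpha>] P.map_id2[of \<alpha>] assms by auto
  show "F1 (\<beta> \<cdot>\<^bsub>source.H\<^esub> \<alpha>) = F1 \<beta> \<cdot>\<^bsub>target.H\<^esub> F1 \<alpha>"
    if "\<beta> \<in> Ar source.H" "trg source.H \<alpha> = src source.H \<beta>"
    using P.map_cmp(1)[of \<alpha> \<beta>] assms that source.dom0_trg[of \<alpha>] source.cod0_trg[of \<alpha>] by simp
qed

lemma map_Ce [simp]:
  assumes "\<sigma> \<in> Ce source.H"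
  shows "F2 \<sigma> \<in> Ce target.H" "dom2 target.H (F2 \<sigma>) = F1 (dom2 source.H \<sigma>)"
    "cod2 target.H (F2 \<sigma>) = F1 (cod2 source.H \<sigma>)"
    "\<tau> \<in> Ce source.H \<Longrightarrow> cod2 source.H \<sigma> = dom2 source.H \<tau> \<Longrightarrow>
      F2 (\<tau> \<odot>\<^bsub>source.H\<^esub> \<sigma>) = F2 \<tau> \<odot>\<^bsub>target.H\<^esub> F2 \<sigma>"
    "\<tau> \<in> Ce source.H \<Longrightarrow> trg source.H (dom2 source.H \<sigma>) = src source.H (dom2 source.H \<tau>) \<Longrightarrow>
      F2 (\<tau> \<star>\<^bsub>source.H\<^esub> \<sigma>) = F2 \<tau> \<star>\<^bsub>target.H\<^esub> F2 \<sigma>"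
proof -
  let ?a = "dom2 source.H \<sigma>"
  let ?X = "dom0 A (src source.H ?a)" and ?Y = "cod0 A (src source.H ?a)"
  interpret P: two_functor "hom A ?X ?Y" "hom B (on_Obj F ?X) (on_Obj F ?Y)" "on_hom F"
    using assms by (intro map_hom) auto
  show "F2 \<sigma> \<in> Ce target.H" "dom2 target.H (F2 \<sigma>) = F1 (dom2 source.H \<sigma>)"
    "cod2 target.H (F2 \<sigma>) = F1 (cod2 source.H \<sigma>)"
    using P.map_typing(4-6)[of \<sigma>] assms by auto
  show "F2 (\<tau> \<odot>\<^bsub>source.H\<^esub> \<sigma>) = F2 \<tau> \<odot>\<^bsub>target.H\<^esub> F2 \<sigma>"
    if "\<tau> \<in> Ce source.H" "cod2 source.H \<sigma> = dom2 source.H \<tau>"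
    using P.map_cmp(2)[of \<sigma> \<tau>] assms that source.H.src_cod2[of \<sigma>] by simp
  show "F2 (\<tau> \<star>\<^bsub>source.H\<^esub> \<sigma>) = F2 \<tau> \<star>\<^bsub>target.H\<^esub> F2 \<sigma>"
    if "\<tau> \<in> Ce source.H" "trg source.H (dom2 source.H \<sigma>) = src source.H (dom2 source.H \<tau>)"
    using P.map_cmp(3)[of \<sigma> \<tau>] assms that source.dom0_trg[of ?a] source.cod0_trg[of ?a] by simp
qed

lemma map_whisker [simp]:
  "f \<in> Ob source.H \<Longrightarrow> g \<in> Ob source.H \<Longrightarrow> cod0 A f = dom0 A g \<Longrightarrow>
    F0 (source.oo g f) = target.oo (F0 g) (F0 f)"
  "f \<in> Ob source.H \<Longrightarrow> \<beta> \<in> Ar source.H \<Longrightarrow> cod0 A f = dom0 A (src source.H \<beta>) \<Longrightarrow>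
    F1 (source.ao \<beta> f) = target.ao (F1 \<beta>) (F0 f)"
  "\<alpha> \<in> Ar source.H \<Longrightarrow> g \<in> Ob source.H \<Longrightarrow> cod0 A (src source.H \<alpha>) = dom0 A g \<Longrightarrow>
    F1 (source.oa g \<alpha>) = target.oa (F0 g) (F1 \<alpha>)"
  "f \<in> Ob source.H \<Longrightarrow> \<Gamma> \<in> Ce source.H \<Longrightarrow> cod0 A f = dom0 A (src source.H (dom2 source.H \<Gamma>)) \<Longrightarrow>
    F2 (source.to \<Gamma> f) = target.to (F2 \<Gamma>) (F0 f)"
  "\<Gamma> \<in> Ce source.H \<Longrightarrow> g \<in> Ob source.H \<Longrightarrow> cod0 A (src source.H (dom2 source.H \<Gamma>)) = dom0 A g \<Longrightarrow>
    F2 (source.ot g \<Gamma>) = target.ot (F0 g) (F2 \<Gamma>)"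
  "\<alpha> \<in> Ar source.H \<Longrightarrow> \<beta> \<in> Ar source.H \<Longrightarrow> cod0 A (src source.H \<alpha>) = dom0 A (src source.H \<beta>) \<Longrightarrow>
    F2 (source.aa \<beta> \<alpha>) = target.aa (F1 \<beta>) (F1 \<alpha>)"
  using map_oo[of f "dom0 A f" "cod0 A f" g] map_ao[of f "dom0 A f" "cod0 A f" \<beta>]
    map_oa[of \<alpha> "dom0 A (src source.H \<alpha>)" "cod0 A (src source.H \<alpha>)" g]
    map_to[of f "dom0 A f" "cod0 A f" \<Gamma>]
    map_ot[of \<Gamma> "dom0 A (src source.H (dom2 source.H \<Gamma>))" "cod0 A (src source.H (dom2 source.H \<Gamma>))" g]
    map_aa[of \<alpha> "dom0 A (src source.H \<alpha>)" "cod0 A (src source.H \<alpha>)" \<beta>] by auto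

lemma map_invertible:
  assumes "invertible_cell source.H \<sigma> f g"
  shows "invertible_cell target.H (F2 \<sigma>) (F1 f) (F1 g)"
  using two_functor.map_invertible_cell[OF map_hom[of "dom0 A (src source.H f)" "cod0 A (src source.H f)"],
      of \<sigma> f g] assms source.H.invertible_cell_Ar[OF assms]
  by (simp add: source.invertible_cell_hom target.invertible_cell_hom)

lemma map_equiv:
  assumes "equivalence source.H f x y"
  shows "equivalence target.H (F1 f) (F0 x) (F0 y)"
  using two_functor.map_equivalence[OF map_hom[of "dom0 A x" "cod0 A x"], of f x y]
    assms source.H.equivalence_Ob[OF assms]
  by (simp add: source.equivalence_hom target.equivalence_hom)

lemma map_adj_equiv:
  assumes "adjoint_equivalence source.H e x y"
  shows "adjoint_equivalence target.H (map_adjeq (on_hom F) e) (F0 x) (F0 y)"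
  using two_functor.map_adjoint_equivalence[OF map_hom[of "dom0 A x" "cod0 A x"], of e x y]
    assms source.H.equivalence_Ob[OF source.H.adjoint_equivalence_equivalence[OF assms]]
  by (simp add: source.adjoint_equivalence_hom target.adjoint_equivalence_hom)

lemma map_adjoint_biequivalence:
  assumes "adjoint_biequivalence A x X Y"
  shows "adjoint_biequivalence B (map_adjbieq F x) (on_Obj F X) (on_Obj F Y)"
proof -
  note x = source.adjoint_biequivalenceD[OF assms]
  note t = source.weak_inverse_simps[OF x(1)] x(2,3)
    source.H.equivalence_arrow[OF source.H.adjoint_equivalence_equivalence[OF x(4)]]
    source.H.equivalence_arrow[OF source.H.adjoint_equivalence_equivalence[OF x(5)]]
    source.H.invertible_cell_simps[OF x(6)] source.H.invertible_cell_simps[OF x(7)]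
  have O: "X \<in> Obj A" "Y \<in> Obj A" using t by auto
  have "(id2 source.H (ladj (eps x)) \<star>\<^bsub>source.H\<^esub> source.to (S3 x) (bwd x))
      \<odot>\<^bsub>source.H\<^esub> (source.aa (ladj (eps x)) (ladj (eps x)) \<star>\<^bsub>source.H\<^esub>
        id2 source.H (source.oa (fwd x) (source.ao (ladj (eta x)) (bwd x))))
      \<odot>\<^bsub>source.H\<^esub> (id2 source.H (ladj (eps x)) \<star>\<^bsub>source.H\<^esub> source.ot (fwd x) (T3 x))
      = id2 source.H (ladj (eps x))"
    using assms unfolding adjoint_biequivalence_def by (simp add: Let_def)
  from arg_cong[OF this, of F2] arg_cong[OF x(8), of F2] map_adj_equiv[OF x(4)] map_adj_equiv[OF x(5)]
    map_invertible[OF x(6)] map_invertible[OF x(7)] t O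
  show ?thesis
    unfolding adjoint_biequivalence_def target.adjoint_equivalence_hom target.invertible_cell_hom
      map_adjbieq_def map_adjeq_def Let_def by simp
qed

lemma lift_equivalence:
  assumes fib: "locally_fibration A B F" and e: "e \<in> Ob source.H" "equivalence target.H f b (F0 e)"
  obtains e' f' where "equivalence source.H f' e' e" "F0 e' = b" "F1 f' = f"
proof -
  let ?X = "dom0 A e" and ?Y = "cod0 A e"
  have "two_fibration (hom A ?X ?Y) (hom B (on_Obj F ?X) (on_Obj F ?Y)) (on_hom F)"
    using fib e unfolding locally_fibration_def by simp
  moreover have "equivalence (hom B (on_Obj F ?X) (on_Obj F ?Y)) f b (F0 e)"
    using e target.dom0_trg[of f] target.cod0_trg[of f] target.H.equivalence_arrow[OF e(2)]
    by (simp add: target.equivalence_hom)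
  moreover have "e \<in> Ob (hom A ?X ?Y)" using e by simp
  ultimately obtain e' f' where "equivalence (hom A ?X ?Y) f' e' e" "F0 e' = b" "F1 f' = f"
    unfolding two_fibration_def by blast
  then show ?thesis using that by (auto simp: source.equivalence_hom)
qed

lemma lift_invertible:
  assumes fib: "locally_fibration A B F" and f: "f \<in> Ar source.H" "invertible_cell target.H \<beta> g (F1 f)"
  obtains g' \<beta>' where "invertible_cell source.H \<beta>' g' f" "F1 g' = g" "F2 \<beta>' = \<beta>"
proof -
  let ?X = "dom0 A (src source.H f)" and ?Y = "cod0 A (src source.H f)"
  have "two_fibration (hom A ?X ?Y) (hom B (on_Obj F ?X) (on_Obj F ?Y)) (on_hom F)"
    using fib f unfolding locally_fibration_def by simp
  moreover have "invertible_cell (hom B (on_Obj F ?X) (on_Obj F ?Y)) \<beta> g (F1 f)"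
    using f target.H.invertible_cell_Ar[OF f(2)] by (simp add: target.invertible_cell_hom)
  moreover have "f \<in> Ar (hom A ?X ?Y)" using f by simp
  ultimately obtain g' \<beta>' where "invertible_cell (hom A ?X ?Y) \<beta>' g' f" "F1 g' = g" "F2 \<beta>' = \<beta>"
    unfolding two_fibration_def by blast
  then show ?thesis using that by (auto simp: source.invertible_cell_hom)
qed

lemma lift_adjoint_equivalence:
  assumes fib: "locally_fibration A B F" and f: "equivalence source.H f a b"
    and e: "adjoint_equivalence target.H e (F0 a) (F0 b)" "F1 f = ladj e"
  obtains e' where "adjoint_equivalence source.H e' a b" "ladj e' = f" "map_adjeq (on_hom F) e' = e"
proof -
  let ?X = "dom0 A a" and ?Y = "cod0 A a"
  note t = source.H.equivalence_Ob[OF f]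
  have "two_fibration (hom A ?X ?Y) (hom B (on_Obj F ?X) (on_Obj F ?Y)) (on_hom F)"
    using fib t unfolding locally_fibration_def by simp
  moreover have "equivalence (hom A ?X ?Y) f a b"
    "adjoint_equivalence (hom B (on_Obj F ?X) (on_Obj F ?Y)) e (F0 a) (F0 b)"
    using f e t by (auto simp: source.equivalence_hom target.adjoint_equivalence_hom)
  ultimately obtain e' where "adjoint_equivalence (hom A ?X ?Y) e' a b" "ladj e' = f"
    "map_adjeq (on_hom F) e' = e"
    using e(2) by (rule two_fibration_lift_adjoint_equivalence)
  then show ?thesis using that by (simp add: source.adjoint_equivalence_hom)
qed

lemma pi_map_class:
  assumes f: "f \<in> Ob (hom A X Y)"
  shows "pi_map B F X Y (pi_rel A X Y `` {f}) = pi_rel B (on_Obj F X) (on_Obj F Y) `` {F0 f}"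
proof -
  have "pi_rel B (on_Obj F X) (on_Obj F Y) `` {F0 f'} = pi_rel B (on_Obj F X) (on_Obj F Y) `` {F0 f}"
    if f': "(f, f') \<in> pi_rel A X Y" for f'
  proof -
    obtain e where e: "equivalence source.H e f f'" using f' unfolding source.pi_rel_iff by blast
    have "f' \<in> Ob (hom A X Y)" using f' by (auto simp: pi_rel_def)
    then show ?thesis
      using target.pi_rel_class_eq_iff[of "F0 f" "on_Obj F X" "on_Obj F Y" "F0 f'"] map_equiv[OF e] f
      by auto
  qed
  moreover have "(f, f) \<in> pi_rel A X Y"
    using f by (rule source.pi_rel_refl)
  ultimately show ?thesis unfolding pi_map_def by blast
qed

section \<open>The two implications\<close>

lemma gray_fibration_if_lifting:
  assumes lift: "adjoint_biequivalence_lifting A B F" and fib: "locally_fibration A B F"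
  shows "gray_fibration A B F"
  unfolding gray_fibration_def
proof (intro conjI ballI allI impI)
  show "gray_functor A B F" by (rule gray_functor_axioms)
  show "locally_fibration A B F" by (rule fib)
next
  fix X Y u assume X: "X \<in> Obj A" and Y: "Y \<in> Obj B" and u: "pi_iso B u Y (on_Obj F X)"
  obtain f where "f \<in> u"
    using u in_quotient_imp_non_empty[OF target.equiv_pi_rel] unfolding pi_iso_def pi_hom_def by blast
  then obtain g where fg: "target.weak_inverse f g" "dom0 B f = Y" "cod0 B f = on_Obj F X"
    "u = pi_rel B Y (on_Obj F X) `` {f}"
    using target.pi_isoE[OF u] X Y by auto
  obtain x where x: "adjoint_biequivalence B x Y (on_Obj F X)" "fwd x = f"
    using target.adjoint_biequivalence_exists[OF fg(1-3)] .
  obtain X' x' where x': "X' \<in> Obj A" "adjoint_biequivalence A x' X' X" "on_Obj F X' = Y"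
    "map_adjbieq F x' = x"
    using lift x X Y unfolding adjoint_biequivalence_lifting_def by blast
  note w = source.adjoint_biequivalenceD(1-3)[OF x'(2)]
  have "F0 (fwd x') = f" using x'(4) x(2) by (auto simp: map_adjbieq_def)
  then have "pi_map B F X' X (pi_rel A X' X `` {fwd x'}) = u"
    using pi_map_class[of "fwd x'" X' X] source.weak_inverse_simps[OF w(1)] w fg x'(3) by simp
  with source.pi_iso_class[OF w] x'(1,3)
  show "\<exists>X'\<in>Obj A. \<exists>u'. pi_iso A u' X' X \<and> on_Obj F X' = Y \<and> pi_map B F X' X u' = u" by blast
qed

lemma lifting_if_gray_fibration:
  assumes gf: "gray_fibration A B F"
  shows "adjoint_biequivalence_lifting A B F"
  unfolding adjoint_biequivalence_lifting_def
proof (intro ballI allI impI)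
  fix X Y x assume X: "X \<in> Obj A" and Y: "Y \<in> Obj B" and x: "adjoint_biequivalence B x Y (on_Obj F X)"
  have fib: "locally_fibration A B F" using gf unfolding gray_fibration_def by blast
  define f g \<eta> \<epsilon> S where "f = fwd x" "g = bwd x" "\<eta> = ladj (eta x)" "\<epsilon> = ladj (eps x)" "S = S3 x"
  note defs = this
  note xD = target.adjoint_biequivalenceD[OF x, folded defs]
  note t = target.weak_inverse_simps[OF xD(1)] xD(2,3)
  have \<eta>: "equivalence target.H \<eta> (unit0 B Y) (target.oo g f)"
    and \<epsilon>: "equivalence target.H \<epsilon> (target.oo f g) (unit0 B (on_Obj F X))"
    using target.H.adjoint_equivalence_equivalence[OF xD(4)]
      target.H.adjoint_equivalence_equivalence[OF xD(5)] by (auto simp: defs)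
  note \<eta>t = target.H.equivalence_arrow[OF \<eta>] and \<epsilon>t = target.H.equivalence_arrow[OF \<epsilon>]

  \<comment> \<open>Lifting \<open>f\<close>\<close>
  obtain X' u' where X': "X' \<in> Obj A" "pi_iso A u' X' X" "on_Obj F X' = Y"
    and u': "pi_map B F X' X u' = pi_rel B Y (on_Obj F X) `` {f}"
    using target.pi_iso_class[OF xD(1-3)] gf X Y unfolding gray_fibration_def by blast
  obtain f0 where f0: "f0 \<in> u'"
    using X'(2) in_quotient_imp_non_empty[OF source.equiv_pi_rel] unfolding pi_iso_def pi_hom_def by blast
  obtain g1 where fg1: "source.weak_inverse f0 g1" "dom0 A f0 = X'" "cod0 A f0 = X"
    "u' = pi_rel A X' X `` {f0}"
    using source.pi_isoE[OF X'(2) f0 X'(1) X] .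
  note t0 = source.weak_inverse_simps[OF fg1(1)]
  have "pi_rel B Y (on_Obj F X) `` {F0 f0} = pi_rel B Y (on_Obj F X) `` {f}"
    using u' pi_map_class[of f0 X' X] t0 fg1 X' by simp
  then obtain k where "equivalence target.H k (F0 f0) f"
    using target.pi_rel_class_eq_iff[of "F0 f0" Y "on_Obj F X" f] t t0 fg1 X' by auto
  \<comment> \<open>The direction is reversed because an equivalence lifts only along its target,
    here the image of \<open>f0\<close>.\<close>
  then obtain k where "equivalence target.H k f (F0 f0)"
    by (rule target.H.equivalence_inverse)
  then obtain f' k' where f': "equivalence source.H k' f' f0" "F0 f' = f"
    using lift_equivalence[OF fib t0(1)] by blast
  \<comment> \<open>\<open>f'\<close> is another representative of the invertible class
    \<open>u'\<close>. Its pseudo-inverse \<open>g0\<close> is arbitrary; nothing relates its image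
    to \<open>g\<close> yet.\<close>
  obtain g0 where fg0: "source.weak_inverse f' g0" "dom0 A f' = X'" "cod0 A f' = X"
  proof -
    note k' = source.H.equivalence_arrow[OF f'(1)] source.H.equivalence_Ob[OF f'(1)]
    have "(f', f0) \<in> pi_rel A X' X"
      using f'(1) k' source.dom0_trg[of k'] source.cod0_trg[of k'] fg1 by (auto simp: source.pi_rel_iff)
    then have "f' \<in> u'"
      unfolding fg1(4) using equivE[OF source.equiv_pi_rel[of X' X]] by (auto dest: symD)
    with source.pi_isoE[OF X'(2) _ X'(1) X] that show ?thesis by blast
  qed
  note t0 = source.weak_inverse_simps[OF fg0(1)] fg0(2,3)

  \<comment> \<open>Lifting \<open>g\<close> and \<eta>\<close>
  obtain \<eta>0 where \<eta>0: "equivalence source.H \<eta>0 (unit0 A X') (source.oo g0 f')"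
  proof -
    obtain h where h: "equivalence source.H h (source.oo g0 f') (unit0 A X')"
      using fg0 by (auto simp: source.weak_inverse_def)
    show ?thesis by (rule source.H.equivalence_inverse[OF h]) (rule that)
  qed
  note \<eta>0t = source.H.equivalence_arrow[OF \<eta>0]
  have F\<eta>0: "equivalence target.H (F1 \<eta>0) (unit0 B Y) (target.oo (F0 g0) f)"
    using map_equiv[OF \<eta>0] t0 X' f' by simp
  \<comment> \<open>Compares the prescribed pair \<open>(g, \<eta>)\<close> with the image of
    \<open>(g0, \<eta>0)\<close>. As \<theta> ends at the image of \<open>g0\<close>, it can be
    lifted to an equivalence out of some \<open>g'\<close> over \<open>g\<close>.\<close>
  obtain \<theta> \<sigma> where \<theta>: "equivalence target.H \<theta> g (F0 g0)"
    and \<sigma>: "invertible_cell target.H \<sigma> (target.ao \<theta> f \<cdot>\<^bsub>target.H\<^esub> \<eta>) (F1 \<eta>0)"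
    using target.unit_transport[OF xD(1,2) \<eta> _ _ _ F\<eta>0] t t0 X' by auto
  note \<theta>t = target.H.equivalence_arrow[OF \<theta>]
  obtain g' \<theta>' where \<theta>': "equivalence source.H \<theta>' g' g0" "F0 g' = g" "F1 \<theta>' = \<theta>"
    using lift_equivalence[OF fib t0(2) \<theta>] .
  note \<theta>'t = source.H.equivalence_arrow[OF \<theta>'(1)] source.H.equivalence_Ob[OF \<theta>'(1)]
  have fg: "source.weak_inverse f' g'" by (rule source.weak_inverse_cong[OF fg0(1) \<theta>'(1)])
  note t' = source.weak_inverse_simps[OF fg] fg0(2,3)
  have \<theta>f: "equivalence source.H (source.ao \<theta>' f') (source.oo g' f') (source.oo g0 f')"
    using source.whisker_equivalence(1)[OF t0(1) \<theta>'(1)] t' by simp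
  obtain r \<tau> where r: "equivalence source.H r (source.oo g0 f') (source.oo g' f')"
    and \<tau>: "invertible_cell source.H \<tau> (source.ao \<theta>' f' \<cdot>\<^bsub>source.H\<^esub> r) (id1 source.H (source.oo g0 f'))"
    by (rule source.H.equivalence_inverse[OF \<theta>f])
  note rt = source.H.equivalence_arrow[OF r]
  \<comment> \<open>\<open>\<eta>0\<close> belongs to \<open>g0\<close> and must be moved to
    \<open>g'\<close>, against the direction of \<open>\<theta>'f'\<close>; hence the pseudo-inverse
    \<open>r\<close>.\<close>
  define \<eta>1 where "\<eta>1 = r \<cdot>\<^bsub>source.H\<^esub> \<eta>0"
  have \<eta>1: "equivalence source.H \<eta>1 (unit0 A X') (source.oo g' f')"
    unfolding \<eta>1_def by (rule source.H.equivalence_comp[OF \<eta>0 r])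
  note \<eta>1t = source.H.equivalence_arrow[OF \<eta>1]
  have "invertible_cell source.H (\<tau> \<star>\<^bsub>source.H\<^esub> id2 source.H \<eta>0)
      (source.ao \<theta>' f' \<cdot>\<^bsub>source.H\<^esub> \<eta>1) \<eta>0"
    using source.H.invertible_whisker(2)[OF \<tau>, of \<eta>0] \<eta>0t rt t0 t' \<theta>'t by (simp add: \<eta>1_def)
  from map_invertible[OF this]
  obtain \<rho> where \<rho>: "invertible_cell target.H \<rho> (F1 \<eta>0) (target.ao \<theta> f \<cdot>\<^bsub>target.H\<^esub> F1 \<eta>1)"
    using \<eta>1t \<theta>'t t' \<theta>' f' by (auto elim: target.H.invertible_cell_inverse)
  have \<theta>fB: "equivalence target.H (target.ao \<theta> f) (target.oo g f) (target.oo (F0 g0) f)"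
    using target.whisker_equivalence(1)[OF t(1) \<theta>] t by simp
  \<comment> \<open>\<sigma> and \<rho> compose to
    \<open>\<theta>f.\<eta> \<cong> \<theta>f.F\<eta>1\<close>, and the equivalence
    \<open>\<theta>f\<close> is cancelled.\<close>
  obtain \<beta> where \<beta>: "invertible_cell target.H \<beta> \<eta> (F1 \<eta>1)"
    by (rule target.H.postcomp_full[OF \<theta>fB _ _ _ _ _ target.H.invertible_vcmp[OF \<sigma> \<rho>]])
      (use \<eta>t \<eta>1t t' f' \<theta>' X' in auto)
  obtain \<eta>' \<beta>' where \<eta>': "invertible_cell source.H \<beta>' \<eta>' \<eta>1" "F1 \<eta>' = \<eta>"
    using lift_invertible[OF fib \<eta>1t(1) \<beta>] .
  have \<eta>'e: "equivalence source.H \<eta>' (unit0 A X') (source.oo g' f')"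
    by (rule source.H.invertible_cell_inverse[OF \<eta>'(1)]) (rule source.H.equivalence_iso[OF \<eta>1])
  note \<eta>'t = source.H.equivalence_arrow[OF \<eta>'e]
  obtain e where e: "adjoint_equivalence source.H e (unit0 A X') (source.oo g' f')" "ladj e = \<eta>'"
    "map_adjeq (on_hom F) e = eta x"
    using lift_adjoint_equivalence[OF fib \<eta>'e, of "eta x"] xD(4) \<eta>' X' t' f' \<theta>' by (auto simp: defs)

  \<comment> \<open>Lifting \<epsilon> and \<open>S\<close>\<close>
  obtain \<epsilon>0 S0 where \<epsilon>0: "equivalence source.H \<epsilon>0 (source.oo f' g') (unit0 A X)"
    and S0: "invertible_cell source.H S0 (source.ao \<epsilon>0 f' \<cdot>\<^bsub>source.H\<^esub> source.oa f' \<eta>') (id1 source.H f')"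
    using source.counit_exists[OF fg t'(5) \<eta>'e] t' by auto
  note \<epsilon>0t = source.H.equivalence_arrow[OF \<epsilon>0]
  have FS0: "invertible_cell target.H (F2 S0) (target.ao (F1 \<epsilon>0) f \<cdot>\<^bsub>target.H\<^esub> target.oa f \<eta>) (id1 target.H f)"
    using map_invertible[OF S0] \<epsilon>0t \<eta>'t t' X X' f' \<eta>' by simp
  obtain S1 where S1: "invertible_cell target.H S1 (id1 target.H f)
      (target.ao (F1 \<epsilon>0) f \<cdot>\<^bsub>target.H\<^esub> target.oa f \<eta>)" "F2 S0 \<odot>\<^bsub>target.H\<^esub> S1 = id2 target.H (id1 target.H f)"
    by (rule target.H.invertible_cell_inverse[OF FS0])
  have f\<eta>: "equivalence target.H (target.oa f \<eta>) f (target.oo f (target.oo g f))"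
    using target.whisker_equivalence(2)[OF t(1) \<eta>] t Y by simp
  \<comment> \<open>Since \<open>S1\<close> inverts the image of \<open>S0\<close>, the equation
    makes that image, precomposed with \<open>\<delta>.f\<eta>\<close>, equal to \<open>S\<close>.
    So \<delta> is the comparison of \<open>\<epsilon>f\<close> with \<open>F\<epsilon>0.f\<close>
    (the latter a whiskering by \<open>f\<close>) that respects the 3-cells.\<close>
  obtain \<delta> where \<delta>: "invertible_cell target.H \<delta> (target.ao \<epsilon> f) (target.ao (F1 \<epsilon>0) f)"
    "\<delta> \<star>\<^bsub>target.H\<^esub> id2 target.H (target.oa f \<eta>) = S1 \<odot>\<^bsub>target.H\<^esub> S"
    by (rule target.H.precomp_full[OF f\<eta> _ _ _ _ _ target.H.invertible_vcmp[OF xD(6) S1(1)]])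
      (use t \<epsilon>t \<epsilon>0t t' X f' \<theta>' in auto)
  obtain \<phi> where \<phi>: "invertible_cell target.H \<phi> \<epsilon> (F1 \<epsilon>0)" "target.to \<phi> f = \<delta>"
    by (rule target.whisker_full[OF xD(1) _ _ _ _ _ \<delta>(1)]) (use t \<epsilon>t \<epsilon>0t t' X f' \<theta>' in auto)
  obtain \<epsilon>' \<phi>' where \<epsilon>': "invertible_cell source.H \<phi>' \<epsilon>' \<epsilon>0" "F1 \<epsilon>' = \<epsilon>" "F2 \<phi>' = \<phi>"
    using lift_invertible[OF fib \<epsilon>0t(1) \<phi>(1)] .
  have \<epsilon>'e: "equivalence source.H \<epsilon>' (source.oo f' g') (unit0 A X)"
    by (rule source.H.invertible_cell_inverse[OF \<epsilon>'(1)]) (rule source.H.equivalence_iso[OF \<epsilon>0])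
  note \<epsilon>'t = source.H.equivalence_arrow[OF \<epsilon>'e]
  obtain d where d: "adjoint_equivalence source.H d (source.oo f' g') (unit0 A X)" "ladj d = \<epsilon>'"
    "map_adjeq (on_hom F) d = eps x"
    using lift_adjoint_equivalence[OF fib \<epsilon>'e, of "eps x"] xD(5) \<epsilon>' X t' f' \<theta>' by (auto simp: defs)
  \<comment> \<open>\<open>S0\<close> transported along the lifted comparison \<phi>', whose image
    becomes \<delta> when whiskered by \<open>f\<close>; by the choice of \<delta>, the image of
    \<open>S'\<close> is \<open>S\<close>.\<close>
  define S' where "S' = S0 \<odot>\<^bsub>source.H\<^esub> (source.to \<phi>' f' \<star>\<^bsub>source.H\<^esub> id2 source.H (source.oa f' \<eta>'))"
  have "invertible_cell source.H (source.to \<phi>' f' \<star>\<^bsub>source.H\<^esub> id2 source.H (source.oa f' \<eta>'))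
    (source.ao \<epsilon>' f' \<cdot>\<^bsub>source.H\<^esub> source.oa f' \<eta>') (source.ao \<epsilon>0 f' \<cdot>\<^bsub>source.H\<^esub> source.oa f' \<eta>')"
    using source.H.invertible_whisker(2)[OF source.whisker_invertible(1)[OF t'(1) \<epsilon>'(1)],
        of "source.oa f' \<eta>'"] t' \<epsilon>'t \<eta>'t X X' by simp
  from source.H.invertible_vcmp[OF this S0]
  have S': "invertible_cell source.H S' (source.ao (ladj d) f' \<cdot>\<^bsub>source.H\<^esub> source.oa f' (ladj e)) (id1 source.H f')"
    unfolding S'_def d(2) e(2) .
  have "F2 S' = F2 S0 \<odot>\<^bsub>target.H\<^esub> (\<delta> \<star>\<^bsub>target.H\<^esub> id2 target.H (target.oa f \<eta>))"
    unfolding S'_def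
    using t' \<epsilon>'t \<epsilon>0t \<eta>'t X X' source.H.invertible_cell_simps[OF S0] source.H.invertible_cell_simps[OF \<epsilon>'(1)]
      \<phi>(2) \<epsilon>' f' \<eta>' by simp
  also have "\<dots> = (F2 S0 \<odot>\<^bsub>target.H\<^esub> S1) \<odot>\<^bsub>target.H\<^esub> S"
    unfolding \<delta>(2) by (rule target.H.vcmp_assoc'[symmetric])
      (use target.H.invertible_cell_simps[OF FS0] target.H.invertible_cell_simps[OF S1(1)]
        target.H.invertible_cell_simps[OF xD(6)] in auto)
  also have "\<dots> = S"
    unfolding S1(2) by (rule target.H.vcmp_id) (use target.H.invertible_cell_simps[OF xD(6)] in auto)
  finally have FS': "F2 S' = S" .

  \<comment> \<open>Lifting \<open>T\<close>\<close>
  obtain T where T: "adjoint_biequivalence A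
      \<lparr>fwd = f', bwd = g', eta = e, eps = d, S3 = S', T3 = T\<rparr> X' X" (is "adjoint_biequivalence A ?x' X' X")
    using source.adjoint_biequivalence_T_exists[OF fg t'(5,6) e(1) d(1) S'] .
  \<comment> \<open>Both sides are adjoint biequivalences agreeing in all data except possibly
    \<open>T\<close>, which uniqueness supplies.\<close>
  have "map_adjbieq F ?x' = x"
    by (rule target.adjoint_biequivalence_T_unique[OF map_adjoint_biequivalence[OF T, unfolded X'(3)] x])
      (use f' \<theta>' e d FS' in \<open>auto simp: map_adjbieq_def defs\<close>)
  with T X' show "\<exists>X'\<in>Obj A. \<exists>x'. adjoint_biequivalence A x' X' X \<and> on_Obj F X' = Y \<and> map_adjbieq F x' = x"
    by blast
qed

end

theorem proposition3p5:
  fixes A :: "('o, 'a, 'b, 'c) graycat"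
    and B :: "('p, 'd, 'e, 'f) graycat"
    and F :: "('o, 'a, 'b, 'c, 'p, 'd, 'e, 'f) grayfun"
  assumes "gray_functor A B F"
  shows "gray_fibration A B F \<longleftrightarrow>
    adjoint_biequivalence_lifting A B F \<and> locally_fibration A B F"
proof -
  interpret gray_functor A B F by (rule assms)
  show ?thesis
    using gray_fibration_if_lifting lifting_if_gray_fibration unfolding gray_fibration_def by blast
qed

end
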